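(* Let $a(x)$, $x=1,2,\dots$, be a sequence of integers which is lacunary, i.e. $\liminf_{x\to\infty} \frac{a(x+1)}{a(x)}>1$. Then for almost all real $\alpha$ (with respect to Lebesgue measure), the sequence of fractional parts $\theta_n=\{\alpha a(n)\}\in[0,1)$, $n\ge 1$, has all its local spacing measures equal to those of the Poisson model; that is, with the normalized spacings $\delta_n^{(N)}$ and $\delta_{j,n}^{(N)}$ defined in the context: (1) for every fixed integer $j\ge 1$ and all $0\le A\le B$, $$\lim_{N\to\infty}\frac1N\#\{1\le n\le N-j:\ \delta_{j,n}^{(N)}\in[A,B]\}=\int_A^B \frac{s^{j-1}}{(j-1)!}e^{-s}\,ds$$ (for $j=1$ this says that the nearest-neighbor spacing distribution is $e^{-s}$); (2) for every fixed integer $r\ge1$ and all intervals $[A_i,B_i]$ with $0\le A_i\le B_i$, $i=1,\dots,r$, $$\lim_{N\to\infty}\frac1N\#\{1\le n\le N-r:\ \delta_{n+i-1}^{(N)}\in[A_i,B_i]\text{ for } i=1,\dots,r\}=\prod_{i=1}^r\int_{A_i}^{B_i}e^{-s}\,ds;$$ (3) for every fixed $\lambda>0$ and every integer $k\ge0$, the probability that an interval of length $\lambda/N$ in $\mathbf{R}/\mathbf{Z}$, with uniformly random position, contains exactly $k$ of the elements $\theta_1,\dots,\theta_N$ (counted with index) converges, as $N\to\infty$, to $e^{-\lambda}\frac{\lambda^k}{k!}$.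
   Context: For a sequence $\{\theta_n\}\subset[0,1)$ and $N\ge1$, let $\theta_{1,N}\le\theta_{2,N}\le\dots\le\theta_{N,N}$ be the first $N$ elements $\theta_1,\dots,\theta_N$ arranged in increasing order. The normalized nearest-neighbor spacings are $\delta_n^{(N)}:=N(\theta_{n+1,N}-\theta_{n,N})$, $1\le n\le N-1$, and, for fixed $j\ge1$, the normalized $j$-th neighbor spacings are $\delta_{j,n}^{(N)}:=N(\theta_{n+j,N}-\theta_{n,N})$, $1\le n\le N-j$. The Poisson model is the model of a sequence generated by independent uniformly distributed random points in $[0,1)$. *)

theory Defs
  imports "HOL-Analysis.Analysis"
begin

(* Sequences x = 1, 2, ... are functions on nat whose value at 0 is never used.
   The liminf is taken in the extended reals, so that it may be infinite; it forces
   a x to be nonzero for all large x, and the finitely many other quotients do not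
   affect it. *)
definition lacunary :: "(nat \<Rightarrow> int) \<Rightarrow> bool" where
  "lacunary a \<longleftrightarrow>
     liminf (\<lambda>x. ereal (real_of_int (a (x + 1)) / real_of_int (a x))) > 1"

(* theta_{n,N}, meant for 1 <= n <= N; list positions start at 0. *)
definition ordered :: "(nat \<Rightarrow> real) \<Rightarrow> nat \<Rightarrow> nat \<Rightarrow> real" where
  "ordered \<theta> N n = sort (map \<theta> [1..<N + 1]) ! (n - 1)"

definition spacing :: "(nat \<Rightarrow> real) \<Rightarrow> nat \<Rightarrow> nat \<Rightarrow> real" where
  "spacing \<theta> N n = real N * (ordered \<theta> N (n + 1) - ordered \<theta> N n)"

definition jth_spacing :: "(nat \<Rightarrow> real) \<Rightarrow> nat \<Rightarrow> nat \<Rightarrow> nat \<Rightarrow> real" where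
  "jth_spacing \<theta> N j n = real N * (ordered \<theta> N (n + j) - ordered \<theta> N n)"

(* The class of t in R/Z lies on the image of the closed interval [x, x + L]. *)
definition on_arc :: "real \<Rightarrow> real \<Rightarrow> real \<Rightarrow> bool" where
  "on_arc x L t \<longleftrightarrow> (\<exists>m::int. t + of_int m \<in> {x..x + L})"

definition arc_count :: "(nat \<Rightarrow> real) \<Rightarrow> nat \<Rightarrow> real \<Rightarrow> real \<Rightarrow> nat" where
  "arc_count \<theta> N x L = card {n \<in> {1..N}. on_arc x L (\<theta> n)}"

definition arc_prob :: "(nat \<Rightarrow> real) \<Rightarrow> nat \<Rightarrow> real \<Rightarrow> nat \<Rightarrow> real" where
  "arc_prob \<theta> N L k =
     measure (uniform_measure lborel {0..<1}) {x. arc_count \<theta> N x L = k}"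

end

theory Submission
  imports Defs
begin

text \<open>
Everything is reduced to averages over a randomly placed window.  For a step function \<open>g\<close> with
values in \<open>[0,1]\<close>, let \<open>Z\<^sub>N(\<alpha>)\<close> be the mean over a uniform position \<open>x\<close> of the product over
\<open>n \<le> N\<close> of \<open>1 - g(N(\<alpha> a(n) - x))\<close>, differences being taken modulo 1.  If \<open>g = 1 - z\<^sub>i\<close> on the
\<open>i\<close>-th of finitely many disjoint intervals and \<open>c\<^sub>i\<close> is the number of points in the \<open>i\<close>-th interval
of the window scaled by \<open>1/N\<close> and placed at \<open>x\<close>, then \<open>Z\<^sub>N\<close> is the mean of the product of the
\<open>z\<^sub>i ^ c\<^sub>i\<close>, that is, the joint generating function of the counts.  So \<open>Z\<^sub>N(\<alpha>) \<rightarrow> exp(- \<integral> g)\<close> for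
all \<open>g\<close> says that the counts become independent Poisson variables.

Why this limit holds for almost every \<open>\<alpha>\<close>.  Average over \<open>\<alpha>\<close> and let the points enter one by
one; write \<open>\<tau> = (1/N) \<integral> g\<close> for the mean of the scaled \<open>g\<close>.  The point number \<open>n\<close> is nearly independent of all points with index at
most \<open>n - \<ell>\<close>: moving \<open>\<alpha>\<close> by \<open>t/a(n)\<close> carries \<open>\<alpha> a(n)\<close> once around the circle, but hardly moves
\<open>\<alpha> a(m)\<close> when \<open>a(n)/a(m)\<close> is exponentially large (\<open>dilate_mixing\<close>).  Deleting the points with
indices between \<open>n - \<ell>\<close> and \<open>n\<close> costs only pair probabilities, and these equal \<open>\<tau>\<^sup>2\<close> exactly,
because \<open>(\<alpha>, x) \<mapsto> (\<alpha> a - x, \<alpha> b - x)\<close> preserves the measure of the torus for integers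
\<open>a \<noteq> b\<close> (\<open>pair_independence\<close>).  Hence each new point multiplies the mean by \<open>1 - \<tau>\<close> up to
\<open>O(\<ell> \<tau>\<^sup>2)\<close> and an error exponentially small in \<open>\<ell>\<close>, and after \<open>N\<close> points one is left with \<open>(1 - \<tau>) ^ N\<close> (\<open>first_moment\<close>).  The
square of \<open>Z\<^sub>N\<close> is again an average of such products, for the union of two copies of the window at
distance \<open>v\<close>, so the same estimate controls the variance (\<open>second_moment\<close>).  Along \<open>N = m\<^sup>4\<close> with
\<open>\<ell> = m\<close> the variances are summable, which gives almost sure convergence for countably many \<open>g\<close>;
since \<open>Z\<^sub>N\<close> is Lipschitz in \<open>g\<close> for the \<open>L\<^sup>1\<close> norm, convergence extends to all \<open>N\<close> and all \<open>g\<close>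
(\<open>AE_void_limit\<close>).  Generating functions then determine the joint law (\<open>joint_poisson\<close>).

From windows to spacings.  The third assertion is the case of one interval.  For the other two,
let \<open>D\<close> be a set of points and let \<open>E\<close> be a set of positions \<open>x\<close> such that \<open>[x, x + h/N)\<close> contains
a point of \<open>D\<close>; then \<open>|E| \<le> |D| h/N\<close> (\<open>palm_bound\<close>).  Taking for \<open>E\<close> the positions at which the
counts certify that some point near \<open>x\<close> has its following spacings in prescribed open intervals, and
letting \<open>h \<rightarrow> 0\<close>, one obtains asymptotic lower bounds for the frequencies of spacings.  They are
lower bounds by the masses of a probability measure, so applying them also to the complementary
intervals turns them into limits (\<open>lim_ge_squeeze\<close>).
\<close>

section \<open>Means over the circle\<close>

text \<open>Functions on the circle are periodic functions on the line; \<open>[0,1)\<close> represents the circle.\<close>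

definition circ :: "real measure" where
  "circ = uniform_measure lborel {0..<1}"

text \<open>A binder for the mean over a period, since almost every integral below is of this kind.\<close>

abbreviation circ_mean :: "(real \<Rightarrow> real) \<Rightarrow> real" (binder \<open>MEAN \<close> 10) where
  "circ_mean f \<equiv> integral\<^sup>L circ f"

lemma sets_circ [simp, measurable_cong]: "sets circ = sets borel"
  by (simp add: circ_def)

lemma space_circ [simp]: "space circ = UNIV"
  by (simp add: circ_def)

lemma emeasure_circ: "A \<in> sets borel \<Longrightarrow> emeasure circ A = emeasure lborel ({0..<1} \<inter> A)"
  by (simp add: circ_def divide_ennreal_def)

lemma measure_circ: "A \<in> sets borel \<Longrightarrow> measure circ A = measure lborel ({0..<1} \<inter> A)"
  by (simp add: measure_def emeasure_circ)

lemma measure_circ_UNIV [simp]: "measure circ UNIV = 1"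
  by (simp add: measure_circ)

lemma finite_measure_circ [simp]: "finite_measure circ"
  by standard (simp add: emeasure_circ)

interpretation circ: finite_measure circ by simp

interpretation circ2: pair_sigma_finite circ circ ..

lemma AE_circ_unit: "AE x in circ. 0 \<le> x \<and> x < 1"
  unfolding circ_def by (rule AE_uniform_measureI) auto

lemma nn_integral_circ:
  assumes [measurable]: "f \<in> borel_measurable borel"
  shows "(\<integral>\<^sup>+x. f x \<partial>circ) = (\<integral>\<^sup>+x. f x * indicator {0..<1} x \<partial>lborel)"
  unfolding circ_def by (subst nn_integral_uniform_measure) (auto simp: divide_ennreal_def)

lemma integrable_circ:
  fixes f :: "real \<Rightarrow> real"
  assumes "f \<in> borel_measurable borel" "\<And>x. \<bar>f x\<bar> \<le> B"
  shows "integrable circ f"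
  by (rule circ.integrable_const_bound[where B = B]) (use assms in auto)

lemma abs_integral_circ_le:
  fixes f :: "real \<Rightarrow> real"
  assumes "f \<in> borel_measurable borel" "\<And>x. \<bar>f x\<bar> \<le> B"
  shows "\<bar>MEAN x. f x\<bar> \<le> B"
proof -
  have "\<bar>MEAN x. f x\<bar> \<le> (MEAN x. \<bar>f x\<bar>)" by (rule integral_abs_bound)
  also have "\<dots> \<le> (MEAN x. B)"
    by (rule integral_mono) (use assms in \<open>auto intro: integrable_circ[where B=B]\<close>)
  finally show ?thesis by simp
qed

lemma integral_circ_unit:
  fixes f :: "real \<Rightarrow> real"
  assumes "f \<in> borel_measurable borel" "\<And>x. 0 \<le> f x" "\<And>x. f x \<le> 1"
  shows "0 \<le> circ_mean f" "circ_mean f \<le> 1"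
proof -
  show "0 \<le> circ_mean f" using assms(2) by (intro Bochner_Integration.integral_nonneg)
  have "\<bar>f x\<bar> \<le> 1" for x using assms(2,3)[of x] by simp
  from abs_integral_circ_le[OF assms(1) this] show "circ_mean f \<le> 1" by linarith
qed

lemma integral_circ_swap:
  fixes f :: "real \<Rightarrow> real \<Rightarrow> real"
  assumes f: "case_prod f \<in> borel_measurable (borel \<Otimes>\<^sub>M borel)" and B: "\<And>x y. \<bar>f x y\<bar> \<le> B"
  shows "(MEAN x. (MEAN y. f x y)) = (MEAN y. (MEAN x. f x y))"
proof -
  have "finite_measure (circ \<Otimes>\<^sub>M circ)"
    by (rule finite_measure_pair_measure) auto
  then interpret fm: finite_measure "circ \<Otimes>\<^sub>M circ" .
  have "borel_measurable (circ \<Otimes>\<^sub>M circ) = (borel_measurable (borel \<Otimes>\<^sub>M borel) :: (real \<times> real \<Rightarrow> real) set)"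
    by (rule measurable_cong_sets) (simp_all add: borel_prod)
  with f have "case_prod f \<in> borel_measurable (circ \<Otimes>\<^sub>M circ)" by simp
  then have "integrable (circ \<Otimes>\<^sub>M circ) (case_prod f)"
    by (intro fm.integrable_const_bound[where B = B]) (use B in auto)
  then show ?thesis by (rule circ2.Fubini_integral[symmetric])
qed

lemma borel_measurable_circ_integral [measurable (raw)]:
  fixes f :: "'a \<Rightarrow> real \<Rightarrow> real"
  assumes "case_prod f \<in> borel_measurable (N \<Otimes>\<^sub>M borel)"
  shows "(\<lambda>x. MEAN y. f x y) \<in> borel_measurable N"
proof -
  have "case_prod f \<in> borel_measurable (N \<Otimes>\<^sub>M circ)"
    using assms by (simp cong: measurable_cong_sets sets_pair_measure_cong)
  then show ?thesis by (rule circ.borel_measurable_lebesgue_integral)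
qed

lemma borel_measurable_frac [measurable]: "(frac :: real \<Rightarrow> real) \<in> borel_measurable borel"
  unfolding frac_def[abs_def] by measurable

definition periodic1 :: "(real \<Rightarrow> 'a) \<Rightarrow> bool" where
  "periodic1 f \<longleftrightarrow> (\<forall>x. f (x + 1) = f x)"

lemma periodic1_nat: "periodic1 f \<Longrightarrow> f (x + real n) = f x"
proof (induction n)
  case (Suc n)
  have "f (x + real (Suc n)) = f ((x + real n) + 1)" by (simp add: algebra_simps)
  also have "\<dots> = f x" using Suc by (simp add: periodic1_def)
  finally show ?case .
qed simp

lemma periodic1_int: "periodic1 f \<Longrightarrow> f (x + of_int k) = f x"
  using periodic1_nat[of f x "nat k"] periodic1_nat[of f "x + of_int k" "nat (-k)"]
  by (cases "k \<ge> 0") auto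

lemma periodic1_frac: "periodic1 f \<Longrightarrow> f (frac x) = f x"
  using periodic1_int[of f "frac x" "\<lfloor>x\<rfloor>"] by (simp add: frac_def)

lemma nn_integral_circ_mult:
  assumes [measurable]: "f \<in> borel_measurable borel" and f: "periodic1 f" and k: "k > (0::nat)"
  shows "(\<integral>\<^sup>+x. f (real k * x) \<partial>circ) = (\<integral>\<^sup>+x. f x \<partial>circ)"
proof -
  have shift: "(\<integral>\<^sup>+x. f x * indicator {real j..<real j + 1} x \<partial>lborel) = (\<integral>\<^sup>+x. f x \<partial>circ)" for j
  proof -
    have "(\<integral>\<^sup>+x. f x * indicator {real j..<real j + 1} x \<partial>lborel)
        = (\<integral>\<^sup>+x. f (real j + 1 * x) * indicator {real j..<real j + 1} (real j + 1 * x) \<partial>lborel)"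
      by (subst nn_integral_real_affine[of _ 1 "real j"]) auto
    also have "\<dots> = (\<integral>\<^sup>+x. f x * indicator {0..<1} x \<partial>lborel)"
      by (intro nn_integral_cong) (use periodic1_nat[OF f] in \<open>auto simp: indicator_def add.commute\<close>)
    finally show ?thesis by (simp add: nn_integral_circ)
  qed
  have split: "(\<integral>\<^sup>+x. f x * indicator {0..<real j} x \<partial>lborel) = of_nat j * (\<integral>\<^sup>+x. f x \<partial>circ)" for j
  proof (induction j)
    case (Suc j)
    have "(\<integral>\<^sup>+x. f x * indicator {0..<real (Suc j)} x \<partial>lborel)
       = (\<integral>\<^sup>+x. f x * indicator {0..<real j} x + f x * indicator {real j..<real j + 1} x \<partial>lborel)"
      by (intro nn_integral_cong) (auto simp: indicator_def)
    also have "\<dots> = of_nat (Suc j) * (\<integral>\<^sup>+x. f x \<partial>circ)"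
      by (subst nn_integral_add) (simp, simp, simp only: Suc shift, simp add: distrib_right add.commute)
    finally show ?case .
  qed simp
  have "of_nat k * (\<integral>\<^sup>+x. f x \<partial>circ) = (\<integral>\<^sup>+x. f x * indicator {0..<real k} x \<partial>lborel)"
    by (simp add: split)
  also have "\<dots> = ennreal \<bar>real k\<bar> * (\<integral>\<^sup>+x. f (0 + real k * x) * indicator {0..<real k} (0 + real k * x) \<partial>lborel)"
    by (subst nn_integral_real_affine[of _ "real k" 0]) (use k in auto)
  also have "(\<integral>\<^sup>+x. f (0 + real k * x) * indicator {0..<real k} (0 + real k * x) \<partial>lborel)
     = (\<integral>\<^sup>+x. f (real k * x) * indicator {0..<1} x \<partial>lborel)"
    by (intro nn_integral_cong) (use k in \<open>auto simp: indicator_def zero_le_mult_iff\<close>)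
  also have "\<dots> = (\<integral>\<^sup>+x. f (real k * x) \<partial>circ)"
    by (simp add: nn_integral_circ)
  also have "ennreal \<bar>real k\<bar> = of_nat k" by (simp add: ennreal_of_nat_eq_real_of_nat)
  finally show ?thesis
    using k by (subst (asm) ennreal_mult_cancel_left) auto
qed

lemma nn_integral_circ_shift:
  assumes [measurable]: "f \<in> borel_measurable borel" and f: "periodic1 f"
  shows "(\<integral>\<^sup>+x. f (x + t) \<partial>circ) = (\<integral>\<^sup>+x. f x \<partial>circ)"
proof -
  define u where "u = frac t"
  have u: "0 \<le> u" "u < 1" by (auto simp: u_def frac_lt_1)
  have tu: "f (x + t) = f (x + u)" for x
    using periodic1_int[OF f, of "x + u" "\<lfloor>t\<rfloor>"] by (simp add: u_def frac_def)
  have "(\<integral>\<^sup>+x. f (x + t) \<partial>circ) = (\<integral>\<^sup>+x. f (u + 1 * x) * indicator {u..<u + 1} (u + 1 * x) \<partial>lborel)"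
    by (subst nn_integral_circ) (auto simp: tu add.commute indicator_def intro!: nn_integral_cong)
  also have "\<dots> = (\<integral>\<^sup>+x. f x * indicator {u..<u + 1} x \<partial>lborel)"
    by (subst (2) nn_integral_real_affine[of _ 1 u]) auto
  also have "\<dots> = (\<integral>\<^sup>+x. f x * indicator {u..<1} x + f x * indicator {1..<u + 1} x \<partial>lborel)"
    using u by (intro nn_integral_cong) (auto simp: indicator_def)
  also have "\<dots> = (\<integral>\<^sup>+x. f x * indicator {u..<1} x \<partial>lborel) + (\<integral>\<^sup>+x. f x * indicator {1..<u + 1} x \<partial>lborel)"
    by (rule nn_integral_add) auto
  also have "(\<integral>\<^sup>+x. f x * indicator {1..<u + 1} x \<partial>lborel)
     = (\<integral>\<^sup>+x. f (1 + 1 * x) * indicator {1..<u + 1} (1 + 1 * x) \<partial>lborel)"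
    by (subst nn_integral_real_affine[of _ 1 1]) auto
  also have "\<dots> = (\<integral>\<^sup>+x. f x * indicator {0..<u} x \<partial>lborel)"
    using f by (intro nn_integral_cong) (auto simp: indicator_def periodic1_def add.commute)
  also have "(\<integral>\<^sup>+x. f x * indicator {u..<1} x \<partial>lborel) + \<dots>
     = (\<integral>\<^sup>+x. f x * indicator {u..<1} x + f x * indicator {0..<u} x \<partial>lborel)"
    by (rule nn_integral_add[symmetric]) auto
  also have "\<dots> = (\<integral>\<^sup>+x. f x \<partial>circ)"
    using u by (subst nn_integral_circ) (auto simp: indicator_def intro!: nn_integral_cong)
  finally show ?thesis .
qed

lemma nn_integral_circ_uminus:
  assumes [measurable]: "f \<in> borel_measurable borel" and f: "periodic1 f"
  shows "(\<integral>\<^sup>+x. f (- x) \<partial>circ) = (\<integral>\<^sup>+x. f x \<partial>circ)"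
proof -
  have "(\<integral>\<^sup>+x. f x \<partial>circ) = ennreal \<bar>-1\<bar> * (\<integral>\<^sup>+x. f (1 + (-1) * x) * indicator {0..<1} (1 + (-1) * x) \<partial>lborel)"
    by (subst nn_integral_circ, simp, subst nn_integral_real_affine[of _ "-1" 1]) auto
  also have "\<dots> = (\<integral>\<^sup>+x. f (- x) * indicator {0<..1} x \<partial>lborel)"
    using periodic1_int[OF f, of _ 1] by (auto simp: indicator_def intro!: nn_integral_cong)
       (metis add.commute uminus_add_conv_diff)
  also have "\<dots> = (\<integral>\<^sup>+x. f (- x) * indicator {0..<1} x \<partial>lborel)"
  proof (rule nn_integral_cong_AE)
    show "AE x in lborel. f (- x) * indicator {0<..1} x = f (- x) * indicator {0..<1} x"
      using AE_lborel_singleton[of 0] AE_lborel_singleton[of 1]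
      by eventually_elim (auto simp: indicator_def)
  qed
  finally show ?thesis by (simp add: nn_integral_circ)
qed

text \<open>A map of the circle that preserves the integrals of nonnegative periodic functions preserves the
measure.  This transfers the invariance properties from nonnegative integrals to signed ones.\<close>

lemma distr_circI:
  assumes [measurable]: "T \<in> borel_measurable borel"
    and "\<And>f :: real \<Rightarrow> ennreal. f \<in> borel_measurable borel \<Longrightarrow> periodic1 f \<Longrightarrow> (\<integral>\<^sup>+x. f (T x) \<partial>circ) = (\<integral>\<^sup>+x. f x \<partial>circ)"
  shows "distr circ borel (\<lambda>x. frac (T x)) = distr circ borel frac"
proof (rule measure_eqI)
  fix A assume "A \<in> sets (distr circ borel (\<lambda>x. frac (T x)))"
  then have A [measurable]: "A \<in> sets borel" by simp
  have [measurable]: "(\<lambda>x. indicator A (frac x) :: ennreal) \<in> borel_measurable borel" by measurable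
  have "(\<integral>\<^sup>+x. indicator A (frac (T x)) \<partial>circ) = (\<integral>\<^sup>+x. indicator A (frac x) \<partial>circ)"
    by (rule assms(2)) (auto simp: periodic1_def frac_1_eq)
  then show "emeasure (distr circ borel (\<lambda>x. frac (T x))) A = emeasure (distr circ borel frac) A"
    by (subst (1 2) nn_integral_indicator[symmetric], simp, simp)
       (subst (1 2) nn_integral_distr; simp)
qed auto

lemma integral_circ_transform:
  fixes f :: "real \<Rightarrow> real"
  assumes [measurable]: "f \<in> borel_measurable borel" and f: "periodic1 f"
    and [measurable]: "T \<in> borel_measurable borel"
    and "\<And>f :: real \<Rightarrow> ennreal. f \<in> borel_measurable borel \<Longrightarrow> periodic1 f \<Longrightarrow> (\<integral>\<^sup>+x. f (T x) \<partial>circ) = (\<integral>\<^sup>+x. f x \<partial>circ)"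
  shows "(MEAN x. f (T x)) = circ_mean f"
proof -
  have "(MEAN x. f (T x)) = integral\<^sup>L (distr circ borel (\<lambda>x. frac (T x))) f"
    by (subst integral_distr) (auto simp: periodic1_frac[OF f])
  also have "\<dots> = integral\<^sup>L (distr circ borel frac) f"
    using distr_circI[of T] assms by metis
  also have "\<dots> = circ_mean f"
    by (subst integral_distr) (auto simp: periodic1_frac[OF f])
  finally show ?thesis .
qed

lemma integral_circ_shift:
  fixes f :: "real \<Rightarrow> real"
  assumes "f \<in> borel_measurable borel" "periodic1 f"
  shows "(MEAN x. f (x + t)) = circ_mean f"
  by (rule integral_circ_transform[OF assms]) (auto intro: nn_integral_circ_shift)

lemma integral_circ_reflect:
  fixes f :: "real \<Rightarrow> real"
  assumes "f \<in> borel_measurable borel" "periodic1 f"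
  shows "(MEAN x. f (- x)) = circ_mean f"
  by (rule integral_circ_transform[OF assms]) (auto intro: nn_integral_circ_uminus)

lemma periodic1_uminus: "periodic1 f \<Longrightarrow> periodic1 (\<lambda>x. f (- x))"
  using periodic1_int[of f _ "-1"] by (auto simp: periodic1_def)

lemma periodic1_shift: "periodic1 f \<Longrightarrow> periodic1 (\<lambda>x. f (x + t))"
  by (auto simp: periodic1_def) (metis add.assoc add.commute)

lemma periodic1_cmult: "periodic1 f \<Longrightarrow> periodic1 (\<lambda>x. f (of_int k * x + t))"
  using periodic1_int[of f _ k] by (auto simp: periodic1_def algebra_simps) (metis add.assoc add.commute)

lemma integral_circ_reflect_shift:
  fixes f :: "real \<Rightarrow> real"
  assumes [measurable]: "f \<in> borel_measurable borel" and f: "periodic1 f"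
  shows "(MEAN x. f (t - x)) = circ_mean f"
  using integral_circ_reflect[of "\<lambda>x. f (x + t)"] integral_circ_shift[OF assms] periodic1_shift[OF f]
  by (simp add: add.commute)

text \<open>Multiplication by a nonzero integer winds the circle around itself a whole number of times, so it
preserves the uniform distribution.\<close>

lemma integral_circ_mult:
  fixes f :: "real \<Rightarrow> real"
  assumes [measurable]: "f \<in> borel_measurable borel" and f: "periodic1 f" and k: "k \<noteq> 0"
  shows "(MEAN x. f (of_int k * x + t)) = circ_mean f"
proof -
  have pos: "(MEAN x. g (real j * x)) = (MEAN x. g x)"
    if [measurable]: "g \<in> borel_measurable borel" and g: "periodic1 g" and "j > 0" for g :: "real \<Rightarrow> real" and j :: nat
    by (rule integral_circ_transform[OF that(1,2)]) (use that in \<open>auto intro: nn_integral_circ_mult\<close>)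
  have "(MEAN x. f (of_int k * x + t)) = (MEAN x. f (x + t))"
  proof (cases "k > 0")
    case True
    then show ?thesis using pos[of "\<lambda>x. f (x + t)" "nat k"] periodic1_shift[OF f] by simp
  next
    case False
    have "(MEAN x. f (of_int k * x + t)) = (MEAN x. f (- (real (nat (-k)) * x) + t))"
      using False by simp
    also have "\<dots> = (MEAN x. f (- x + t))"
      by (rule pos[of "\<lambda>x. f (- x + t)" "nat (-k)"])
         (use False k periodic1_uminus[OF periodic1_shift[OF f, of t]] in auto)
    also have "\<dots> = (MEAN x. f (x + t))"
      by (rule integral_circ_reflect[of "\<lambda>x. f (x + t)"]) (use periodic1_shift[OF f] in auto)
    finally show ?thesis .
  qed
  then show ?thesis using integral_circ_shift[OF assms(1,2)] by simp
qed

section \<open>Quasi-independence of lacunary dilates\<close>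

text \<open>The periodic functions that describe a (possibly weighted) target on the circle.\<close>

definition circle_fun :: "(real \<Rightarrow> real) \<Rightarrow> bool" where
  "circle_fun G \<longleftrightarrow> G \<in> borel_measurable borel \<and> periodic1 G \<and> (\<forall>x. 0 \<le> G x \<and> G x \<le> 1)"

lemma circle_funD:
  assumes "circle_fun G"
  shows "G \<in> borel_measurable borel" "periodic1 G" "0 \<le> G x" "G x \<le> 1" "\<bar>G x\<bar> \<le> 1" "\<bar>1 - G x\<bar> \<le> 1"
  using assms by (auto simp: circle_fun_def abs_le_iff intro: order_trans)

lemma circle_fun_mean:
  assumes "circle_fun G"
  shows "0 \<le> circ_mean G" "circ_mean G \<le> 1"
  using assms integral_circ_unit[of G] by (auto simp: circle_fun_def)

lemma circle_fun_reflect_shift: "circle_fun G \<Longrightarrow> circle_fun (\<lambda>x. G (x - t))"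
  using periodic1_shift[of G "-t"] by (auto simp: circle_fun_def)

lemma abs_integral_circ_diff_le:
  fixes f g :: "real \<Rightarrow> real"
  assumes [measurable]: "f \<in> borel_measurable borel" "g \<in> borel_measurable borel"
    and B: "\<And>x. \<bar>f x\<bar> \<le> B" "\<And>x. \<bar>g x\<bar> \<le> B"
  shows "\<bar>(circ_mean f) - (MEAN x. g x)\<bar> \<le> (MEAN x. \<bar>f x - g x\<bar>)"
proof -
  have "circ_mean f - (MEAN x. g x) = (MEAN x. f x - g x)"
    using B by (intro Bochner_Integration.integral_diff[symmetric] integrable_circ[where B=B]) auto
  then show ?thesis by (metis integral_abs_bound)
qed

text \<open>Translating \<open>\<alpha>\<close> by \<open>t/k\<close> does not change the mean of \<open>P(\<alpha>) F(k \<alpha>)\<close>.  If it does not change \<open>P\<close>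
much either, then averaging over \<open>t\<close> replaces \<open>F\<close> by its mean.\<close>

lemma dilate_mixing:
  fixes P F :: "real \<Rightarrow> real"
  assumes P: "circle_fun P" and F: "circle_fun F" and k: "k \<noteq> 0"
    and \<epsilon>: "\<And>t. 0 \<le> t \<Longrightarrow> t \<le> 1 \<Longrightarrow> (MEAN \<alpha>. \<bar>P (\<alpha> + t / of_int k) - P \<alpha>\<bar>) \<le> \<epsilon>"
  shows "\<bar>(MEAN \<alpha>. P \<alpha> * F (of_int k * \<alpha>)) - circ_mean P * circ_mean F\<bar> \<le> \<epsilon>"
proof -
  note [measurable] = circle_funD(1)[OF P] circle_funD(1)[OF F]
  have PF: "\<bar>P x * F y\<bar> \<le> 1" for x y
    using circle_funD(3,4)[OF P, of x] circle_funD(3,4)[OF F, of y] by (simp add: abs_mult mult_le_one)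
  \<comment> \<open>\<open>A\<close> does not depend on \<open>t\<close>, whereas the mean of \<open>B\<close> over \<open>t\<close> is the product of the means.\<close>
  define A where "A t = (MEAN \<alpha>. P (\<alpha> + t / of_int k) * F (of_int k * \<alpha> + t))" for t
  define B where "B t = (MEAN \<alpha>. P \<alpha> * F (of_int k * \<alpha> + t))" for t
  have [measurable]: "A \<in> borel_measurable borel" "B \<in> borel_measurable borel"
    unfolding A_def B_def by measurable
  have per: "periodic1 (\<lambda>\<alpha>. P \<alpha> * F (of_int k * \<alpha>))"
    using circle_funD(2)[OF P] periodic1_cmult[OF circle_funD(2)[OF F], of k 0] by (simp add: periodic1_def)
  have A: "A t = (MEAN \<alpha>. P \<alpha> * F (of_int k * \<alpha>))" for t
    using integral_circ_shift[OF _ per, of "t / of_int k"] k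
    by (simp add: A_def distrib_left)
  have "circ_mean B = (MEAN \<alpha>. (MEAN t. P \<alpha> * F (of_int k * \<alpha> + t)))"
    unfolding B_def by (rule integral_circ_swap[where B=1]) (use PF in auto)
  also have "\<dots> = (MEAN \<alpha>. P \<alpha> * circ_mean F)"
    using integral_circ_shift[OF circle_funD(1,2)[OF F], of "of_int k * \<alpha>" for \<alpha>]
    by (simp add: add.commute[of "of_int k * _"])
  finally have B: "circ_mean B = circ_mean P * circ_mean F" by simp
  have bA: "\<bar>A t\<bar> \<le> 1" and bB: "\<bar>B t\<bar> \<le> 1" for t
    unfolding A_def B_def by (rule abs_integral_circ_le; use PF in auto)+
  have AB: "\<bar>A t - B t\<bar> \<le> \<epsilon>" if t: "0 \<le> t" "t \<le> 1" for t
  proof -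
    have "\<bar>A t - B t\<bar> \<le> (MEAN \<alpha>. \<bar>P (\<alpha> + t / of_int k) * F (of_int k * \<alpha> + t) - P \<alpha> * F (of_int k * \<alpha> + t)\<bar>)"
      unfolding A_def B_def by (rule abs_integral_circ_diff_le[where B=1]) (use PF in auto)
    also have "\<dots> \<le> (MEAN \<alpha>. \<bar>P (\<alpha> + t / of_int k) - P \<alpha>\<bar>)"
    proof (rule integral_mono)
      have P2: "\<bar>P x - P y\<bar> \<le> 1" for x y
        using circle_funD(3,4)[OF P, of x] circle_funD(3,4)[OF P, of y] by linarith
      show le: "\<bar>P (\<alpha> + t / of_int k) * F (of_int k * \<alpha> + t) - P \<alpha> * F (of_int k * \<alpha> + t)\<bar>
          \<le> \<bar>P (\<alpha> + t / of_int k) - P \<alpha>\<bar>" for \<alpha>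
        using circle_funD(3-5)[OF F, of "of_int k * \<alpha> + t"]
        by (simp add: left_diff_distrib[symmetric] abs_mult mult_left_le)
      show "integrable circ (\<lambda>\<alpha>. \<bar>P (\<alpha> + t / of_int k) - P \<alpha>\<bar>)"
        by (rule integrable_circ[where B=1]) (use P2 in auto)
      show "integrable circ (\<lambda>\<alpha>. \<bar>P (\<alpha> + t / of_int k) * F (of_int k * \<alpha> + t) - P \<alpha> * F (of_int k * \<alpha> + t)\<bar>)"
        by (rule integrable_circ[where B=1]) (use P2 le in \<open>auto intro: order_trans\<close>)
    qed
    finally show ?thesis using \<epsilon>[OF t] by linarith
  qed
  have "\<bar>(MEAN t. A t) - circ_mean B\<bar> \<le> (MEAN t. \<bar>A t - B t\<bar>)"
    by (rule abs_integral_circ_diff_le[where B=1]) (use bA bB in auto)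
  also have "\<dots> \<le> (MEAN t. \<epsilon>)"
  proof (rule integral_mono_AE)
    have "\<bar>A t - B t\<bar> \<le> 2" for t using bA[of t] bB[of t] by linarith
    then show "integrable circ (\<lambda>t. \<bar>A t - B t\<bar>)"
      by (intro integrable_circ[where B=2]) auto
    show "AE t in circ. \<bar>A t - B t\<bar> \<le> \<epsilon>"
      using AE_circ_unit by eventually_elim (auto intro: AB)
  qed simp
  finally show ?thesis by (simp add: A B)
qed

text \<open>Two distinct dilates, observed from the same random position, are exactly independent: after the
translation \<open>x \<mapsto> x + a \<alpha>\<close> only the multiple \<open>(b - a) \<alpha>\<close> is left, which is uniform.\<close>

lemma pair_independence:
  fixes F G :: "real \<Rightarrow> real"
  assumes F: "circle_fun F" and G: "circle_fun G" and ab: "a \<noteq> b"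
  shows "(MEAN x. (MEAN \<alpha>. F (of_int a * \<alpha> - x) * G (of_int b * \<alpha> - x))) = circ_mean F * circ_mean G"
proof -
  note [measurable] = circle_funD(1)[OF F] circle_funD(1)[OF G]
  have FG: "\<bar>F x * G y\<bar> \<le> 1" for x y
    using circle_funD(3,4)[OF F, of x] circle_funD(3,4)[OF G, of y] by (simp add: abs_mult mult_le_one)
  have inner: "(MEAN x. F (of_int a * \<alpha> - x) * G (of_int b * \<alpha> - x))
      = (MEAN y. F (- y) * G (of_int (b - a) * \<alpha> - y))" for \<alpha>
  proof -
    have "periodic1 (\<lambda>y. F (- y) * G (of_int (b - a) * \<alpha> - y))"
      using periodic1_uminus[OF circle_funD(2)[OF F]]
        periodic1_uminus[OF periodic1_shift[OF circle_funD(2)[OF G], of "of_int (b - a) * \<alpha>"]]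
      by (simp add: periodic1_def)
    from integral_circ_shift[OF _ this, of "- (of_int a * \<alpha>)"] show ?thesis
      by (simp add: algebra_simps)
  qed
  have "(MEAN x. (MEAN \<alpha>. F (of_int a * \<alpha> - x) * G (of_int b * \<alpha> - x)))
      = (MEAN \<alpha>. (MEAN x. F (of_int a * \<alpha> - x) * G (of_int b * \<alpha> - x)))"
    by (rule integral_circ_swap[where B=1]) (use FG in auto)
  also have "\<dots> = (MEAN \<alpha>. (MEAN y. F (- y) * G (of_int (b - a) * \<alpha> - y)))"
    by (simp only: inner)
  also have "(MEAN \<alpha>. (MEAN y. F (- y) * G (of_int (b - a) * \<alpha> - y)))
      = (MEAN y. (MEAN \<alpha>. F (- y) * G (of_int (b - a) * \<alpha> - y)))"
    by (rule integral_circ_swap[where B=1]) (use FG in auto)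
  also have "\<dots> = (MEAN y. F (- y) * circ_mean G)"
    using integral_circ_mult[OF circle_funD(1,2)[OF G], of "b - a" "- y" for y] ab by simp
  also have "\<dots> = circ_mean F * circ_mean G"
    using integral_circ_reflect[OF circle_funD(1,2)[OF F]] by simp
  finally show ?thesis .
qed

text \<open>Deleting factors from a product costs at most the sum of the deleted deviations from 1.\<close>

lemma prod_one_minus_diff:
  fixes u :: "nat \<Rightarrow> real"
  assumes u: "\<And>m. 0 \<le> u m" "\<And>m. u m \<le> 1" and jn: "j \<le> n"
  shows "0 \<le> (\<Prod>m<j. 1 - u m) - (\<Prod>m<n. 1 - u m)"
    "(\<Prod>m<j. 1 - u m) - (\<Prod>m<n. 1 - u m) \<le> (\<Sum>m\<in>{j..<n}. u m)"
proof -
  have b: "0 \<le> (\<Prod>m<n. 1 - u m) \<and> (\<Prod>m<n. 1 - u m) \<le> 1" for n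
    using u by (auto intro!: prod_nonneg prod_le_1)
  have "0 \<le> (\<Prod>m<j. 1 - u m) - (\<Prod>m<n. 1 - u m) \<and>
    (\<Prod>m<j. 1 - u m) - (\<Prod>m<n. 1 - u m) \<le> (\<Sum>m\<in>{j..<n}. u m)"
    using jn
  proof (induction n rule: dec_induct)
    case (step n)
    have "0 \<le> (\<Prod>m<n. 1 - u m) * u n" "(\<Prod>m<n. 1 - u m) * u n \<le> u n"
      using b[of n] u[of n] by (auto intro: mult_left_le_one_le)
    then show ?case using step by (auto simp: algebra_simps)
  qed simp
  then show "0 \<le> (\<Prod>m<j. 1 - u m) - (\<Prod>m<n. 1 - u m)"
    "(\<Prod>m<j. 1 - u m) - (\<Prod>m<n. 1 - u m) \<le> (\<Sum>m\<in>{j..<n}. u m)" by auto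
qed

text \<open>A lacunary sequence with an initial segment removed: beyond some index the terms are nonzero and
their absolute values grow at least geometrically, with ratio \<open>1/q\<close>.\<close>

locale separated_dilates =
  fixes b :: "nat \<Rightarrow> int" and q :: real
  assumes q: "0 < q" "q < 1" and b_nonzero: "b n \<noteq> 0"
    and b_decay: "m \<le> n \<Longrightarrow> \<bar>of_int (b m)\<bar> \<le> q ^ (n - m) * \<bar>of_int (b n) :: real\<bar>"
begin

lemma b_distinct: "m < n \<Longrightarrow> b m \<noteq> b n"
proof
  assume "m < n" "b m = b n"
  then have "\<bar>of_int (b n)\<bar> \<le> q ^ (n - m) * \<bar>of_int (b n) :: real\<bar>" using b_decay[of m n] by simp
  moreover have "q ^ (n - m) < 1" using q \<open>m < n\<close> by (simp add: power_Suc_less_one power_less_one_iff)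
  moreover have "\<bar>of_int (b n) :: real\<bar> > 0" using b_nonzero by simp
  ultimately show False using mult_strict_right_mono[of "q^(n-m)" 1 "\<bar>of_int (b n) :: real\<bar>"] by simp
qed

definition avoid :: "(real \<Rightarrow> real) \<Rightarrow> nat \<Rightarrow> real \<Rightarrow> real" where
  "avoid G n \<alpha> = (\<Prod>m<n. 1 - G (of_int (b m) * \<alpha>))"

lemma avoid_circle_fun: assumes G: "circle_fun G" shows "circle_fun (avoid G n)"
proof -
  note [measurable] = circle_funD(1)[OF G]
  have "avoid G n \<in> borel_measurable borel" unfolding avoid_def by measurable
  moreover have "periodic1 (avoid G n)"
    using periodic1_cmult[OF circle_funD(2)[OF G], of _ 0] by (simp add: avoid_def periodic1_def)
  moreover have "0 \<le> avoid G n \<alpha> \<and> avoid G n \<alpha> \<le> 1" for \<alpha>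
    using circle_funD(3,4)[OF G] by (auto simp: avoid_def intro!: prod_nonneg prod_le_1)
  ultimately show ?thesis by (simp add: circle_fun_def)
qed

text \<open>The variation of the product is the sum of the variations of its factors, and the \<open>m\<close>-th factor is
a dilate by \<open>b m\<close>.\<close>

lemma avoid_modulus:
  assumes G: "circle_fun G" and C: "\<And>s. (MEAN \<beta>. \<bar>G (\<beta> + s) - G \<beta>\<bar>) \<le> C * \<bar>s\<bar>"
  shows "(MEAN \<alpha>. \<bar>avoid G n (\<alpha> + s) - avoid G n \<alpha>\<bar>) \<le> C * (\<Sum>m<n. \<bar>of_int (b m)\<bar>) * \<bar>s\<bar>"
proof -
  note [measurable] = circle_funD(1)[OF G] circle_funD(1)[OF avoid_circle_fun[OF G]]
  have G1: "\<bar>G x - G y\<bar> \<le> 1" for x y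
    using circle_funD(3,4)[OF G, of x] circle_funD(3,4)[OF G, of y] by linarith
  let ?d = "\<lambda>m \<alpha>. \<bar>G (of_int (b m) * \<alpha> + of_int (b m) * s) - G (of_int (b m) * \<alpha>)\<bar>"
  have int: "integrable circ (?d m)" for m
    by (rule integrable_circ[where B=1]) (use G1 in auto)
  have le: "\<bar>avoid G n (\<alpha> + s) - avoid G n \<alpha>\<bar> \<le> (\<Sum>m<n. ?d m \<alpha>)" for \<alpha>
  proof -
    have "norm (avoid G n (\<alpha> + s) - avoid G n \<alpha>)
      \<le> (\<Sum>m<n. norm ((1 - G (of_int (b m) * (\<alpha> + s))) - (1 - G (of_int (b m) * \<alpha>))))"
      unfolding avoid_def by (rule norm_prod_diff) (use circle_funD(6)[OF G] in auto)
    also have "\<dots> = (\<Sum>m<n. ?d m \<alpha>)"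
      by (intro sum.cong) (auto simp: distrib_left)
    finally show ?thesis by simp
  qed
  have "(MEAN \<alpha>. \<bar>avoid G n (\<alpha> + s) - avoid G n \<alpha>\<bar>) \<le> (MEAN \<alpha>. (\<Sum>m<n. ?d m \<alpha>))"
    by (rule integral_mono') (use le int in \<open>auto intro!: Bochner_Integration.integrable_sum sum_nonneg\<close>)
  also have "\<dots> = (\<Sum>m<n. (MEAN \<alpha>. ?d m \<alpha>))"
    by (rule Bochner_Integration.integral_sum) (rule int)
  also have "\<dots> \<le> (\<Sum>m<n. C * \<bar>of_int (b m) * s\<bar>)"
  proof (rule sum_mono)
    fix m
    have "periodic1 (\<lambda>\<beta>. \<bar>G (\<beta> + of_int (b m) * s) - G \<beta>\<bar>)"
      using periodic1_shift[OF circle_funD(2)[OF G], of "of_int (b m) * s"] circle_funD(2)[OF G]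
      by (simp add: periodic1_def)
    from integral_circ_mult[OF _ this b_nonzero, of m 0]
    have "(MEAN \<alpha>. ?d m \<alpha>) = (MEAN \<beta>. \<bar>G (\<beta> + of_int (b m) * s) - G \<beta>\<bar>)" by simp
    with C show "(MEAN \<alpha>. ?d m \<alpha>) \<le> C * \<bar>of_int (b m) * s\<bar>" by simp
  qed
  also have "\<dots> = C * (\<Sum>m<n. \<bar>of_int (b m)\<bar>) * \<bar>s\<bar>"
    by (simp add: abs_mult sum_distrib_left sum_distrib_right mult_ac)
  finally show ?thesis .
qed

lemma sum_b_ratio:
  shows "(\<Sum>m<n - g. \<bar>of_int (b m)\<bar>) / \<bar>of_int (b n)\<bar> \<le> q ^ g / (1 - q)"
proof -
  have "(\<Sum>m<n - g. \<bar>of_int (b m)\<bar>) / \<bar>of_int (b n)\<bar> = (\<Sum>m<n - g. \<bar>of_int (b m)\<bar> / \<bar>of_int (b n) :: real\<bar>)"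
    by (simp add: sum_divide_distrib)
  also have "\<dots> \<le> (\<Sum>m<n - g. q ^ g * q ^ (n - g - Suc m))"
  proof (rule sum_mono)
    fix m assume m: "m \<in> {..<n - g}"
    have "\<bar>of_int (b m)\<bar> / \<bar>of_int (b n) :: real\<bar> \<le> q ^ (n - m)"
      using b_decay[of m n] m b_nonzero[of n] by (simp add: divide_le_eq)
    also have "\<dots> \<le> q ^ (g + (n - g - Suc m))"
      using q m by (intro power_decreasing) auto
    finally show "\<bar>of_int (b m)\<bar> / \<bar>of_int (b n) :: real\<bar> \<le> q ^ g * q ^ (n - g - Suc m)"
      by (simp add: power_add)
  qed
  also have "\<dots> = q ^ g * (\<Sum>i<n - g. q ^ i)"
    by (simp only: sum_distrib_left[symmetric] sum.nat_diff_reindex)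
  also have "\<dots> = q ^ g * ((1 - q ^ (n - g)) / (1 - q))"
    using q by (simp add: sum_gp_strict)
  also have "\<dots> \<le> q ^ g * (1 / (1 - q))"
    using q by (intro mult_left_mono divide_right_mono) auto
  finally show ?thesis by simp
qed

text \<open>The \<open>g\<close> most recent factors are deleted, the new factor is decoupled from what remains by
\<open>dilate_mixing\<close>, and the deleted factors are restored.  Deletion and restoration cost the
pair correlations and \<open>g \<tau>\<^sup>2\<close>; decoupling costs a term that is exponentially small in \<open>g\<close>.\<close>

lemma avoid_step:
  assumes G: "circle_fun G" and C: "\<And>s. (MEAN \<beta>. \<bar>G (\<beta> + s) - G \<beta>\<bar>) \<le> C * \<bar>s\<bar>" and C0: "C \<ge> 0"
  defines "\<tau> \<equiv> circ_mean G"
  shows "\<bar>(MEAN \<alpha>. avoid G (Suc n) \<alpha>) - (1 - \<tau>) * (MEAN \<alpha>. avoid G n \<alpha>)\<bar>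
    \<le> (\<Sum>m\<in>{n - g..<n}. (MEAN \<alpha>. G (of_int (b m) * \<alpha>) * G (of_int (b n) * \<alpha>))) + real g * \<tau>\<^sup>2 + C * q ^ g / (1 - q)"
proof -
  note [measurable] = circle_funD(1)[OF G] circle_funD(1)[OF avoid_circle_fun[OF G]]
  let ?F = "\<lambda>m \<alpha>. G (of_int (b m) * \<alpha>)" and ?P = "avoid G n" and ?Q = "avoid G (n - g)"
  let ?QF = "MEAN \<alpha>. ?Q \<alpha> * ?F n \<alpha>" and ?PF = "MEAN \<alpha>. ?P \<alpha> * ?F n \<alpha>" and ?mQ = "circ_mean ?Q" and ?mP = "circ_mean ?P"
  let ?E = "\<Sum>m\<in>{n - g..<n}. (MEAN \<alpha>. ?F m \<alpha> * ?F n \<alpha>)"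
  have F01: "0 \<le> ?F m \<alpha>" "?F m \<alpha> \<le> 1" for m \<alpha> using circle_funD(3,4)[OF G] by auto
  have A01: "0 \<le> avoid G k \<alpha>" "avoid G k \<alpha> \<le> 1" for k \<alpha> using circle_funD(3,4)[OF avoid_circle_fun[OF G]] by auto
  have intF: "(MEAN \<alpha>. ?F m \<alpha>) = \<tau>" for m
    using integral_circ_mult[OF circle_funD(1,2)[OF G] b_nonzero, of m 0] by (simp add: \<tau>_def)
  have \<tau>: "0 \<le> \<tau>" "\<tau> \<le> 1" unfolding \<tau>_def using circle_fun_mean[OF G] by auto
  have iF [simp]: "integrable circ (?F m)" for m by (rule integrable_circ[where B=1]) (use F01 in auto)
  have iA [simp]: "integrable circ (avoid G k)" for k by (rule integrable_circ[where B=1]) (use A01 in auto)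
  have iAF [simp]: "integrable circ (\<lambda>\<alpha>. avoid G k \<alpha> * ?F m \<alpha>)" for k m
    by (rule integrable_circ[where B=1]) (use F01 A01 in \<open>auto simp: abs_mult mult_le_one\<close>)
  have iFF [simp]: "integrable circ (\<lambda>\<alpha>. ?F k \<alpha> * ?F m \<alpha>)" for k m
    by (rule integrable_circ[where B=1]) (use F01 in \<open>auto simp: abs_mult mult_le_one\<close>)
  have PQ: "0 \<le> ?Q \<alpha> - ?P \<alpha>" "?Q \<alpha> - ?P \<alpha> \<le> (\<Sum>m\<in>{n - g..<n}. ?F m \<alpha>)" for \<alpha>
    unfolding avoid_def by (rule prod_one_minus_diff; use F01 in simp)+
  have e1: "0 \<le> ?mQ - ?mP"
           "?mQ - ?mP \<le> real g * \<tau>"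
  proof -
    have eq: "?mQ - ?mP = (MEAN \<alpha>. ?Q \<alpha> - ?P \<alpha>)" by simp
    show "0 \<le> ?mQ - ?mP"
      unfolding eq by (rule Bochner_Integration.integral_nonneg) (rule PQ)
    have "(MEAN \<alpha>. ?Q \<alpha> - ?P \<alpha>) \<le> (MEAN \<alpha>. (\<Sum>m\<in>{n - g..<n}. ?F m \<alpha>))"
      by (rule integral_mono) (use PQ in auto)
    also have "\<dots> = real (n - (n - g)) * \<tau>" by (simp add: intF)
    also have "\<dots> \<le> real g * \<tau>" using \<tau> by (intro mult_right_mono) auto
    finally show "?mQ - ?mP \<le> real g * \<tau>" unfolding eq .
  qed
  have e2: "\<bar>?QF - ?mQ * \<tau>\<bar> \<le> C * q ^ g / (1 - q)"
    unfolding \<tau>_def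
  proof (rule dilate_mixing[OF avoid_circle_fun[OF G] G b_nonzero])
    fix t :: real assume t: "0 \<le> t" "t \<le> 1"
    have "(MEAN \<alpha>. \<bar>?Q (\<alpha> + t / of_int (b n)) - ?Q \<alpha>\<bar>)
      \<le> C * (\<Sum>m<n - g. \<bar>of_int (b m)\<bar>) * \<bar>t / of_int (b n)\<bar>"
      by (rule avoid_modulus[OF G C])
    also have "\<dots> = \<bar>t\<bar> * (C * ((\<Sum>m<n - g. \<bar>of_int (b m)\<bar>) / \<bar>of_int (b n)\<bar>))"
      by (simp add: abs_divide)
    also have "\<dots> \<le> 1 * (C * ((\<Sum>m<n - g. \<bar>of_int (b m)\<bar>) / \<bar>of_int (b n)\<bar>))"
      using t C0 by (intro mult_right_mono mult_nonneg_nonneg divide_nonneg_nonneg sum_nonneg) auto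
    also have "\<dots> \<le> C * (q ^ g / (1 - q))"
      using mult_left_mono[OF sum_b_ratio[of n g] C0] by linarith
    finally show "(MEAN \<alpha>. \<bar>?Q (\<alpha> + t / of_int (b n)) - ?Q \<alpha>\<bar>) \<le> C * q ^ g / (1 - q)" by simp
  qed
  have e3: "0 \<le> ?QF - ?PF"
    "?QF - ?PF
      \<le> ?E"
  proof -
    have eq: "?QF - ?PF
      = (MEAN \<alpha>. ?Q \<alpha> * ?F n \<alpha> - ?P \<alpha> * ?F n \<alpha>)" by simp
    show "0 \<le> ?QF - ?PF"
      unfolding eq by (rule Bochner_Integration.integral_nonneg)
        (use PQ F01 in \<open>simp add: left_diff_distrib[symmetric]\<close>)
    have "(MEAN \<alpha>. ?Q \<alpha> * ?F n \<alpha> - ?P \<alpha> * ?F n \<alpha>) \<le> (MEAN \<alpha>. (\<Sum>m\<in>{n - g..<n}. ?F m \<alpha> * ?F n \<alpha>))"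
    proof (rule integral_mono)
      show "?Q \<alpha> * ?F n \<alpha> - ?P \<alpha> * ?F n \<alpha> \<le> (\<Sum>m\<in>{n - g..<n}. ?F m \<alpha> * ?F n \<alpha>)" for \<alpha>
        using PQ F01 by (auto simp: left_diff_distrib[symmetric] sum_distrib_right[symmetric] intro!: mult_right_mono)
    qed (intro Bochner_Integration.integrable_diff Bochner_Integration.integrable_sum iAF iFF)+
    also have "\<dots> = ?E" by simp
    finally show "?QF - ?PF
      \<le> ?E" unfolding eq .
  qed
  have e4: "0 \<le> \<tau> * (?mQ - ?mP)"
     "\<tau> * (?mQ - ?mP) \<le> real g * \<tau>\<^sup>2"
    using e1 \<tau> mult_left_mono[OF e1(2) \<tau>(1)] by (auto simp: power2_eq_square mult_ac)
  \<comment> \<open>The exact recursion, written as a sum of three errors: deletion, decoupling and restoration.\<close>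
  have "(MEAN \<alpha>. avoid G (Suc n) \<alpha>) = (MEAN \<alpha>. ?P \<alpha> - ?P \<alpha> * ?F n \<alpha>)"
    by (simp add: avoid_def right_diff_distrib)
  also have "\<dots> = ?mP - ?PF" by simp
  finally have "(MEAN \<alpha>. avoid G (Suc n) \<alpha>) - (1 - \<tau>) * ?mP
    = (?QF - ?PF)
     - (?QF - ?mQ * \<tau>)
     - \<tau> * (?mQ - ?mP)"
    by (simp add: algebra_simps)
  then show ?thesis using e2 e3 e4 by linarith
qed

lemma avoid_bound:
  assumes G: "circle_fun G" and C: "\<And>s. (MEAN \<beta>. \<bar>G (\<beta> + s) - G \<beta>\<bar>) \<le> C * \<bar>s\<bar>" and C0: "C \<ge> 0"
  defines "\<tau> \<equiv> circ_mean G"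
  shows "\<bar>(MEAN \<alpha>. avoid G K \<alpha>) - (1 - \<tau>) ^ K\<bar>
    \<le> (\<Sum>n<K. (\<Sum>m\<in>{n - g..<n}. (MEAN \<alpha>. G (of_int (b m) * \<alpha>) * G (of_int (b n) * \<alpha>))))
      + K * (real g * \<tau>\<^sup>2 + C * q ^ g / (1 - q))"
proof (induction K)
  case 0
  show ?case by (simp add: avoid_def)
next
  case (Suc K)
  have \<tau>: "0 \<le> \<tau>" "\<tau> \<le> 1" unfolding \<tau>_def using circle_fun_mean[OF G] by auto
  have "(MEAN \<alpha>. avoid G (Suc K) \<alpha>) - (1 - \<tau>) ^ Suc K
     = ((MEAN \<alpha>. avoid G (Suc K) \<alpha>) - (1 - \<tau>) * (MEAN \<alpha>. avoid G K \<alpha>))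
       + (1 - \<tau>) * ((MEAN \<alpha>. avoid G K \<alpha>) - (1 - \<tau>) ^ K)" by (simp add: algebra_simps)
  also have "\<bar>\<dots>\<bar> \<le> \<bar>(MEAN \<alpha>. avoid G (Suc K) \<alpha>) - (1 - \<tau>) * (MEAN \<alpha>. avoid G K \<alpha>)\<bar>
       + \<bar>(1 - \<tau>) * ((MEAN \<alpha>. avoid G K \<alpha>) - (1 - \<tau>) ^ K)\<bar>" by (rule abs_triangle_ineq)
  also have "\<bar>(1 - \<tau>) * ((MEAN \<alpha>. avoid G K \<alpha>) - (1 - \<tau>) ^ K)\<bar> \<le> \<bar>(MEAN \<alpha>. avoid G K \<alpha>) - (1 - \<tau>) ^ K\<bar>"
    using \<tau> by (simp add: abs_mult mult_left_le_one_le)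
  finally have le: "\<bar>(MEAN \<alpha>. avoid G (Suc K) \<alpha>) - (1 - \<tau>) ^ Suc K\<bar>
     \<le> \<bar>(MEAN \<alpha>. avoid G (Suc K) \<alpha>) - (1 - \<tau>) * (MEAN \<alpha>. avoid G K \<alpha>)\<bar>
       + \<bar>(MEAN \<alpha>. avoid G K \<alpha>) - (1 - \<tau>) ^ K\<bar>" by simp
  have "real (Suc K) * D = real K * D + D" for D by (simp add: distrib_right)
  then show ?case
    using le Suc avoid_step[OF G C C0, of K g, folded \<tau>_def] unfolding sum.lessThan_Suc by (smt (verit))
qed

definition mean_avoid :: "(real \<Rightarrow> real) \<Rightarrow> nat \<Rightarrow> real \<Rightarrow> real" where
  "mean_avoid G K \<alpha> = (MEAN x. (\<Prod>m<K. 1 - G (of_int (b m) * \<alpha> - x)))"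

lemma prod_unit:
  assumes G: "circle_fun G"
  shows "\<bar>\<Prod>m<K. 1 - G (f m)\<bar> \<le> 1" "0 \<le> (\<Prod>m<(K::nat). 1 - G (f m))" "(\<Prod>m<K. 1 - G (f m)) \<le> 1"
  using circle_funD(3,4)[OF G] by (auto simp: abs_prod intro!: prod_nonneg prod_le_1)

lemma mean_avoid_measurable:
  assumes G: "circle_fun G" shows "mean_avoid G K \<in> borel_measurable borel"
proof -
  note [measurable] = circle_funD(1)[OF G]
  show ?thesis unfolding mean_avoid_def by measurable
qed

lemma mean_avoid_unit:
  assumes G: "circle_fun G" shows "0 \<le> mean_avoid G K \<alpha>" "mean_avoid G K \<alpha> \<le> 1"
proof -
  note [measurable] = circle_funD(1)[OF G]
  show "0 \<le> mean_avoid G K \<alpha>" "mean_avoid G K \<alpha> \<le> 1"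
    unfolding mean_avoid_def by (rule integral_circ_unit; use prod_unit[OF G] in simp)+
qed

text \<open>For a fixed position the pair correlations in \<open>avoid_bound\<close> may be large; it is their mean over the
position that equals \<open>\<tau>\<^sup>2\<close>.\<close>

lemma first_moment:
  assumes G: "circle_fun G" and C: "\<And>s. (MEAN \<beta>. \<bar>G (\<beta> + s) - G \<beta>\<bar>) \<le> C * \<bar>s\<bar>" and C0: "C \<ge> 0"
  defines "\<tau> \<equiv> circ_mean G"
  shows "\<bar>(MEAN \<alpha>. mean_avoid G K \<alpha>) - (1 - \<tau>) ^ K\<bar> \<le> K * (2 * real g * \<tau>\<^sup>2 + C * q ^ g / (1 - q))"
proof -
  note [measurable] = circle_funD(1)[OF G]
  let ?Gx = "\<lambda>x \<beta>. G (\<beta> - x)"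
  let ?p = "\<lambda>x. (MEAN \<alpha>. avoid (?Gx x) K \<alpha>)"
  let ?e = "\<lambda>m n x. (MEAN \<alpha>. G (of_int (b m) * \<alpha> - x) * G (of_int (b n) * \<alpha> - x))"
  have Gx: "circle_fun (?Gx x)" for x by (rule circle_fun_reflect_shift[OF G])
  have \<tau>x: "(MEAN \<beta>. ?Gx x \<beta>) = \<tau>" for x
    using integral_circ_shift[OF circle_funD(1,2)[OF G], of "- x"] by (simp add: \<tau>_def)
  have Cx: "(MEAN \<beta>. \<bar>?Gx x (\<beta> + s) - ?Gx x \<beta>\<bar>) \<le> C * \<bar>s\<bar>" for x s
  proof -
    have "periodic1 (\<lambda>\<beta>. \<bar>G (\<beta> + s) - G \<beta>\<bar>)"
      using periodic1_shift[OF circle_funD(2)[OF G], of s] circle_funD(2)[OF G] by (simp add: periodic1_def)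
    from integral_circ_shift[OF _ this, of "- x"] C[of s] show ?thesis by (simp add: algebra_simps)
  qed
  have \<tau>: "0 \<le> \<tau>" "\<tau> \<le> 1" unfolding \<tau>_def using circle_fun_mean[OF G] by auto
  have swap: "(MEAN \<alpha>. mean_avoid G K \<alpha>) = (MEAN x. ?p x)"
    unfolding mean_avoid_def avoid_def by (rule integral_circ_swap[where B=1]) (use prod_unit[OF G] in auto)
  have pm [measurable]: "?p \<in> borel_measurable borel" unfolding avoid_def by measurable
  have p01: "0 \<le> ?p x" "?p x \<le> 1" for x
    using circle_fun_mean[OF avoid_circle_fun[OF Gx]] by auto
  have GG: "\<bar>G x * G y\<bar> \<le> 1" for x y
    using circle_funD(3,4)[OF G, of x] circle_funD(3,4)[OF G, of y] by (simp add: abs_mult mult_le_one)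
  have em [measurable]: "?e m n \<in> borel_measurable borel" for m n by measurable
  have ie [simp]: "integrable circ (?e m n)" for m n
    by (rule integrable_circ[where B=1], measurable) (rule abs_integral_circ_le, measurable, rule GG)
  have eint: "(MEAN x. ?e m n x) = \<tau>\<^sup>2" if "m < n" for m n
    using pair_independence[OF G G b_distinct[OF that]] by (simp add: \<tau>_def power2_eq_square)
  have c01: "0 \<le> (1 - \<tau>) ^ K" "(1 - \<tau>) ^ K \<le> 1" using \<tau> by (auto intro: power_le_one)
  have "\<bar>(MEAN x. ?p x) - (MEAN x. (1 - \<tau>) ^ K)\<bar> \<le> (MEAN x. \<bar>?p x - (1 - \<tau>) ^ K\<bar>)"
    by (rule abs_integral_circ_diff_le[where B=1]) (use p01 c01 in auto)
  also have "\<dots> \<le> (MEAN x. (\<Sum>n<K. (\<Sum>m\<in>{n - g..<n}. ?e m n x)) + K * (real g * \<tau>\<^sup>2 + C * q ^ g / (1 - q)))"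
  proof (rule integral_mono)
    have "\<bar>?p x - (1 - \<tau>) ^ K\<bar> \<le> 1" for x using p01[of x] c01 by linarith
    then show "integrable circ (\<lambda>x. \<bar>?p x - (1 - \<tau>) ^ K\<bar>)"
      by (intro integrable_circ[where B=1]) auto
    show "\<bar>?p x - (1 - \<tau>) ^ K\<bar> \<le> (\<Sum>n<K. (\<Sum>m\<in>{n - g..<n}. ?e m n x)) + K * (real g * \<tau>\<^sup>2 + C * q ^ g / (1 - q))" for x
      using avoid_bound[OF Gx Cx C0, of x K g] unfolding \<tau>x .
  qed simp
  also have "\<dots> = (\<Sum>n<K. (\<Sum>m\<in>{n - g..<n}. \<tau>\<^sup>2)) + K * (real g * \<tau>\<^sup>2 + C * q ^ g / (1 - q))"
    by (simp add: eint)
  also have "\<dots> \<le> (\<Sum>n<K. real g * \<tau>\<^sup>2) + K * (real g * \<tau>\<^sup>2 + C * q ^ g / (1 - q))"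
    using \<tau> by (intro add_right_mono sum_mono) (auto intro!: mult_right_mono)
  also have "\<dots> = K * (2 * real g * \<tau>\<^sup>2 + C * q ^ g / (1 - q))" by (simp add: algebra_simps)
  finally show ?thesis by (simp add: swap)
qed

end

section \<open>The second moment\<close>

text \<open>The target consisting of a window and its translate by \<open>v\<close>, as the complement of the product of
the two complements.\<close>

definition doubled :: "(real \<Rightarrow> real) \<Rightarrow> real \<Rightarrow> real \<Rightarrow> real" where
  "doubled G v \<beta> = 1 - (1 - G \<beta>) * (1 - G (\<beta> - v))"

lemma doubled_circle_fun: assumes G: "circle_fun G" shows "circle_fun (doubled G v)"
proof -
  note [measurable] = circle_funD(1)[OF G]
  have "doubled G v \<in> borel_measurable borel" unfolding doubled_def by measurable
  moreover have "periodic1 (doubled G v)"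
    using circle_funD(2)[OF G] periodic1_shift[OF circle_funD(2)[OF G], of "-v"]
    by (simp add: periodic1_def doubled_def)
  moreover have "0 \<le> doubled G v \<beta> \<and> doubled G v \<beta> \<le> 1" for \<beta>
    using circle_funD(3,4)[OF G, of \<beta>] circle_funD(3,4)[OF G, of "\<beta> - v"]
    by (simp add: doubled_def mult_le_one)
  ultimately show ?thesis by (simp add: circle_fun_def)
qed

context separated_dilates
begin

text \<open>The square is a mean over two independent positions \<open>x\<close> and \<open>y\<close>; the substitution \<open>y = x + v\<close>
turns it into a mean over one position of the doubled window.\<close>

lemma mean_avoid_square:
  assumes G: "circle_fun G"
  shows "(mean_avoid G K \<alpha>)\<^sup>2 = (MEAN v. mean_avoid (doubled G v) K \<alpha>)"
proof -
  note [measurable] = circle_funD(1)[OF G]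
  define A where "A x = (\<Prod>m<K. 1 - G (of_int (b m) * \<alpha> - x))" for x
  have [measurable]: "A \<in> borel_measurable borel" unfolding A_def by measurable
  have A01: "0 \<le> A x" "A x \<le> 1" for x using prod_unit[OF G] by (auto simp: A_def)
  have per: "periodic1 A"
    using periodic1_uminus[OF periodic1_shift[OF circle_funD(2)[OF G], of "of_int (b m) * \<alpha>" for m]]
    by (simp add: periodic1_def A_def)
  have "(mean_avoid G K \<alpha>)\<^sup>2 = (MEAN x. A x * (MEAN y. A y))"
    by (simp add: mean_avoid_def A_def power2_eq_square)
  also have "\<dots> = (MEAN x. (MEAN v. A x * A (v + x)))"
    using integral_circ_shift[OF _ per] by simp
  also have "\<dots> = (MEAN v. (MEAN x. A x * A (v + x)))"
    by (rule integral_circ_swap[where B=1]) (use A01 in \<open>auto simp: abs_mult mult_le_one\<close>)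
  also have "(\<lambda>v. MEAN x. A x * A (v + x)) = (\<lambda>v. mean_avoid (doubled G v) K \<alpha>)"
    unfolding A_def mean_avoid_def doubled_def prod.distrib[symmetric]
    by (intro ext Bochner_Integration.integral_cong prod.cong) (auto simp: algebra_simps)
  finally show ?thesis .
qed

text \<open>The doubled window has mean \<open>2 \<tau>\<close> minus the overlap of its two copies.  The overlap has mean
\<open>\<tau>\<^sup>2\<close> over \<open>v\<close>, so \<open>first_moment\<close> for the doubled window yields powers of a quantity that is on
average \<open>1 - 2 \<tau> + \<tau>\<^sup>2 = (1 - \<tau>)\<^sup>2\<close>.  Hence the second moment is close to the square of the first.\<close>

lemma second_moment:
  assumes G: "circle_fun G" and C: "\<And>s. (MEAN \<beta>. \<bar>G (\<beta> + s) - G \<beta>\<bar>) \<le> C * \<bar>s\<bar>" and C0: "C \<ge> 0"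
    and g: "g \<ge> 1"
  defines "\<tau> \<equiv> circ_mean G"
  shows "(MEAN \<alpha>. (mean_avoid G K \<alpha> - (1 - \<tau>) ^ K)\<^sup>2) \<le> K * (14 * real g * \<tau>\<^sup>2 + 4 * (C * q ^ g / (1 - q)))"
proof -
  note [measurable] = circle_funD(1)[OF G] mean_avoid_measurable[OF G]
  define T where "T = C * q ^ g / (1 - q)"
  define c where "c = (1 - \<tau>) ^ K"
  let ?H = "doubled G"
  define \<tau>v where "\<tau>v v = (MEAN \<beta>. ?H v \<beta>)" for v
  define ov where "ov v = (MEAN \<beta>. G \<beta> * G (\<beta> - v))" for v
  have GG: "0 \<le> G x * G y" "G x * G y \<le> 1" for x y
    using circle_funD(3,4)[OF G, of x] circle_funD(3,4)[OF G, of y] by (auto simp: mult_le_one)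
  have iG [simp]: "integrable circ (\<lambda>\<beta>. G (\<beta> - v))" for v
    by (rule integrable_circ[where B=1]) (use circle_funD(5)[OF G] in auto)
  have iG0 [simp]: "integrable circ G" using iG[of 0] by simp
  have iGG [simp]: "integrable circ (\<lambda>\<beta>. G \<beta> * G (\<beta> - v))" for v
    by (rule integrable_circ[where B=1]) (use GG in auto)
  have shiftG: "(MEAN \<beta>. G (\<beta> - v)) = \<tau>" for v
    using integral_circ_shift[OF circle_funD(1,2)[OF G], of "- v"] by (simp add: \<tau>_def)
  have \<tau>: "0 \<le> \<tau>" "\<tau> \<le> 1" unfolding \<tau>_def using circle_fun_mean[OF G] by auto
  have c01: "0 \<le> c" "c \<le> 1" using \<tau> by (auto simp: c_def intro: power_le_one)
  have \<tau>v_eq: "\<tau>v v = 2 * \<tau> - ov v" for v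
  proof -
    have "\<tau>v v = (MEAN \<beta>. (G \<beta> + G (\<beta> - v)) - G \<beta> * G (\<beta> - v))"
      unfolding \<tau>v_def doubled_def by (intro Bochner_Integration.integral_cong) (auto simp: algebra_simps)
    then show ?thesis by (simp add: shiftG ov_def \<tau>_def[symmetric])
  qed
  have [measurable]: "ov \<in> borel_measurable borel" unfolding ov_def by measurable
  have ov01: "0 \<le> ov v" "ov v \<le> 1" for v
    unfolding ov_def by (rule integral_circ_unit; use GG in simp)+
  have iov [simp]: "integrable circ ov" by (rule integrable_circ[where B=1]) (use ov01 in auto)
  have ovint: "circ_mean ov = \<tau>\<^sup>2"
  proof -
    have "circ_mean ov = (MEAN \<beta>. (MEAN v. G \<beta> * G (\<beta> - v)))"
      unfolding ov_def by (rule integral_circ_swap[where B=1]) (use GG in auto)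
    then show ?thesis
      using integral_circ_reflect_shift[OF circle_funD(1,2)[OF G]] by (simp add: \<tau>_def power2_eq_square)
  qed
  have \<tau>v01: "0 \<le> \<tau>v v" "\<tau>v v \<le> 1" for v unfolding \<tau>v_def using circle_fun_mean[OF doubled_circle_fun[OF G]] by auto
  have [measurable]: "\<tau>v \<in> borel_measurable borel" unfolding \<tau>v_eq[abs_def] by measurable

  have CH: "(MEAN \<beta>. \<bar>?H v (\<beta> + s) - ?H v \<beta>\<bar>) \<le> (2 * C) * \<bar>s\<bar>" for v s
  proof -
    let ?d = "\<lambda>\<beta>. \<bar>G (\<beta> + s) - G \<beta>\<bar>"
    have d1: "\<bar>?d x\<bar> \<le> 1" for x
      using circle_funD(3,4)[OF G, of x] circle_funD(3,4)[OF G, of "x + s"] by linarith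
    have i: "integrable circ (\<lambda>\<beta>. ?d (\<beta> - v))" for v
      by (rule integrable_circ[where B=1], measurable) (rule d1)
    have "(MEAN \<beta>. \<bar>?H v (\<beta> + s) - ?H v \<beta>\<bar>) \<le> (MEAN \<beta>. ?d (\<beta> - 0) + ?d (\<beta> - v))"
    proof (rule integral_mono')
      show "integrable circ (\<lambda>\<beta>. ?d (\<beta> - 0) + ?d (\<beta> - v))"
        by (rule Bochner_Integration.integrable_add) (rule i)+
      fix \<beta>
      define x y x' y' where "x = G \<beta>" and "y = G (\<beta> - v)" and "x' = G (\<beta> + s)" and "y' = G (\<beta> - v + s)"
      have xy: "0 \<le> 1 - x" "1 - x \<le> 1" "0 \<le> 1 - y'" "1 - y' \<le> 1"
        using circle_funD(3,4)[OF G] by (auto simp: x_def y'_def)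
      have "?H v (\<beta> + s) - ?H v \<beta> = (x' - x) * (1 - y') + (1 - x) * (y' - y)"
        by (simp add: doubled_def x_def y_def x'_def y'_def algebra_simps)
      also have "\<bar>\<dots>\<bar> \<le> \<bar>x' - x\<bar> * \<bar>1 - y'\<bar> + \<bar>1 - x\<bar> * \<bar>y' - y\<bar>"
        by (metis abs_mult abs_triangle_ineq)
      also have "\<dots> \<le> \<bar>x' - x\<bar> * 1 + 1 * \<bar>y' - y\<bar>"
        using xy by (intro add_mono mult_left_mono mult_right_mono) auto
      finally show "\<bar>?H v (\<beta> + s) - ?H v \<beta>\<bar> \<le> ?d (\<beta> - 0) + ?d (\<beta> - v)"
        by (simp add: x_def y_def x'_def y'_def)
    qed auto
    also have "\<dots> = (MEAN \<beta>. ?d (\<beta> - 0)) + (MEAN \<beta>. ?d (\<beta> - v))"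
      by (rule Bochner_Integration.integral_add) (rule i)+
    also have "(MEAN \<beta>. ?d (\<beta> - v)) = (MEAN \<beta>. ?d \<beta>)"
    proof -
      have "periodic1 ?d"
        using periodic1_shift[OF circle_funD(2)[OF G], of s] circle_funD(2)[OF G] by (simp add: periodic1_def)
      from integral_circ_shift[OF _ this, of "- v"] show ?thesis by simp
    qed
    finally show ?thesis using C[of s] by simp
  qed

  let ?M = "\<lambda>v \<alpha>. mean_avoid (?H v) K \<alpha>"
  have M01: "0 \<le> ?M v \<alpha>" "?M v \<alpha> \<le> 1" for v \<alpha>
    using mean_avoid_unit[OF doubled_circle_fun[OF G]] by auto
  have M01': "\<bar>?M v \<alpha>\<bar> \<le> 1" for v \<alpha> using M01[of v \<alpha>] by simp
  have [measurable]: "(\<lambda>(\<alpha>, v). ?M v \<alpha>) \<in> borel_measurable (borel \<Otimes>\<^sub>M borel)"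
    unfolding mean_avoid_def doubled_def by measurable
  have [measurable]: "(\<lambda>(v, \<alpha>). ?M v \<alpha>) \<in> borel_measurable (borel \<Otimes>\<^sub>M borel)"
    unfolding mean_avoid_def doubled_def by measurable
  define m2 where "m2 v = (MEAN \<alpha>. ?M v \<alpha>)" for v
  have [measurable]: "m2 \<in> borel_measurable borel" unfolding m2_def by measurable
  have m201: "\<bar>m2 v\<bar> \<le> 1" for v
    unfolding m2_def by (rule abs_integral_circ_le) (use M01 mean_avoid_measurable[OF doubled_circle_fun[OF G]] in auto)
  have sq: "(MEAN \<alpha>. (mean_avoid G K \<alpha>)\<^sup>2) = circ_mean m2"
    unfolding mean_avoid_square[OF G] m2_def
    by (rule integral_circ_swap[where B=1]) (measurable, rule M01')
  have m2_bound: "\<bar>m2 v - c\<^sup>2\<bar> \<le> K * (8 * real g * \<tau>\<^sup>2 + 2 * T) + K * (ov v + \<tau>\<^sup>2)" for v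
  proof -
    have "\<bar>m2 v - (1 - \<tau>v v) ^ K\<bar> \<le> K * (2 * real g * (\<tau>v v)\<^sup>2 + 2 * C * q ^ g / (1 - q))"
      unfolding m2_def \<tau>v_def by (rule first_moment[OF doubled_circle_fun[OF G] CH]) (use C0 in simp)
    also have "\<dots> \<le> K * (8 * real g * \<tau>\<^sup>2 + 2 * T)"
    proof -
      have "(\<tau>v v)\<^sup>2 \<le> (2 * \<tau>)\<^sup>2" using \<tau>v01[of v] ov01[of v] \<tau>v_eq[of v] by (intro power_mono) auto
      then have "2 * real g * (\<tau>v v)\<^sup>2 \<le> 2 * real g * (2 * \<tau>)\<^sup>2" by (intro mult_left_mono) auto
      moreover have "2 * real g * (2 * \<tau>)\<^sup>2 = 8 * real g * \<tau>\<^sup>2" by (simp add: power2_eq_square)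
      moreover have "2 * C * q ^ g / (1 - q) = 2 * T" by (simp add: T_def)
      ultimately show ?thesis by (intro mult_left_mono) auto
    qed
    finally have 1: "\<bar>m2 v - (1 - \<tau>v v) ^ K\<bar> \<le> K * (8 * real g * \<tau>\<^sup>2 + 2 * T)" .
    have "norm ((1 - \<tau>v v) ^ K - ((1 - \<tau>)\<^sup>2) ^ K) \<le> K * norm ((1 - \<tau>v v) - (1 - \<tau>)\<^sup>2)"
      using \<tau>v01[of v] \<tau> by (intro norm_power_diff) (auto simp: abs_square_le_1 abs_le_iff)
    moreover have "((1 - \<tau>)\<^sup>2) ^ K = c\<^sup>2" by (simp add: c_def power_mult[symmetric] mult.commute)
    moreover have "(1 - \<tau>v v) - (1 - \<tau>)\<^sup>2 = ov v - \<tau>\<^sup>2" by (simp add: \<tau>v_eq power2_eq_square algebra_simps)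
    moreover have "\<bar>ov v - \<tau>\<^sup>2\<bar> \<le> ov v + \<tau>\<^sup>2" using ov01[of v] by (simp add: abs_le_iff)
    then have "K * \<bar>ov v - \<tau>\<^sup>2\<bar> \<le> K * (ov v + \<tau>\<^sup>2)" by (intro mult_left_mono) auto
    ultimately have "\<bar>(1 - \<tau>v v) ^ K - c\<^sup>2\<bar> \<le> K * (ov v + \<tau>\<^sup>2)" by simp
    with 1 show ?thesis by linarith
  qed
  have c2: "\<bar>c\<^sup>2\<bar> \<le> 1" using c01 by (simp add: abs_square_le_1 abs_le_iff)
  have "\<bar>(circ_mean m2) - (MEAN v. c\<^sup>2)\<bar> \<le> (MEAN v. \<bar>m2 v - c\<^sup>2\<bar>)"
    by (rule abs_integral_circ_diff_le[where B=1]) (use m201 c2 in auto)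
  also have "\<dots> \<le> (MEAN v. K * (8 * real g * \<tau>\<^sup>2 + 2 * T) + K * (ov v + \<tau>\<^sup>2))"
    by (rule integral_mono') (use m2_bound ov01 \<tau> in \<open>auto intro: order_trans[OF _ m2_bound]\<close>)
  also have "\<dots> = K * (8 * real g * \<tau>\<^sup>2 + 2 * T) + K * (2 * \<tau>\<^sup>2)"
    by (simp add: ovint algebra_simps)
  finally have A: "\<bar>(MEAN \<alpha>. (mean_avoid G K \<alpha>)\<^sup>2) - c\<^sup>2\<bar> \<le> K * (8 * real g * \<tau>\<^sup>2 + 2 * T) + K * (2 * \<tau>\<^sup>2)"
    by (simp add: sq)
  have B: "\<bar>(MEAN \<alpha>. mean_avoid G K \<alpha>) - c\<bar> \<le> K * (2 * real g * \<tau>\<^sup>2 + T)"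
    unfolding c_def T_def \<tau>_def by (rule first_moment[OF G C C0])
  have Z1: "\<bar>mean_avoid G K \<alpha>\<bar> \<le> 1" for \<alpha> using mean_avoid_unit[OF G, of K \<alpha>] by simp
  have [simp]: "integrable circ (mean_avoid G K)" by (rule integrable_circ[where B=1]) (use Z1 in auto)
  have [simp]: "integrable circ (\<lambda>\<alpha>. (mean_avoid G K \<alpha>)\<^sup>2)"
    by (rule integrable_circ[where B=1]) (use Z1 in \<open>auto simp: abs_square_le_1\<close>)
  have "(MEAN \<alpha>. (mean_avoid G K \<alpha> - c)\<^sup>2)
     = (MEAN \<alpha>. (mean_avoid G K \<alpha>)\<^sup>2 - 2 * c * mean_avoid G K \<alpha> + c\<^sup>2)"
    by (simp add: power2_diff algebra_simps)
  also have "\<dots> = (MEAN \<alpha>. (mean_avoid G K \<alpha>)\<^sup>2) - 2 * c * (MEAN \<alpha>. mean_avoid G K \<alpha>) + c\<^sup>2"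
    by simp
  also have "\<dots> = ((MEAN \<alpha>. (mean_avoid G K \<alpha>)\<^sup>2) - c\<^sup>2) - 2 * (c * ((MEAN \<alpha>. mean_avoid G K \<alpha>) - c))"
    by (simp add: power2_eq_square algebra_simps)
  also have "\<dots> \<le> (K * (8 * real g * \<tau>\<^sup>2 + 2 * T) + K * (2 * \<tau>\<^sup>2)) + 2 * (K * (2 * real g * \<tau>\<^sup>2 + T))"
  proof -
    have "\<bar>c * ((MEAN \<alpha>. mean_avoid G K \<alpha>) - c)\<bar> \<le> \<bar>(MEAN \<alpha>. mean_avoid G K \<alpha>) - c\<bar>"
      using c01 by (simp add: abs_mult mult_left_le_one_le)
    with A B show ?thesis by linarith
  qed
  also have "\<dots> = K * (12 * real g * \<tau>\<^sup>2 + 2 * \<tau>\<^sup>2 + 4 * T)" by (simp add: algebra_simps)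
  also have "\<dots> \<le> K * (14 * real g * \<tau>\<^sup>2 + 4 * T)"
  proof -
    have "1 * \<tau>\<^sup>2 \<le> real g * \<tau>\<^sup>2" using g by (intro mult_right_mono) auto
    then show ?thesis by (intro mult_left_mono) auto
  qed
  finally show ?thesis by (simp add: c_def T_def)
qed

end

section \<open>Step functions on the circle\<close>

text \<open>For \<open>b \<le> c \<le> b + 1\<close> this is the indicator of the arc \<open>[b, c)\<close> modulo 1: the difference counts the
integers \<open>k\<close> with \<open>b \<le> \<beta> - k < c\<close>.  In this form arcs are additive and translations, changes of the
endpoints and means all reduce to those of the floor function.\<close>

definition arc_fun :: "real \<Rightarrow> real \<Rightarrow> real \<Rightarrow> real" where
  "arc_fun b c \<beta> = of_int (\<lfloor>\<beta> - b\<rfloor> - \<lfloor>\<beta> - c\<rfloor>)"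

lemma arc_measurable [measurable]: "arc_fun b c \<in> borel_measurable borel"
  unfolding arc_fun_def by measurable

lemma arc_periodic: "periodic1 (arc_fun b c)"
proof -
  have "\<lfloor>\<beta> + 1 - d\<rfloor> = \<lfloor>\<beta> - d\<rfloor> + 1" for \<beta> d :: real
    by (metis add_diff_eq diff_add_eq floor_add_int of_int_1)
  then show ?thesis by (simp add: periodic1_def arc_fun_def)
qed

lemma arc_eq_frac: "arc_fun b c \<beta> = (c - b) - frac (\<beta> - b) + frac (\<beta> - c)"
  by (simp add: arc_fun_def frac_def)

lemma arc_bound: "\<bar>arc_fun b c \<beta>\<bar> \<le> \<bar>c - b\<bar> + 1"
  using frac_ge_0[of "\<beta> - b"] frac_ge_0[of "\<beta> - c"] frac_lt_1[of "\<beta> - b"] frac_lt_1[of "\<beta> - c"]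
  unfolding arc_eq_frac by linarith

lemma arc_integrable [simp]: "integrable circ (arc_fun b c)"
  by (rule integrable_circ[OF arc_measurable arc_bound])

lemma integral_arc: "(MEAN \<beta>. arc_fun b c \<beta>) = c - b"
proof -
  have p: "periodic1 (frac :: real \<Rightarrow> real)" by (simp add: periodic1_def frac_1_eq)
  have i: "integrable circ (\<lambda>\<beta>. frac (\<beta> - d))" for d :: real
    by (rule integrable_circ[where B=1]) (auto simp: abs_le_iff less_imp_le[OF frac_lt_1] intro: order_trans[OF _ frac_ge_0])
  have s: "(MEAN \<beta>. frac (\<beta> - d)) = (MEAN \<beta>. frac \<beta>)" for d :: real
    using integral_circ_shift[OF _ p, of "- d"] by simp
  show ?thesis unfolding arc_eq_frac using i by (simp add: s)
qed

lemma arc_nonneg: "b \<le> c \<Longrightarrow> 0 \<le> arc_fun b c \<beta>"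
  unfolding arc_fun_def by (simp add: floor_mono)

lemma integral_abs_arc: "(MEAN \<beta>. \<bar>arc_fun b c \<beta>\<bar>) = \<bar>c - b\<bar>"
proof (cases "b \<le> c")
  case True
  then show ?thesis using integral_arc[of b c] arc_nonneg[OF True] by simp
next
  case False
  have "\<bar>arc_fun b c \<beta>\<bar> = arc_fun c b \<beta>" for \<beta>
    using arc_nonneg[of c b \<beta>] False by (simp add: arc_fun_def)
  then show ?thesis using integral_arc[of c b] False by simp
qed

lemma arc_le_1: assumes "c \<le> b + 1" shows "arc_fun b c \<beta> \<le> 1"
proof -
  have "\<lfloor>\<beta> - b\<rfloor> \<le> \<lfloor>\<beta> - c + 1\<rfloor>" using assms by (intro floor_mono) simp
  then show ?thesis by (simp add: arc_fun_def)
qed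

text \<open>The value \<open>v i\<close> is taken on the arc from \<open>s i\<close> to \<open>s (i + 1)\<close>; the function vanishes elsewhere.\<close>

definition step_fun :: "nat \<Rightarrow> (nat \<Rightarrow> real) \<Rightarrow> (nat \<Rightarrow> real) \<Rightarrow> real \<Rightarrow> real" where
  "step_fun M s v \<beta> = (\<Sum>i<M. v i * arc_fun (s i) (s (Suc i)) \<beta>)"

definition steps :: "nat \<Rightarrow> (nat \<Rightarrow> real) \<Rightarrow> (nat \<Rightarrow> real) \<Rightarrow> bool" where
  "steps M s v \<longleftrightarrow> (\<forall>i<M. s i \<le> s (Suc i) \<and> 0 \<le> v i \<and> v i \<le> 1)"

definition mass :: "nat \<Rightarrow> (nat \<Rightarrow> real) \<Rightarrow> (nat \<Rightarrow> real) \<Rightarrow> real" where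
  "mass M s v = (\<Sum>i<M. v i * (s (Suc i) - s i))"

lemma sum_arc: "(\<Sum>i<M. arc_fun (s i) (s (Suc i)) \<beta>) = arc_fun (s 0) (s M) \<beta>"
  by (induction M) (auto simp: arc_fun_def)

lemma integral_step_fun: "(MEAN \<beta>. step_fun M s v \<beta>) = mass M s v"
  unfolding step_fun_def mass_def by (simp add: integral_arc)

lemma step_fun_circle_fun:
  assumes st: "steps M s v" and len: "s M \<le> s 0 + 1"
  shows "circle_fun (step_fun M s v)"
proof -
  have "step_fun M s v \<in> borel_measurable borel" unfolding step_fun_def by measurable
  moreover have "periodic1 (step_fun M s v)"
    using arc_periodic by (simp add: periodic1_def step_fun_def)
  moreover have "0 \<le> step_fun M s v \<beta>" for \<beta>
    using st unfolding step_fun_def steps_def by (intro sum_nonneg mult_nonneg_nonneg arc_nonneg) auto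
  moreover have "step_fun M s v \<beta> \<le> 1" for \<beta>
  proof -
    have "step_fun M s v \<beta> \<le> (\<Sum>i<M. arc_fun (s i) (s (Suc i)) \<beta>)"
      unfolding step_fun_def using st
      by (intro sum_mono mult_left_le_one_le arc_nonneg) (auto simp: steps_def)
    also have "\<dots> \<le> 1" unfolding sum_arc by (rule arc_le_1) (use len in simp)
    finally show ?thesis .
  qed
  ultimately show ?thesis by (simp add: circle_fun_def)
qed

text \<open>An arc changes by two arcs joining the old endpoints to the new ones.  The modulus of continuity
and the comparison of different scales both follow from this estimate.\<close>

lemma step_fun_L1_dist:
  assumes st: "steps M s v" "steps M s' v'"
  shows "(MEAN \<beta>. \<bar>step_fun M s v \<beta> - step_fun M s' v' \<beta>\<bar>)
    \<le> (\<Sum>i<M. \<bar>s i - s' i\<bar> + \<bar>s (Suc i) - s' (Suc i)\<bar> + \<bar>v i - v' i\<bar> * (s (Suc i) - s i))"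
proof -
  let ?c = "\<lambda>i. arc_fun (s i) (s (Suc i))" and ?c' = "\<lambda>i. arc_fun (s' i) (s' (Suc i))"
  let ?e = "\<lambda>i. arc_fun (s i) (s' i)"
  let ?R = "\<lambda>\<beta>. \<Sum>i<M. \<bar>?e i \<beta>\<bar> + \<bar>?e (Suc i) \<beta>\<bar> + \<bar>v i - v' i\<bar> * ?c i \<beta>"
  have "(MEAN \<beta>. \<bar>step_fun M s v \<beta> - step_fun M s' v' \<beta>\<bar>) \<le> (MEAN \<beta>. ?R \<beta>)"
  proof (rule integral_mono')
    fix \<beta>
    have "\<bar>step_fun M s v \<beta> - step_fun M s' v' \<beta>\<bar> = \<bar>\<Sum>i<M. v i * ?c i \<beta> - v' i * ?c' i \<beta>\<bar>"
      by (simp add: step_fun_def sum_subtractf)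
    also have "\<dots> \<le> (\<Sum>i<M. \<bar>v i * ?c i \<beta> - v' i * ?c' i \<beta>\<bar>)"
      by (rule sum_abs)
    also have "\<dots> \<le> ?R \<beta>"
    proof (rule sum_mono)
      fix i assume i: "i \<in> {..<M}"
      have v': "\<bar>v' i\<bar> \<le> 1" using st i by (auto simp: steps_def)
      have a: "0 \<le> ?c i \<beta>" using st i by (auto simp: steps_def intro: arc_nonneg)
      have eq: "?c' i \<beta>
          = ?c i \<beta> - (?e i \<beta> - ?e (Suc i) \<beta>)"
        by (simp add: arc_fun_def)
      have "v i * ?c i \<beta> - v' i * ?c' i \<beta>
        = v' i * (?e i \<beta> - ?e (Suc i) \<beta>) + (v i - v' i) * ?c i \<beta>"
        unfolding eq by (simp add: algebra_simps)
      also have "\<bar>\<dots>\<bar> \<le> \<bar>v' i\<bar> * \<bar>?e i \<beta> - ?e (Suc i) \<beta>\<bar> + \<bar>v i - v' i\<bar> * ?c i \<beta>"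
        using a by (metis abs_mult abs_of_nonneg abs_triangle_ineq)
      also have "\<bar>v' i\<bar> * \<bar>?e i \<beta> - ?e (Suc i) \<beta>\<bar>
         \<le> \<bar>?e i \<beta> - ?e (Suc i) \<beta>\<bar>"
        using v' by (simp add: mult_left_le_one_le)
      also have "\<dots> \<le> \<bar>?e i \<beta>\<bar> + \<bar>?e (Suc i) \<beta>\<bar>" by (rule abs_triangle_ineq4)
      finally show "\<bar>v i * ?c i \<beta> - v' i * ?c' i \<beta>\<bar>
        \<le> \<bar>?e i \<beta>\<bar> + \<bar>?e (Suc i) \<beta>\<bar> + \<bar>v i - v' i\<bar> * ?c i \<beta>" by simp
    qed
    finally show "\<bar>step_fun M s v \<beta> - step_fun M s' v' \<beta>\<bar> \<le> ?R \<beta>" .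
  qed (use st in \<open>auto simp: steps_def intro!: sum_nonneg add_nonneg_nonneg mult_nonneg_nonneg arc_nonneg\<close>)
  also have "\<dots> = (\<Sum>i<M. \<bar>s' i - s i\<bar> + \<bar>s' (Suc i) - s (Suc i)\<bar> + \<bar>v i - v' i\<bar> * (s (Suc i) - s i))"
    by (simp add: integral_abs_arc integral_arc)
  finally show ?thesis by (simp add: abs_minus_commute)
qed

lemma step_fun_modulus:
  assumes st: "steps M s v"
  shows "(MEAN \<beta>. \<bar>step_fun M s v (\<beta> + t) - step_fun M s v \<beta>\<bar>) \<le> (2 * M) * \<bar>t\<bar>"
proof -
  have "step_fun M s v (\<beta> + t) = step_fun M (\<lambda>i. s i - t) v \<beta>" for \<beta>
    by (simp add: step_fun_def arc_fun_def algebra_simps)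
  moreover have "steps M (\<lambda>i. s i - t) v" using st by (simp add: steps_def)
  ultimately show ?thesis using step_fun_L1_dist[OF _ st, of "\<lambda>i. s i - t" v] by simp
qed

section \<open>Almost sure convergence of window averages\<close>

text \<open>With the indicator of a set for \<open>G\<close>, this is the probability that the set, placed at a uniform
position, contains none of the first \<open>N\<close> points.\<close>

definition void :: "(nat \<Rightarrow> real) \<Rightarrow> nat \<Rightarrow> (real \<Rightarrow> real) \<Rightarrow> real" where
  "void \<theta> N G = (MEAN x. (\<Prod>n\<in>{1..N}. 1 - G (\<theta> n - x)))"

text \<open>Each of the first \<open>N'\<close> factors contributes the \<open>L\<^sup>1\<close> distance, whatever the position of its point,
because the mean over \<open>x\<close> is invariant under translations.\<close>

lemma void_lipschitz:
  assumes G: "circle_fun G" and G': "circle_fun G'" and N: "N' \<le> N"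
  shows "\<bar>void \<theta> N G - void \<theta> N' G'\<bar> \<le> real (N - N') * circ_mean G + real N' * (MEAN \<beta>. \<bar>G \<beta> - G' \<beta>\<bar>)"
proof -
  note [measurable] = circle_funD(1)[OF G] circle_funD(1)[OF G']
  have b: "\<bar>\<Prod>n\<in>{1..K}. 1 - F (\<theta> n - x)\<bar> \<le> 1" if "circle_fun F" for F K x
    using circle_funD(6)[OF that] by (auto simp: abs_prod intro!: prod_le_1)
  have d1: "\<bar>G y - G' y\<bar> \<le> 1" for y
    using circle_funD(3,4)[OF G, of y] circle_funD(3,4)[OF G', of y] by linarith
  let ?R = "\<lambda>x. (\<Sum>m\<in>{N'..<N}. G (\<theta> (Suc m) - x)) + (\<Sum>m<N'. \<bar>G (\<theta> (Suc m) - x) - G' (\<theta> (Suc m) - x)\<bar>)"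
  have iG: "integrable circ (\<lambda>x. G (t - x))" for t
    by (rule integrable_circ[where B=1]) (use circle_funD(5)[OF G] in auto)
  have iD: "integrable circ (\<lambda>x. \<bar>G (t - x) - G' (t - x)\<bar>)" for t
    by (rule integrable_circ[where B=1]) (use d1 in auto)
  have "\<bar>void \<theta> N G - void \<theta> N' G'\<bar>
     \<le> (MEAN x. \<bar>(\<Prod>n\<in>{1..N}. 1 - G (\<theta> n - x)) - (\<Prod>n\<in>{1..N'}. 1 - G' (\<theta> n - x))\<bar>)"
    unfolding void_def by (rule abs_integral_circ_diff_le[where B=1]) (use b[OF G] b[OF G'] in auto)
  also have "\<dots> \<le> (MEAN x. ?R x)"
  proof (rule integral_mono')
    fix x
    have 1: "\<bar>(\<Prod>m<N'. 1 - G (\<theta> (Suc m) - x)) - (\<Prod>m<N. 1 - G (\<theta> (Suc m) - x))\<bar> \<le> (\<Sum>m\<in>{N'..<N}. G (\<theta> (Suc m) - x))"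
      using prod_one_minus_diff[of "\<lambda>m. G (\<theta> (Suc m) - x)", OF circle_funD(3,4)[OF G] N]
      by (simp add: abs_of_nonneg)
    have "norm ((\<Prod>m<N'. 1 - G (\<theta> (Suc m) - x)) - (\<Prod>m<N'. 1 - G' (\<theta> (Suc m) - x)))
      \<le> (\<Sum>m<N'. norm ((1 - G (\<theta> (Suc m) - x)) - (1 - G' (\<theta> (Suc m) - x))))"
      by (rule norm_prod_diff) (use circle_funD(6)[OF G] circle_funD(6)[OF G'] in auto)
    then have 2: "\<bar>(\<Prod>m<N'. 1 - G (\<theta> (Suc m) - x)) - (\<Prod>m<N'. 1 - G' (\<theta> (Suc m) - x))\<bar>
      \<le> (\<Sum>m<N'. \<bar>G (\<theta> (Suc m) - x) - G' (\<theta> (Suc m) - x)\<bar>)"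
      by (simp add: abs_minus_commute)
    show "\<bar>(\<Prod>n\<in>{1..N}. 1 - G (\<theta> n - x)) - (\<Prod>n\<in>{1..N'}. 1 - G' (\<theta> n - x))\<bar> \<le> ?R x"
      using 1 2 unfolding One_nat_def prod.atLeast1_atMost_eq by linarith
  qed (use iG iD circle_funD(3)[OF G] in \<open>auto intro!: Bochner_Integration.integrable_add Bochner_Integration.integrable_sum add_nonneg_nonneg sum_nonneg\<close>)
  also have "\<dots> = (\<Sum>m\<in>{N'..<N}. MEAN x. G (\<theta> (Suc m) - x)) + (\<Sum>m<N'. MEAN x. \<bar>G (\<theta> (Suc m) - x) - G' (\<theta> (Suc m) - x)\<bar>)"
    using iG iD by (subst Bochner_Integration.integral_add) auto
  also have "\<dots> = (\<Sum>m\<in>{N'..<N}. MEAN x. G x) + (\<Sum>m<N'. MEAN x. \<bar>G x - G' x\<bar>)"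
  proof -
    have "periodic1 (\<lambda>x. \<bar>G x - G' x\<bar>)"
      using circle_funD(2)[OF G] circle_funD(2)[OF G'] by (simp add: periodic1_def)
    from integral_circ_reflect_shift[OF _ this] integral_circ_reflect_shift[OF circle_funD(1,2)[OF G]]
    show ?thesis by simp
  qed
  finally show ?thesis by simp
qed

text \<open>The convergence part of the Borel-Cantelli argument, in the form of monotone convergence.\<close>

lemma AE_tendsto_0_of_summable:
  fixes f :: "nat \<Rightarrow> real \<Rightarrow> real"
  assumes [measurable]: "\<And>m. f m \<in> borel_measurable borel" and f: "\<And>m x. 0 \<le> f m x" "\<And>m x. f m x \<le> B"
    and s: "summable (\<lambda>m. MEAN x. f m x)"
  shows "AE x in circ. (\<lambda>m. f m x) \<longlonglongrightarrow> 0"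
proof -
  have i: "integrable circ (f m)" for m
    by (rule integrable_circ[where B=B]) (use f in auto)
  have "(\<integral>\<^sup>+x. (\<Sum>m. ennreal (f m x)) \<partial>circ) = (\<Sum>m. \<integral>\<^sup>+x. ennreal (f m x) \<partial>circ)"
    by (rule nn_integral_suminf) auto
  also have "\<dots> = (\<Sum>m. ennreal (MEAN x. f m x))"
    using i f by (intro suminf_cong nn_integral_eq_integral) auto
  also have "\<dots> = ennreal (\<Sum>m. MEAN x. f m x)"
    using s f by (intro suminf_ennreal2) (auto intro: Bochner_Integration.integral_nonneg)
  finally have "(\<integral>\<^sup>+x. (\<Sum>m. ennreal (f m x)) \<partial>circ) \<noteq> \<infinity>" by simp
  then have "AE x in circ. (\<Sum>m. ennreal (f m x)) \<noteq> \<infinity>"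
    by (intro nn_integral_PInf_AE) auto
  then show ?thesis
  proof eventually_elim
    case (elim x)
    then have "summable (\<lambda>m. f m x)" using f by (intro summable_suminf_not_top) auto
    then show ?case by (rule summable_LIMSEQ_zero)
  qed
qed

lemma lacunary_separated:
  assumes "lacunary a"
  obtains n0 q where "separated_dilates (\<lambda>m. a (Suc (n0 + m))) q"
proof -
  from ereal_dense2[OF assms[unfolded lacunary_def]]
  obtain r where "1 < ereal r" and r2: "ereal r < liminf (\<lambda>x. ereal (of_int (a (x + 1)) / of_int (a x)))"
    by blast
  then have r: "1 < r" by simp
  from less_LiminfD[OF r2] obtain n0 where n0: "\<And>x. x \<ge> n0 \<Longrightarrow> r < of_int (a (x + 1)) / of_int (a x)"
    by (auto simp: eventually_sequentially)
  have nz: "a x \<noteq> 0" if "x \<ge> n0" for x using n0[OF that] r by auto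
  have incr: "\<bar>of_int (a x)\<bar> \<le> (1 / r) * \<bar>of_int (a (Suc x)) :: real\<bar>" if "x \<ge> n0" for x
  proof -
    have "r < \<bar>of_int (a (Suc x))\<bar> / \<bar>of_int (a x) :: real\<bar>"
      using n0[OF that] abs_ge_self[of "of_int (a (Suc x)) / of_int (a x) :: real"] by (simp add: abs_divide)
    then show ?thesis using nz[OF that] r by (simp add: field_simps)
  qed
  have "separated_dilates (\<lambda>m. a (Suc (n0 + m))) (1 / r)"
  proof
    fix m n :: nat assume "m \<le> n"
    then show "\<bar>of_int (a (Suc (n0 + m)))\<bar> \<le> (1 / r) ^ (n - m) * \<bar>of_int (a (Suc (n0 + n))) :: real\<bar>"
    proof (induction n rule: dec_induct)
      case (step n)
      have "(1 / r) ^ (n - m) * \<bar>of_int (a (Suc (n0 + n))) :: real\<bar>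
        \<le> (1 / r) ^ (n - m) * ((1 / r) * \<bar>of_int (a (Suc (n0 + Suc n)))\<bar>)"
        using incr[of "Suc (n0 + n)"] r by (intro mult_left_mono) auto
      with step show ?case by (simp add: Suc_diff_le mult_ac)
    qed simp
  qed (use r nz in auto)
  then show ?thesis by (rule that)
qed

lemma div_tendsto_0: "(\<lambda>N. c / real N) \<longlonglongrightarrow> 0"
  by (intro tendsto_divide_0[OF tendsto_const] filterlim_at_top_imp_at_infinity filterlim_real_sequentially)

lemma tendsto_power_exp:
  "(\<lambda>N. (1 - \<mu> / real N) ^ (N - n0)) \<longlonglongrightarrow> exp (- \<mu>)"
proof -
  have "(\<lambda>N. 1 - \<mu> / real N) \<longlonglongrightarrow> 1 - 0"
    by (intro tendsto_diff tendsto_const div_tendsto_0)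
  then have 1: "(\<lambda>N. 1 - \<mu> / real N) \<longlonglongrightarrow> 1" by simp
  from tendsto_divide[OF tendsto_exp_limit_sequentially[of "- \<mu>"] tendsto_power[OF 1, of n0]]
  have "(\<lambda>N. (1 + - \<mu> / real N) ^ N / (1 - \<mu> / real N) ^ n0) \<longlonglongrightarrow> exp (- \<mu>)" by simp
  moreover have "\<forall>\<^sub>F N in sequentially. (1 + - \<mu> / real N) ^ N / (1 - \<mu> / real N) ^ n0 = (1 - \<mu> / real N) ^ (N - n0)"
    using order_tendstoD(1)[OF 1 zero_less_one] eventually_ge_at_top[of n0]
  proof eventually_elim
    case (elim N)
    then have nz: "1 - \<mu> / real N \<noteq> 0" by linarith
    have "1 + - \<mu> / real N = 1 - \<mu> / real N" by simp
    then show ?case by (simp only: power_diff[OF nz elim(2)])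
  qed
  ultimately show ?thesis by (rule Lim_transform_eventually)
qed

lemma summable_fourth_power_geometric:
  fixes q :: real
  assumes q: "0 < q" "q < 1"
  shows "summable (\<lambda>m. real m ^ 4 * q ^ m)"
proof -
  have "(\<lambda>m. (1 + 1 / real m) ^ 4 * q) \<longlonglongrightarrow> (1 + 0) ^ 4 * q"
    by (intro tendsto_intros div_tendsto_0)
  then have "\<forall>\<^sub>F m in sequentially. (1 + 1 / real m) ^ 4 * q < (1 + q) / 2"
    using q by (intro order_tendstoD(2)[of _ q]) auto
  then obtain m0 where m0: "\<And>m. m \<ge> m0 \<Longrightarrow> (1 + 1 / real m) ^ 4 * q < (1 + q) / 2"
    by (auto simp: eventually_sequentially)
  show ?thesis
  proof (rule summable_ratio_test[of "(1 + q) / 2" "Suc m0"])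
    fix m assume m: "Suc m0 \<le> m"
    have "real (Suc m) ^ 4 * q ^ Suc m = ((1 + 1 / real m) ^ 4 * q) * (real m ^ 4 * q ^ m)"
    proof -
      have "real (Suc m) = (1 + 1 / real m) * real m" using m by (simp add: field_simps)
      then show ?thesis by (simp only: power_mult_distrib power_Suc mult_ac)
    qed
    also have "\<dots> \<le> ((1 + q) / 2) * (real m ^ 4 * q ^ m)"
      using m0[of m] m q by (intro mult_right_mono) auto
    finally show "norm (real (Suc m) ^ 4 * q ^ Suc m) \<le> (1 + q) / 2 * norm (real m ^ 4 * q ^ m)"
      using q by simp
  qed (use q in auto)
qed

lemma void_drop_initial:
  assumes sep: "separated_dilates (\<lambda>m. a (Suc (n0 + m))) q" and G: "circle_fun G"
  shows "\<bar>void (\<lambda>n. \<alpha> * of_int (a n)) (n0 + K) G - separated_dilates.mean_avoid (\<lambda>m. a (Suc (n0 + m))) G K \<alpha>\<bar>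
    \<le> real n0 * circ_mean G"
proof -
  interpret S: separated_dilates "\<lambda>m. a (Suc (n0 + m))" q by (rule sep)
  note [measurable] = circle_funD(1)[OF G]
  define A where "A x = (\<Prod>m<n0. 1 - G (\<alpha> * of_int (a (Suc m)) - x))" for x
  define B where "B x = (\<Prod>m<K. 1 - G (of_int (a (Suc (n0 + m))) * \<alpha> - x))" for x
  have [measurable]: "A \<in> borel_measurable borel" "B \<in> borel_measurable borel"
    unfolding A_def B_def by measurable
  have A01: "0 \<le> A x" "A x \<le> 1" and B01: "0 \<le> B x" "B x \<le> 1" for x
    using circle_funD(3,4)[OF G] by (auto simp: A_def B_def intro!: prod_nonneg prod_le_1)
  have iG: "integrable circ (\<lambda>x. G (t - x))" for t
    by (rule integrable_circ[where B=1]) (use circle_funD(5)[OF G] in auto)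
  have split: "(\<Prod>m<n0 + k. f m) = (\<Prod>m<n0. f m) * (\<Prod>m<k. f (n0 + m))" for f :: "nat \<Rightarrow> real" and k
    by (induction k) (auto simp: mult.assoc)
  have AB: "(\<Prod>n\<in>{1..n0 + K}. 1 - G (\<alpha> * of_int (a n) - x)) = A x * B x" for x
    unfolding One_nat_def prod.atLeast1_atMost_eq A_def B_def split
    by (simp add: mult.commute)
  have "\<bar>(MEAN x. A x * B x) - circ_mean B\<bar> \<le> (MEAN x. \<bar>A x * B x - B x\<bar>)"
    by (rule abs_integral_circ_diff_le[where B=1]) (use A01 B01 in \<open>auto simp: abs_mult mult_le_one\<close>)
  also have "\<dots> \<le> (MEAN x. (\<Sum>m<n0. G (\<alpha> * of_int (a (Suc m)) - x)))"
  proof (rule integral_mono')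
    fix x
    have "0 \<le> 1 - A x" "1 - A x \<le> (\<Sum>m<n0. G (\<alpha> * of_int (a (Suc m)) - x))"
      using prod_one_minus_diff[of "\<lambda>m. G (\<alpha> * of_int (a (Suc m)) - x)" 0 n0] circle_funD(3,4)[OF G]
      by (auto simp: A_def atLeast0LessThan)
    moreover have "\<bar>A x * B x - B x\<bar> = (1 - A x) * B x"
    proof -
      have "A x * B x - B x = - ((1 - A x) * B x)" by (simp add: algebra_simps)
      then show ?thesis using A01[of x] B01[of x] by (simp only: abs_minus_cancel) simp
    qed
    moreover have "(1 - A x) * B x \<le> 1 - A x" using A01[of x] B01[of x] by (intro mult_right_le_one_le) auto
    ultimately show "\<bar>A x * B x - B x\<bar> \<le> (\<Sum>m<n0. G (\<alpha> * of_int (a (Suc m)) - x))" by linarith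
  qed (use iG circle_funD(3)[OF G] in \<open>auto intro!: Bochner_Integration.integrable_sum sum_nonneg\<close>)
  also have "\<dots> = real n0 * circ_mean G"
    using iG integral_circ_reflect_shift[OF circle_funD(1,2)[OF G]] by simp
  finally show ?thesis unfolding void_def AB S.mean_avoid_def B_def .
qed

text \<open>With \<open>N = m\<^sup>4\<close> points and gap \<open>m\<close>, the bound of \<open>second_moment\<close> is of order
\<open>m\<^sup>4 (m / m\<^sup>8 + q ^ m)\<close>, which is summable; at the same time consecutive fourth powers have ratio
tending to 1.\<close>

lemma AE_void_fourth_powers:
  assumes sep: "separated_dilates (\<lambda>m. a (Suc (n0 + m))) q" and st: "steps M s v"
  shows "AE \<alpha> in circ. (\<lambda>m. void (\<lambda>n. \<alpha> * of_int (a n)) (m ^ 4) (step_fun M (\<lambda>i. s i / real (m ^ 4)) v))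
           \<longlonglongrightarrow> exp (- mass M s v)"
proof -
  interpret S: separated_dilates "\<lambda>m. a (Suc (n0 + m))" q by (rule sep)
  define G where "G m = step_fun M (\<lambda>i. s i / real (m ^ 4)) v" for m
  define \<mu> where "\<mu> = mass M s v"
  \<comment> \<open>From \<open>m1\<close> on, the window fits on the circle and \<open>1 - \<mu>/N\<close> lies in \<open>[0,1]\<close>.\<close>
  define m1 where "m1 = Suc (n0 + nat \<lceil>\<bar>s M - s 0\<bar>\<rceil> + nat \<lceil>\<bar>\<mu>\<bar>\<rceil>)"
  define K where "K m = m ^ 4 - n0" for m :: nat
  have m1: "m \<ge> 1" "n0 \<le> m ^ 4" "s M - s 0 \<le> real (m ^ 4)" "\<bar>\<mu>\<bar> \<le> real (m ^ 4)" if "m \<ge> m1" for m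
  proof -
    show m: "m \<ge> 1" using that by (simp add: m1_def)
    then have m4: "m \<le> m ^ 4" by (intro self_le_power) auto
    show "n0 \<le> m ^ 4" using that m4 by (simp add: m1_def)
    have "real (nat \<lceil>\<bar>s M - s 0\<bar>\<rceil>) \<le> real (m ^ 4)" "real (nat \<lceil>\<bar>\<mu>\<bar>\<rceil>) \<le> real (m ^ 4)"
      using that m4 unfolding m1_def by (intro of_nat_mono; linarith)+
    then show "s M - s 0 \<le> real (m ^ 4)" "\<bar>\<mu>\<bar> \<le> real (m ^ 4)" by linarith+
  qed
  have stm: "steps M (\<lambda>i. s i / real (m ^ 4)) v" for m
    using st by (auto simp: steps_def intro: divide_right_mono)
  have G: "circle_fun (G m)" if "m \<ge> m1" for m
    unfolding G_def using m1[OF that]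
    by (intro step_fun_circle_fun stm) (simp add: field_simps)
  have \<tau>: "(MEAN \<beta>. G m \<beta>) = \<mu> / real (m ^ 4)" for m
    by (simp add: G_def integral_step_fun \<mu>_def mass_def sum_divide_distrib diff_divide_distrib right_diff_distrib)
  define c where "c m = (1 - \<mu> / real (m ^ 4)) ^ K m" for m
  have \<mu>0: "0 \<le> \<mu>" using st by (auto simp: \<mu>_def mass_def steps_def intro!: sum_nonneg)
  have c01: "0 \<le> c m" "c m \<le> 1" if "m \<ge> m1" for m
  proof -
    have "0 \<le> 1 - \<mu> / real (m ^ 4)" "1 - \<mu> / real (m ^ 4) \<le> 1" using m1[OF that] \<mu>0 by (auto simp: field_simps)
    then show "0 \<le> c m" "c m \<le> 1" by (auto simp: c_def intro: power_le_one)
  qed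
  define f where "f m \<alpha> = (if m \<ge> m1 then (S.mean_avoid (G m) (K m) \<alpha> - c m)\<^sup>2 else 0)" for m \<alpha>
  have f01: "0 \<le> f m \<alpha>" "f m \<alpha> \<le> 1" for m \<alpha>
  proof -
    have "\<bar>S.mean_avoid (G m) (K m) \<alpha> - c m\<bar> \<le> 1" if "m \<ge> m1"
      using S.mean_avoid_unit[OF G[OF that], of "K m" \<alpha>] c01[OF that] by linarith
    then show "0 \<le> f m \<alpha>" "f m \<alpha> \<le> 1" by (auto simp: f_def abs_square_le_1)
  qed
  have fm [measurable]: "f m \<in> borel_measurable borel" for m
  proof (cases "m \<ge> m1")
    case True
    note [measurable] = S.mean_avoid_measurable[OF G[OF True]]
    show ?thesis using True unfolding f_def by simp
  next
    case False
    then have "f m = (\<lambda>_. 0)" by (auto simp: f_def)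
    then show ?thesis by simp
  qed
  \<comment> \<open>The second moment bound with at most \<open>m\<^sup>4\<close> points, gap \<open>m\<close>, modulus \<open>2 M\<close> and mean \<open>\<mu>/m\<^sup>4\<close>.\<close>
  define R where "R m = 14 * \<mu>\<^sup>2 * inverse (real m ^ 3) + (8 * real M / (1 - q)) * (real m ^ 4 * q ^ m)" for m
  have sR: "summable R"
    unfolding R_def using summable_fourth_power_geometric[OF S.q]
    by (intro summable_add summable_mult inverse_power_summable) auto
  have fR: "(MEAN \<alpha>. f m \<alpha>) \<le> R m" if m: "m \<ge> m1" for m
  proof -
    have "(MEAN \<alpha>. f m \<alpha>) = (MEAN \<alpha>. (S.mean_avoid (G m) (K m) \<alpha> - (1 - (MEAN \<beta>. G m \<beta>)) ^ K m)\<^sup>2)"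
      using m by (simp add: f_def c_def \<tau>)
    also have "\<dots> \<le> K m * (14 * real m * (MEAN \<beta>. G m \<beta>)\<^sup>2 + 4 * ((2 * M) * q ^ m / (1 - q)))"
      by (rule S.second_moment[OF G[OF m]])
         (use step_fun_modulus[OF stm] m1[OF m] in \<open>auto simp: G_def\<close>)
    also have "\<dots> \<le> real (m ^ 4) * (14 * real m * (MEAN \<beta>. G m \<beta>)\<^sup>2 + 4 * ((2 * M) * q ^ m / (1 - q)))"
      using S.q by (intro mult_right_mono add_nonneg_nonneg mult_nonneg_nonneg divide_nonneg_nonneg) (auto simp: K_def)
    also have "\<dots> = R m"
      using m1(1)[OF m] unfolding R_def \<tau> by (simp add: field_simps power2_eq_square eval_nat_numeral)
    finally show ?thesis .
  qed
  have "summable (\<lambda>m. MEAN \<alpha>. f m \<alpha>)"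
  proof (rule summable_comparison_test_ev[OF _ sR])
    show "\<forall>\<^sub>F m in sequentially. norm (MEAN \<alpha>. f m \<alpha>) \<le> R m"
      using eventually_ge_at_top[of m1]
    proof eventually_elim
      case (elim m)
      have "0 \<le> (MEAN \<alpha>. f m \<alpha>)" by (rule Bochner_Integration.integral_nonneg) (rule f01)
      with fR[OF elim] show ?case by simp
    qed
  qed
  from AE_tendsto_0_of_summable[OF fm f01 this]
  show ?thesis
  proof eventually_elim
    case (elim \<alpha>)
    have sub: "strict_mono (\<lambda>m::nat. m ^ 4)" by (auto simp: strict_mono_def power_strict_mono)
    have c_lim: "c \<longlonglongrightarrow> exp (- \<mu>)"
      using LIMSEQ_subseq_LIMSEQ[OF tendsto_power_exp[of \<mu> n0] sub] by (simp add: c_def[abs_def] K_def o_def)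
    have "(\<lambda>m. sqrt (f m \<alpha>)) \<longlonglongrightarrow> sqrt 0" by (intro tendsto_real_sqrt elim)
    moreover have "\<forall>\<^sub>F m in sequentially. sqrt (f m \<alpha>) = \<bar>S.mean_avoid (G m) (K m) \<alpha> - c m\<bar>"
      using eventually_ge_at_top[of m1] by eventually_elim (simp add: f_def)
    ultimately have d1: "(\<lambda>m. \<bar>S.mean_avoid (G m) (K m) \<alpha> - c m\<bar>) \<longlonglongrightarrow> 0"
      by (simp add: Lim_transform_eventually)
    have d2: "(\<lambda>m. real n0 * (\<mu> / real (m ^ 4))) \<longlonglongrightarrow> 0"
    proof -
      have "(\<lambda>N. real n0 * (\<mu> / real N)) \<longlonglongrightarrow> real n0 * 0"
        by (intro tendsto_mult tendsto_const div_tendsto_0)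
      from LIMSEQ_subseq_LIMSEQ[OF this sub] show ?thesis by (simp add: o_def)
    qed
    let ?V = "\<lambda>m. void (\<lambda>n. \<alpha> * of_int (a n)) (m ^ 4) (G m)"
    have "(\<lambda>m. ?V m - c m) \<longlonglongrightarrow> 0"
    proof (rule Lim_null_comparison)
      show "(\<lambda>m. real n0 * (\<mu> / real (m ^ 4)) + \<bar>S.mean_avoid (G m) (K m) \<alpha> - c m\<bar>) \<longlonglongrightarrow> 0"
        using tendsto_add[OF d2 d1] by simp
      show "\<forall>\<^sub>F m in sequentially. norm (?V m - c m) \<le> real n0 * (\<mu> / real (m ^ 4)) + \<bar>S.mean_avoid (G m) (K m) \<alpha> - c m\<bar>"
        using eventually_ge_at_top[of m1]
      proof eventually_elim
        case (elim m)
        have "n0 + K m = m ^ 4" using m1[OF elim] by (simp add: K_def)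
        with void_drop_initial[OF sep G[OF elim], of \<alpha> "K m"] \<tau>[of m]
        show ?case by simp
      qed
    qed
    from tendsto_add[OF this c_lim] show ?case by (simp add: G_def \<mu>_def)
  qed
qed

lemma ex_fourth_root: "\<exists>m::nat. m ^ 4 \<le> N \<and> N < (m + 1) ^ 4"
proof -
  define m where "m = (LEAST m::nat. N < (m + 1) ^ 4)"
  have ex: "N < (N + 1) ^ 4" using self_le_power[of "N + 1" 4] by simp
  have 1: "N < (m + 1) ^ 4" unfolding m_def by (rule LeastI[of "\<lambda>m. N < (m + 1) ^ 4", OF ex])
  have "m ^ 4 \<le> N"
  proof (cases m)
    case (Suc k)
    have "\<not> N < (k + 1) ^ 4" using not_less_Least[of k "\<lambda>m. N < (m + 1) ^ 4"] Suc by (simp add: m_def)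
    then show ?thesis using Suc by simp
  qed simp
  with 1 show ?thesis by blast
qed

text \<open>Two approximations are made at once: the data \<open>s\<close>, \<open>v\<close> are rounded down to multiples of \<open>1/p\<close>, and
\<open>N\<close> is replaced by the largest fourth power below it.  Both perturb the scaled step function by a
small amount in \<open>L\<^sup>1\<close>, relative to \<open>1/N\<close>.\<close>

lemma void_limit_interpolate:
  assumes rat: "\<And>M p (ks :: int list) vs. steps M (\<lambda>i. of_int (ks ! i) / real p) (\<lambda>i. of_int (vs ! i) / real p) \<Longrightarrow>
     (\<lambda>m. void \<theta> (m ^ 4) (step_fun M (\<lambda>i. of_int (ks ! i) / real p / real (m ^ 4)) (\<lambda>i. of_int (vs ! i) / real p)))
       \<longlonglongrightarrow> exp (- mass M (\<lambda>i. of_int (ks ! i) / real p) (\<lambda>i. of_int ((vs :: int list) ! i) / real p))"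
    and st: "steps M s v"
  shows "(\<lambda>N. void \<theta> N (step_fun M (\<lambda>i. s i / real N) v)) \<longlonglongrightarrow> exp (- mass M s v)"
proof -
  define ks where "ks p = map (\<lambda>i. \<lfloor>real p * s i\<rfloor>) [0..<Suc M]" for p :: nat
  define vs where "vs p = map (\<lambda>i. \<lfloor>real p * v i\<rfloor>) [0..<M]" for p :: nat
  define s' where "s' p i = of_int (ks p ! i) / real p" for p i
  define v' where "v' p i = of_int (vs p ! i) / real p" for p i
  have s'_eq: "s' p i = of_int \<lfloor>real p * s i\<rfloor> / real p" if "i \<le> M" for p i
    using that by (simp add: s'_def ks_def nth_append del: upt_Suc)
  have v'_eq: "v' p i = of_int \<lfloor>real p * v i\<rfloor> / real p" if "i < M" for p i
    using that by (simp add: v'_def vs_def)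
  have close: "\<bar>x - of_int \<lfloor>real p * x\<rfloor> / real p\<bar> \<le> 1 / real p" if "p > 0" for x p
  proof -
    have "\<bar>real p * x - of_int \<lfloor>real p * x\<rfloor>\<bar> / real p \<le> 1 / real p"
      by (intro divide_right_mono) linarith+
    moreover have "\<bar>real p * x - of_int \<lfloor>real p * x\<rfloor>\<bar> / real p = \<bar>x - of_int \<lfloor>real p * x\<rfloor> / real p\<bar>"
    proof -
      have "x - of_int \<lfloor>real p * x\<rfloor> / real p = (real p * x - of_int \<lfloor>real p * x\<rfloor>) / real p"
        using that by (simp add: field_simps)
      then show ?thesis by (simp only: abs_divide abs_of_nat)
    qed
    ultimately show ?thesis by simp
  qed
  have st': "steps M (s' p) (v' p)" for p
    unfolding steps_def
  proof (intro allI impI)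
    fix i assume i: "i < M"
    have s: "s i \<le> s (Suc i)" and v: "0 \<le> v i" "v i \<le> 1" using st i by (auto simp: steps_def)
    have "of_int \<lfloor>real p * v i\<rfloor> \<le> real p * 1"
      using v by (intro order_trans[OF of_int_floor_le] mult_left_mono) auto
    then have "v' p i \<le> 1" using i by (cases "p = 0") (auto simp: v'_eq divide_le_eq)
    then show "s' p i \<le> s' p (Suc i) \<and> 0 \<le> v' p i \<and> v' p i \<le> 1"
      using i s v by (auto simp: s'_eq v'_eq intro!: divide_right_mono floor_mono mult_left_mono)
  qed
  define D where "D = (\<Sum>i<M. 2 + (s (Suc i) - s i))"
  define E where "E = mass M s v + (\<Sum>i<M. \<bar>s i\<bar> + \<bar>s (Suc i)\<bar>)"
  have mass_close: "\<bar>mass M s v - mass M (s' p) (v' p)\<bar> \<le> D / real p" if p: "p > 0" for p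
  proof -
    have "\<bar>mass M s v - mass M (s' p) (v' p)\<bar> = \<bar>MEAN \<beta>. step_fun M s v \<beta> - step_fun M (s' p) (v' p) \<beta>\<bar>"
      by (subst Bochner_Integration.integral_diff) (auto simp: integral_step_fun, auto simp: step_fun_def[abs_def])
    also have "\<dots> \<le> (\<Sum>i<M. \<bar>s i - s' p i\<bar> + \<bar>s (Suc i) - s' p (Suc i)\<bar> + \<bar>v i - v' p i\<bar> * (s (Suc i) - s i))"
      using integral_abs_bound step_fun_L1_dist[OF st st'] by (rule order_trans)
    also have "\<dots> \<le> (\<Sum>i<M. 1 / real p + 1 / real p + 1 / real p * (s (Suc i) - s i))"
      using close[OF p] st by (intro sum_mono add_mono mult_right_mono) (auto simp: s'_eq v'_eq steps_def)
    also have "\<dots> = D / real p" by (simp add: D_def sum_divide_distrib add_divide_distrib)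
    finally show ?thesis .
  qed
  obtain m :: "nat \<Rightarrow> nat" where m: "\<And>N. m N ^ 4 \<le> N" "\<And>N. N < (m N + 1) ^ 4"
    using ex_fourth_root by metis
  have m_top: "filterlim m at_top sequentially"
    unfolding filterlim_at_top
  proof
    fix c
    show "\<forall>\<^sub>F N in sequentially. c \<le> m N"
      using eventually_ge_at_top[of "c ^ 4"]
    proof eventually_elim
      case (elim N)
      show ?case
      proof (rule ccontr)
        assume "\<not> c \<le> m N"
        then have "(m N + 1) ^ 4 \<le> c ^ 4" by (intro power_mono) auto
        with m(2)[of N] elim show False by linarith
      qed
    qed
  qed
  \<comment> \<open>The relative size of the fourth power used in place of \<open>N\<close>.\<close>
  define \<rho> where "\<rho> N = real (m N ^ 4) / real N" for N
  have \<rho>: "\<rho> N \<le> 1" for N 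
  proof -
    have "real (m N ^ 4) \<le> real N" using m(1) by (rule of_nat_mono)
    then show ?thesis unfolding \<rho>_def by (cases "N = 0") (simp_all del: of_nat_power of_nat_le_iff)
  qed
  have \<rho>_lim: "\<rho> \<longlonglongrightarrow> 1"
  proof (rule real_tendsto_sandwich)
    have "(\<lambda>k. (1 - inverse (real (Suc k))) ^ 4) \<longlonglongrightarrow> (1 - 0) ^ 4"
      by (intro tendsto_intros LIMSEQ_inverse_real_of_nat)
    then show "(\<lambda>N. (1 - inverse (real (Suc (m N)))) ^ 4) \<longlonglongrightarrow> 1"
      using filterlim_compose[OF _ m_top] by fastforce
    show "\<forall>\<^sub>F N in sequentially. (1 - inverse (real (Suc (m N)))) ^ 4 \<le> \<rho> N"
      using eventually_gt_at_top[of 0]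
    proof eventually_elim
      case (elim N)
      have "1 - inverse (real (Suc (m N))) = real (m N) / real (m N + 1)" by (simp add: field_simps)
      then have "(1 - inverse (real (Suc (m N)))) ^ 4 = real (m N ^ 4) / real ((m N + 1) ^ 4)"
        by (simp add: power_divide)
      also have "\<dots> \<le> real (m N ^ 4) / real N"
        using m(2)[of N] elim by (intro divide_left_mono) (auto simp del: of_nat_power)
      finally show ?case by (simp add: \<rho>_def)
    qed
  qed (use \<rho> in auto)
  let ?V = "\<lambda>N. void \<theta> N (step_fun M (\<lambda>i. s i / real N) v)"
  let ?V' = "\<lambda>p m. void \<theta> (m ^ 4) (step_fun M (\<lambda>i. s' p i / real (m ^ 4)) (v' p))"
  have main: "\<bar>?V N - ?V' p (m N)\<bar> \<le> (1 - \<rho> N) * E + D / real p"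
    if p: "p > 0" and N: "N > 0" "s M - s 0 \<le> real N" and mN: "m N > 0" "s' p M - s' p 0 \<le> real (m N)" for N p
  proof -
    let ?G = "step_fun M (\<lambda>i. s i / real N) v" and ?G' = "step_fun M (\<lambda>i. s' p i / real (m N ^ 4)) (v' p)"
    let ?r = "real (m N ^ 4)"
    let ?t = "\<lambda>i. \<bar>s i / real N - s' p i / ?r\<bar> + \<bar>s (Suc i) / real N - s' p (Suc i) / ?r\<bar>
          + \<bar>v i - v' p i\<bar> * (s (Suc i) / real N - s i / real N)"
    let ?u = "\<lambda>j. \<bar>s j / real N - s' p j / ?r\<bar>"
    have "m N \<le> m N ^ 4" using mN by (intro self_le_power) auto
    then have mN4: "s' p M - s' p 0 \<le> ?r" "?r > 0" using mN by (linarith, simp)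
    have stN: "steps M (\<lambda>i. s i / real N) v" using st by (auto simp: steps_def intro: divide_right_mono)
    have stN': "steps M (\<lambda>i. s' p i / ?r) (v' p)"
      using st'[of p] by (auto simp: steps_def intro: divide_right_mono)
    have G: "circle_fun ?G" by (rule step_fun_circle_fun[OF stN]) (use N in \<open>simp add: field_simps\<close>)
    have G': "circle_fun ?G'" by (rule step_fun_circle_fun[OF stN']) (use mN4 in \<open>simp add: field_simps\<close>)
    have "?r * (MEAN \<beta>. \<bar>?G \<beta> - ?G' \<beta>\<bar>)
      \<le> ?r * (\<Sum>i<M. ?t i)"
      by (intro mult_left_mono step_fun_L1_dist stN stN') auto
    also have "\<dots> = (\<Sum>i<M. ?r * (?t i))"
      by (rule sum_distrib_left)
    also have "\<dots> \<le> (\<Sum>i<M. (1 - \<rho> N) * (\<bar>s i\<bar> + \<bar>s (Suc i)\<bar>) + (2 + (s (Suc i) - s i)) / real p)"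
    proof (rule sum_mono)
      fix i assume "i \<in> {..<M}" then have i: "i < M" by simp
      have si: "s i \<le> s (Suc i)" using st i by (simp add: steps_def)
      have *: "?r * ?u j \<le> (1 - \<rho> N) * \<bar>s j\<bar> + 1 / real p" if "j \<le> M" for j
      proof -
        have "?r * ?u j = \<bar>?r * (s j / real N - s' p j / ?r)\<bar>"
          by (simp add: abs_mult)
        also have "?r * (s j / real N - s' p j / ?r) = (s j - s' p j) - (1 - \<rho> N) * s j"
        proof -
          have alg: "R * (x / n - y / R) = (x - y) - (1 - R / n) * x" if "R > 0" for R x y n :: real
            using that by (simp add: right_diff_distrib left_diff_distrib)
          show ?thesis unfolding \<rho>_def by (rule alg[OF mN4(2)])
        qed
        also have "\<bar>\<dots>\<bar> \<le> \<bar>s j - s' p j\<bar> + (1 - \<rho> N) * \<bar>s j\<bar>"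
          using abs_triangle_ineq4[of "s j - s' p j" "(1 - \<rho> N) * s j"] \<rho>[of N] by (simp add: abs_mult)
        also have "\<bar>s j - s' p j\<bar> \<le> 1 / real p" using close[OF p] that by (simp add: s'_eq)
        finally show ?thesis by simp
      qed
      have "?r * (\<bar>v i - v' p i\<bar> * (s (Suc i) / real N - s i / real N)) = \<rho> N * (\<bar>v i - v' p i\<bar> * (s (Suc i) - s i))"
        unfolding \<rho>_def diff_divide_distrib[symmetric] by (simp add: mult_ac)
      also have "\<dots> \<le> 1 * (1 / real p * (s (Suc i) - s i))"
        using \<rho>[of N] close[OF p, of "v i"] i si
        by (intro mult_mono mult_nonneg_nonneg) (auto simp: v'_eq \<rho>_def)
      finally have "?r * (\<bar>v i - v' p i\<bar> * (s (Suc i) / real N - s i / real N)) \<le> (s (Suc i) - s i) / real p" by simp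
      with *[of i] *[of "Suc i"] i
      show "?r * (?t i) \<le> (1 - \<rho> N) * (\<bar>s i\<bar> + \<bar>s (Suc i)\<bar>) + (2 + (s (Suc i) - s i)) / real p"
        unfolding distrib_left add_divide_distrib by linarith
    qed
    also have "\<dots> = (1 - \<rho> N) * (\<Sum>i<M. \<bar>s i\<bar> + \<bar>s (Suc i)\<bar>) + D / real p"
      by (subst sum.distrib) (simp only: sum_distrib_left sum_divide_distrib D_def)
    finally have 1: "?r * (MEAN \<beta>. \<bar>?G \<beta> - ?G' \<beta>\<bar>) \<le> (1 - \<rho> N) * (\<Sum>i<M. \<bar>s i\<bar> + \<bar>s (Suc i)\<bar>) + D / real p" .
    have "(MEAN \<beta>. ?G \<beta>) = mass M s v / real N"
      by (simp add: integral_step_fun mass_def sum_divide_distrib diff_divide_distrib right_diff_distrib)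
    then have 2: "real (N - m N ^ 4) * (MEAN \<beta>. ?G \<beta>) = (1 - \<rho> N) * mass M s v"
      using N m(1)[of N] by (simp add: \<rho>_def of_nat_diff field_simps del: of_nat_power)
    have "(1 - \<rho> N) * E = (1 - \<rho> N) * mass M s v + (1 - \<rho> N) * (\<Sum>i<M. \<bar>s i\<bar> + \<bar>s (Suc i)\<bar>)"
      by (simp only: E_def distrib_left)
    with void_lipschitz[OF G G' m(1)[of N], of \<theta>] 1 2 show ?thesis by linarith
  qed
  show ?thesis
  proof (rule LIMSEQ_I)
    fix e :: real assume e: "e > 0"
    have Dp: "(\<lambda>p. D / real p) \<longlonglongrightarrow> 0"
      by (intro div_tendsto_0)
    have "(\<lambda>p. mass M s v - mass M (s' p) (v' p)) \<longlonglongrightarrow> 0"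
      by (rule Lim_null_comparison[OF _ Dp]) (use eventually_gt_at_top[of 0] in \<open>eventually_elim; use mass_close in simp\<close>)
    from tendsto_diff[OF tendsto_const[of "mass M s v"] this]
    have "(\<lambda>p. exp (- mass M (s' p) (v' p))) \<longlonglongrightarrow> exp (- mass M s v)" by (intro tendsto_intros) simp
    then have p1: "\<forall>\<^sub>F p in sequentially. dist (exp (- mass M (s' p) (v' p))) (exp (- mass M s v)) < e / 4"
      by (rule tendstoD) (use e in simp)
    have p2: "\<forall>\<^sub>F p in sequentially. D / real p < e / 4"
      by (rule order_tendstoD(2)[OF Dp]) (use e in simp)
    have "\<forall>\<^sub>F p in sequentially. dist (exp (- mass M (s' p) (v' p))) (exp (- mass M s v)) < e / 4 \<and> D / real p < e / 4 \<and> p > 0"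
      using p1 p2 eventually_gt_at_top[of 0] by eventually_elim auto
    then obtain p where p: "\<bar>exp (- mass M (s' p) (v' p)) - exp (- mass M s v)\<bar> < e / 4" "D / real p < e / 4" "p > 0"
      by (auto simp: eventually_sequentially dist_real_def)
    have "(\<lambda>N. ?V' p (m N)) \<longlonglongrightarrow> exp (- mass M (s' p) (v' p))"
      using filterlim_compose[OF rat[OF st'[of p, unfolded s'_def v'_def]] m_top] by (simp add: s'_def[abs_def] v'_def[abs_def])
    from tendstoD[OF this, of "e / 4"] have 1: "\<forall>\<^sub>F N in sequentially. \<bar>?V' p (m N) - exp (- mass M (s' p) (v' p))\<bar> < e / 4"
      using e by (simp add: dist_real_def)
    have "(\<lambda>N. (1 - \<rho> N) * E) \<longlonglongrightarrow> (1 - 1) * E" by (intro tendsto_intros \<rho>_lim)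
    from order_tendstoD(2)[OF this, of "e / 4"] have 2: "\<forall>\<^sub>F N in sequentially. (1 - \<rho> N) * E < e / 4" using e by simp
    have 3: "\<forall>\<^sub>F N in sequentially. s M - s 0 \<le> real N"
      using eventually_ge_at_top[of "nat \<lceil>s M - s 0\<rceil>"] by eventually_elim linarith
    have 4: "\<forall>\<^sub>F N in sequentially. s' p M - s' p 0 \<le> real (m N)"
      using m_top[unfolded filterlim_at_top, rule_format, of "nat \<lceil>s' p M - s' p 0\<rceil>"] by eventually_elim linarith
    have 5: "\<forall>\<^sub>F N in sequentially. 1 \<le> m N" using m_top[unfolded filterlim_at_top] by blast
    have "\<forall>\<^sub>F N in sequentially. norm (?V N - exp (- mass M s v)) < e"
      using 1 2 3 4 5 eventually_gt_at_top[of 0]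
    proof eventually_elim
      case (elim N)
      have mp: "m N > 0" using elim(5) by linarith
      show ?case unfolding real_norm_def
        using main[OF p(3) elim(6,3) mp elim(4)] elim(1,2) p(1,2) by linarith
    qed
    then show "\<exists>no. \<forall>N\<ge>no. norm (?V N - exp (- mass M s v)) < e" by (simp add: eventually_sequentially)
  qed
qed

text \<open>The exceptional null set does not depend on the step function, as only the countably many rational
step functions contribute to it.\<close>

theorem AE_void_limit:
  assumes "lacunary a"
  shows "AE \<alpha> in circ. \<forall>M s v. steps M s v \<longrightarrow>
    (\<lambda>N. void (\<lambda>n. \<alpha> * of_int (a n)) N (step_fun M (\<lambda>i. s i / real N) v)) \<longlonglongrightarrow> exp (- mass M s v)"
proof -
  obtain n0 q where sep: "separated_dilates (\<lambda>m. a (Suc (n0 + m))) q"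
    using lacunary_separated[OF assms] .
  let ?s = "\<lambda>d. case d of (M::nat, p::nat, ks::int list, vs::int list) \<Rightarrow> (\<lambda>i. of_int (ks ! i) / real p)"
  let ?v = "\<lambda>d. case d of (M::nat, p::nat, ks::int list, vs::int list) \<Rightarrow> (\<lambda>i. of_int (vs ! i) / real p)"
  let ?L = "\<lambda>\<alpha> d. steps (fst d) (?s d) (?v d) \<longrightarrow>
     (\<lambda>m. void (\<lambda>n. \<alpha> * of_int (a n)) (m ^ 4) (step_fun (fst d) (\<lambda>i. ?s d i / real (m ^ 4)) (?v d)))
        \<longlonglongrightarrow> exp (- mass (fst d) (?s d) (?v d))"
  have "AE \<alpha> in circ. \<forall>d. ?L \<alpha> d"
    unfolding AE_all_countable
  proof
    fix d
    show "AE \<alpha> in circ. ?L \<alpha> d"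
      by (cases "steps (fst d) (?s d) (?v d)") (use AE_void_fourth_powers[OF sep] in auto)
  qed
  then show ?thesis
  proof eventually_elim
    case (elim \<alpha>)
    show ?case
    proof (intro allI impI)
      fix M s v assume st: "steps M s v"
      show "(\<lambda>N. void (\<lambda>n. \<alpha> * of_int (a n)) N (step_fun M (\<lambda>i. s i / real N) v)) \<longlonglongrightarrow> exp (- mass M s v)"
      proof (rule void_limit_interpolate[OF _ st])
        fix M p ks vs
        show "steps M (\<lambda>i. of_int (ks ! i) / real p) (\<lambda>i. of_int (vs ! i) / real p) \<Longrightarrow>
     (\<lambda>m. void (\<lambda>n. \<alpha> * of_int (a n)) (m ^ 4) (step_fun M (\<lambda>i. of_int (ks ! i) / real p / real (m ^ 4)) (\<lambda>i. of_int (vs ! i) / real p)))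
       \<longlonglongrightarrow> exp (- mass M (\<lambda>i. of_int (ks ! i) / real p) (\<lambda>i. of_int ((vs :: int list) ! i) / real p))"
          using elim[rule_format, of "(M, p, ks, vs)"] by simp
      qed
    qed
  qed
qed

section \<open>Joint Poisson law of window counts\<close>

text \<open>Convergence of generating functions on \<open>(0,1)\<close> implies convergence of the coefficients: once the
lower coefficients are known to converge, division by \<open>w ^ k\<close> isolates the \<open>k\<close>-th one up to an
error of at most \<open>w\<close>, uniformly in \<open>N\<close>.\<close>

lemma coefficient_limits:
  fixes b :: "nat \<Rightarrow> nat \<Rightarrow> real" and \<beta> :: "nat \<Rightarrow> real"
  assumes b: "\<And>N i. 0 \<le> b N i" "\<And>N. (\<Sum>i\<le>N. b N i) \<le> 1"
    and \<beta>: "\<And>i. 0 \<le> \<beta> i" "summable \<beta>" "suminf \<beta> \<le> 1"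
    and lim: "\<And>w. 0 < w \<Longrightarrow> w < 1 \<Longrightarrow> (\<lambda>N. \<Sum>i\<le>N. b N i * w ^ i) \<longlonglongrightarrow> (\<Sum>i. \<beta> i * w ^ i)"
  shows "(\<lambda>N. b N k) \<longlonglongrightarrow> \<beta> k"
proof (induction k rule: less_induct)
  case (less k)
  show ?case
  proof (rule LIMSEQ_I)
    fix e :: real assume e: "e > 0"
    \<comment> \<open>The tails beyond the \<open>k\<close>-th term are at most \<open>w ^ (k + 1)\<close>, which has to be small against \<open>e w ^ k\<close>.\<close>
    define w where "w = min (1 / 2) (e / 2)"
    have w: "0 < w" "w < 1" "w \<le> e / 2" using e by (auto simp: w_def)
    define S where "S N = (\<Sum>i\<le>N. b N i * w ^ i)" for N
    define S' where "S' = (\<Sum>i. \<beta> i * w ^ i)"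
    have "(\<lambda>N. (S N - S') - (\<Sum>i<k. (b N i - \<beta> i) * w ^ i)) \<longlonglongrightarrow> (S' - S') - (\<Sum>i<k. (\<beta> i - \<beta> i) * w ^ i)"
      unfolding S_def S'_def using less lim[OF w(1,2)] by (intro tendsto_intros) auto
    then have "(\<lambda>N. (S N - S') - (\<Sum>i<k. (b N i - \<beta> i) * w ^ i)) \<longlonglongrightarrow> 0" by simp
    then have "\<forall>\<^sub>F N in sequentially. \<bar>(S N - S') - (\<Sum>i<k. (b N i - \<beta> i) * w ^ i)\<bar> < e / 2 * w ^ k"
      using e w by (auto dest!: tendstoD[of _ _ _ "e / 2 * w ^ k"] simp: dist_real_def)
    then have "\<forall>\<^sub>F N in sequentially. norm (b N k - \<beta> k) < e"
      using eventually_ge_at_top[of k]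
    proof eventually_elim
      case (elim N)
      define t where "t = (\<Sum>i\<in>{Suc k..N}. b N i * w ^ i)"
      define t' where "t' = (\<Sum>i. \<beta> (i + Suc k) * w ^ (i + Suc k))"
      have wp: "0 \<le> w ^ i" "w ^ i \<le> 1" for i using w by (auto intro: power_le_one)
      have sb: "summable (\<lambda>i. \<beta> i * w ^ i)"
        by (rule summable_comparison_test'[OF \<beta>(2), of 0]) (use \<beta>(1) wp in \<open>auto intro: mult_right_le_one_le\<close>)
      have "{..N} = {..<Suc k} \<union> {Suc k..N}" using elim by auto
      then have S: "S N = (\<Sum>i<k. b N i * w ^ i) + b N k * w ^ k + t"
        unfolding S_def t_def by (subst sum.union_disjoint[symmetric, of "{..<Suc k}" "{Suc k..N}", simplified]) auto
      have S': "S' = t' + ((\<Sum>i<k. \<beta> i * w ^ i) + \<beta> k * w ^ k)"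
        unfolding S'_def t'_def using suminf_split_initial_segment[OF sb, of "Suc k"] by simp
      have t: "0 \<le> t" "t \<le> w ^ Suc k"
      proof -
        show "0 \<le> t" unfolding t_def using b wp by (intro sum_nonneg mult_nonneg_nonneg) auto
        have "t \<le> (\<Sum>i\<in>{Suc k..N}. b N i * w ^ Suc k)"
          unfolding t_def using b w by (intro sum_mono mult_left_mono power_decreasing) auto
        also have "\<dots> \<le> (\<Sum>i\<le>N. b N i) * w ^ Suc k"
          unfolding sum_distrib_right[symmetric] using b wp(1)[of "Suc k"] by (intro mult_right_mono sum_mono2) auto
        also have "\<dots> \<le> 1 * w ^ Suc k" using b(2)[of N] wp(1) by (rule mult_right_mono)
        finally show "t \<le> w ^ Suc k" by simp
      qed
      have t': "0 \<le> t'" "t' \<le> w ^ Suc k"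
      proof -
        have s1: "summable (\<lambda>i. \<beta> (i + Suc k) * w ^ (i + Suc k))" using sb by (subst summable_iff_shift)
        have s2: "summable (\<lambda>i. \<beta> (i + Suc k))" using \<beta>(2) by (subst summable_iff_shift)
        show "0 \<le> t'" unfolding t'_def by (intro suminf_nonneg mult_nonneg_nonneg s1 \<beta>(1) wp(1))
        have "t' \<le> (\<Sum>i. \<beta> (i + Suc k) * w ^ Suc k)"
          unfolding t'_def using s1 s2 \<beta>(1) w
          by (intro suminf_le summable_mult2 mult_left_mono power_decreasing) auto
        also have "\<dots> = (\<Sum>i. \<beta> (i + Suc k)) * w ^ Suc k" using s2 by (rule suminf_mult2[symmetric])
        also have "(\<Sum>i. \<beta> (i + Suc k)) \<le> suminf \<beta>"
          using suminf_split_initial_segment[OF \<beta>(2), of "Suc k"] \<beta>(1) by (simp add: sum_nonneg)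
        then have "(\<Sum>i. \<beta> (i + Suc k)) * w ^ Suc k \<le> 1 * w ^ Suc k"
          using \<beta>(3) wp(1)[of "Suc k"] by (intro mult_right_mono) auto
        finally show "t' \<le> w ^ Suc k" by simp
      qed
      have "(b N k - \<beta> k) * w ^ k = ((S N - S') - (\<Sum>i<k. (b N i - \<beta> i) * w ^ i)) - (t - t')"
        by (simp add: S S' left_diff_distrib sum_subtractf)
      then have "\<bar>(b N k - \<beta> k) * w ^ k\<bar> < e / 2 * w ^ k + w ^ Suc k"
        using elim(1) t t' by linarith
      also have "\<dots> \<le> e / 2 * w ^ k + e / 2 * w ^ k"
        using mult_right_mono[OF w(3) wp(1)[of k]] by simp
      also have "\<dots> = e * w ^ k" by simp
      finally have "\<bar>b N k - \<beta> k\<bar> * w ^ k < e * w ^ k" using wp(1)[of k] by (simp add: abs_mult)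
      then show ?case using w by simp
    qed
    then show "\<exists>no. \<forall>N\<ge>no. norm (b N k - \<beta> k) < e" by (simp add: eventually_sequentially)
  qed
qed

definition hits :: "(nat \<Rightarrow> real) \<Rightarrow> nat \<Rightarrow> real \<Rightarrow> real \<Rightarrow> real \<Rightarrow> nat" where
  "hits \<theta> N b c x = card {n \<in> {1..N}. arc_fun b c (\<theta> n - x) = 1}"

definition pois :: "real \<Rightarrow> nat \<Rightarrow> real" where
  "pois h k = exp (- h) * h ^ k / fact k"

lemma hits_measurable [measurable]: "hits \<theta> N b c \<in> borel \<rightarrow>\<^sub>M count_space UNIV"
  unfolding hits_def by measurable

lemma hits_le: "hits \<theta> N b c x \<le> N"
proof -
  have "hits \<theta> N b c x \<le> card {1..N}" unfolding hits_def by (rule card_mono) auto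
  then show ?thesis by simp
qed

lemma arc_fun_01:
  assumes "b \<le> c" "c \<le> b + 1"
  shows "arc_fun b c \<beta> = 0 \<or> arc_fun b c \<beta> = 1"
proof -
  have "0 \<le> \<lfloor>\<beta> - b\<rfloor> - \<lfloor>\<beta> - c\<rfloor>" "\<lfloor>\<beta> - b\<rfloor> - \<lfloor>\<beta> - c\<rfloor> \<le> 1"
    using arc_nonneg[OF assms(1), of \<beta>] arc_le_1[OF assms(2), of \<beta>] unfolding arc_fun_def by linarith+
  then have "\<lfloor>\<beta> - b\<rfloor> - \<lfloor>\<beta> - c\<rfloor> = 0 \<or> \<lfloor>\<beta> - b\<rfloor> - \<lfloor>\<beta> - c\<rfloor> = 1" by linarith
  then show ?thesis unfolding arc_fun_def by (metis of_int_0 of_int_1)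
qed

text \<open>At most one of the arcs contains a given point, so at most one factor differs from 1.\<close>

lemma one_minus_step_fun:
  assumes "\<And>i. i < M \<Longrightarrow> s i \<le> s (Suc i)" "s M \<le> s 0 + 1"
  shows "1 - step_fun M s v \<beta> = (\<Prod>i<M. if arc_fun (s i) (s (Suc i)) \<beta> = 1 then 1 - v i else 1)"
  using assms
proof (induction M)
  case (Suc M)
  have s: "s i \<le> s j" if "i \<le> j" "j \<le> Suc M" for i j
    using that(1) that(2)
  proof (induction j rule: dec_induct)
    case (step n)
    then show ?case using Suc.prems(1)[of n] by linarith
  qed simp
  have IH: "1 - step_fun M s v \<beta> = (\<Prod>i<M. if arc_fun (s i) (s (Suc i)) \<beta> = 1 then 1 - v i else 1)"
  proof (rule Suc.IH)
    show "s M \<le> s 0 + 1" using Suc.prems(2) s[of M "Suc M"] by linarith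
  qed (use Suc.prems(1) in auto)
  have "arc_fun (s M) (s (Suc M)) \<beta> = 0 \<or> arc_fun (s M) (s (Suc M)) \<beta> = 1"
    using Suc.prems s[of 0 M] by (intro arc_fun_01) auto
  then show ?case
  proof
    assume "arc_fun (s M) (s (Suc M)) \<beta> = 0"
    then show ?thesis using IH by (simp add: step_fun_def)
  next
    assume 1: "arc_fun (s M) (s (Suc M)) \<beta> = 1"
    have "arc_fun (s 0) (s (Suc M)) \<beta> \<le> 1" using Suc.prems(2) by (rule arc_le_1)
    moreover have "arc_fun (s 0) (s (Suc M)) \<beta> = arc_fun (s 0) (s M) \<beta> + 1"
      using 1 by (simp add: arc_fun_def)
    ultimately have "(\<Sum>i<M. arc_fun (s i) (s (Suc i)) \<beta>) \<le> 0" by (simp add: sum_arc)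
    moreover have nn: "0 \<le> arc_fun (s i) (s (Suc i)) \<beta>" if "i < M" for i
      using that Suc.prems(1)[of i] by (intro arc_nonneg) auto
    moreover have "0 \<le> (\<Sum>i<M. arc_fun (s i) (s (Suc i)) \<beta>)" by (rule sum_nonneg) (use nn in simp)
    ultimately have s0: "(\<Sum>i<M. arc_fun (s i) (s (Suc i)) \<beta>) = 0" by linarith
    have z: "arc_fun (s i) (s (Suc i)) \<beta> = 0" if "i < M" for i
      using sum_nonneg_0[OF _ _ s0, of i] nn that by simp
    show ?thesis using 1 z by (simp add: step_fun_def)
  qed
qed (simp add: step_fun_def)

lemma void_eq_pgf:
  assumes "\<And>i. i < M \<Longrightarrow> s i \<le> s (Suc i)" "s M \<le> s 0 + 1"
  shows "void \<theta> N (step_fun M s v) = (MEAN x. (\<Prod>i<M. (1 - v i) ^ hits \<theta> N (s i) (s (Suc i)) x))"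
  unfolding void_def
proof (rule Bochner_Integration.integral_cong)
  fix x
  have eq: "1 - step_fun M s v \<beta> = (\<Prod>i<M. if arc_fun (s i) (s (Suc i)) \<beta> = 1 then 1 - v i else 1)" for \<beta>
    using assms by (rule one_minus_step_fun)
  have "(\<Prod>n\<in>{1..N}. 1 - step_fun M s v (\<theta> n - x))
    = (\<Prod>i<M. \<Prod>n\<in>{1..N}. if arc_fun (s i) (s (Suc i)) (\<theta> n - x) = 1 then 1 - v i else 1)"
    unfolding eq by (rule prod.swap)
  also have "\<dots> = (\<Prod>i<M. (1 - v i) ^ hits \<theta> N (s i) (s (Suc i)) x)"
    by (intro prod.cong) (auto simp: hits_def prod.inter_filter[symmetric])
  finally show "(\<Prod>n\<in>{1..N}. 1 - step_fun M s v (\<theta> n - x)) = (\<Prod>i<M. (1 - v i) ^ hits \<theta> N (s i) (s (Suc i)) x)" .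
qed simp

lemma pois_nonneg: "0 \<le> h \<Longrightarrow> 0 \<le> pois h k"
  by (simp add: pois_def)

lemma pois_pgf: "(\<lambda>k. pois h k * w ^ k) sums exp (- h * (1 - w))"
proof -
  have "(\<lambda>k. exp (- h) * ((h * w) ^ k /\<^sub>R fact k)) sums (exp (- h) * exp (h * w))"
    by (intro sums_mult exp_converges)
  then show ?thesis
    by (simp add: pois_def exp_add[symmetric] power_mult_distrib field_simps)
qed

text \<open>The generating function in all variables is known from \<open>void_eq_pgf\<close>.  Its coefficients are
extracted one variable at a time; for the variable in question, the remaining factors play the role
of a fixed weight with values in \<open>[0,1]\<close>.\<close>

theorem joint_poisson:
  assumes void: "\<And>M s v. steps M s v \<Longrightarrow> (\<lambda>N. void \<theta> N (step_fun M (\<lambda>i. s i / real N) v)) \<longlonglongrightarrow> exp (- mass M s v)"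
    and s: "\<And>i. i < M \<Longrightarrow> s i \<le> s (Suc i)"
  shows "(\<lambda>N. measure circ {x. \<forall>i<M. hits \<theta> N (s i / real N) (s (Suc i) / real N) x = k i})
    \<longlonglongrightarrow> (\<Prod>i<M. pois (s (Suc i) - s i) (k i))"
proof -
  define c where "c N i = hits \<theta> N (s i / real N) (s (Suc i) / real N)" for N i
  have [measurable]: "c N i \<in> borel \<rightarrow>\<^sub>M count_space UNIV" for N i unfolding c_def by measurable
  have cN: "c N i x \<le> N" for N i x unfolding c_def by (rule hits_le)
  let ?h = "\<lambda>i. s (Suc i) - s i"
  define I where "I j z N x = (\<Prod>i<j. of_bool (c N i x = k i) :: real) * (\<Prod>i\<in>{j..<M}. z i ^ c N i x)" for j z N x
  have Q: "\<And>z. (\<And>i. 0 \<le> z i \<and> z i \<le> 1) \<Longrightarrow> (\<lambda>N. MEAN x. I j z N x) \<longlonglongrightarrow>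
     (\<Prod>i<j. pois (?h i) (k i)) * (\<Prod>i\<in>{j..<M}. exp (- ?h i * (1 - z i)))" if "j \<le> M" for j
    using that
  proof (induction j)
    case 0
    let ?v = "\<lambda>i. 1 - z i"
    have st: "steps M s ?v" using s 0 by (auto simp: steps_def)
    have "exp (- mass M s ?v) = (\<Prod>i<M. exp (- ?h i * (1 - z i)))"
    proof -
      have "- mass M s ?v = (\<Sum>i<M. - ?h i * (1 - z i))"
        unfolding mass_def sum_negf[symmetric] by (intro sum.cong) (auto simp: algebra_simps)
      then show ?thesis by (simp add: exp_sum)
    qed
    moreover have "\<forall>\<^sub>F N in sequentially. void \<theta> N (step_fun M (\<lambda>i. s i / real N) ?v) = (MEAN x. I 0 z N x)"
      using eventually_gt_at_top[of "nat \<lceil>\<bar>s M - s 0\<bar>\<rceil>"]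
    proof eventually_elim
      case (elim N)
      then have N: "0 < real N" "s M - s 0 \<le> real N" by linarith+
      have "void \<theta> N (step_fun M (\<lambda>i. s i / real N) ?v)
        = (MEAN x. (\<Prod>i<M. (1 - ?v i) ^ hits \<theta> N (s i / real N) (s (Suc i) / real N) x))"
        by (rule void_eq_pgf) (use N s in \<open>auto simp: divide_right_mono field_simps\<close>)
      then show ?case by (simp add: I_def c_def atLeast0LessThan)
    qed
    ultimately show ?case using Lim_transform_eventually[OF void[OF st]] by (simp add: atLeast0LessThan)
  next
    case (Suc j)
    have jM: "j < M" using Suc.prems by simp
    define r where "r N x = (\<Prod>i<j. of_bool (c N i x = k i) :: real) * (\<Prod>i\<in>{Suc j..<M}. z i ^ c N i x)" for N x
    have r01: "0 \<le> r N x" "r N x \<le> 1" for N x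
      unfolding r_def using Suc.prems(1)
      by (auto intro!: mult_nonneg_nonneg prod_nonneg mult_le_one prod_le_1 power_le_one)
    have [measurable]: "r N \<in> borel_measurable borel" for N unfolding r_def by measurable
    define b where "b N \<kappa> = (MEAN x. r N x * of_bool (c N j x = \<kappa>))" for N \<kappa>
    define C where "C = (\<Prod>i<j. pois (?h i) (k i)) * (\<Prod>i\<in>{Suc j..<M}. exp (- ?h i * (1 - z i)))"
    have ib: "integrable circ (\<lambda>x. r N x * of_bool (c N j x = \<kappa>) * w)" for N \<kappa> and w :: real
      by (rule integrable_circ[where B="\<bar>w\<bar>"]) (use r01 in \<open>auto simp: abs_mult intro!: mult_left_le_one_le\<close>)
    have sum_b: "(\<Sum>\<kappa>\<le>N. b N \<kappa> * w ^ \<kappa>) = (MEAN x. r N x * w ^ c N j x)" for N w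
    proof -
      have "(\<Sum>\<kappa>\<le>N. b N \<kappa> * w ^ \<kappa>) = (MEAN x. (\<Sum>\<kappa>\<le>N. r N x * of_bool (c N j x = \<kappa>) * w ^ \<kappa>))"
        unfolding b_def using ib by (subst Bochner_Integration.integral_sum) auto
      also have "(\<lambda>x. \<Sum>\<kappa>\<le>N. r N x * of_bool (c N j x = \<kappa>) * w ^ \<kappa>) = (\<lambda>x. r N x * w ^ c N j x)"
      proof
        fix x
        have "(\<Sum>\<kappa>\<le>N. r N x * of_bool (c N j x = \<kappa>) * w ^ \<kappa>) = (\<Sum>\<kappa>\<le>N. if c N j x = \<kappa> then r N x * w ^ \<kappa> else 0)"
          by (intro sum.cong) auto
        then show "(\<Sum>\<kappa>\<le>N. r N x * of_bool (c N j x = \<kappa>) * w ^ \<kappa>) = r N x * w ^ c N j x"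
          using cN[of N j x] by simp
      qed
      finally show ?thesis .
    qed
    have h: "0 \<le> ?h i" if "i < M" for i using s[OF that] by simp
    have C0: "0 \<le> C" unfolding C_def using h jM
      by (intro mult_nonneg_nonneg prod_nonneg ballI pois_nonneg) auto
    have lim: "(\<lambda>N. \<Sum>\<kappa>\<le>N. b N \<kappa> * w ^ \<kappa>) \<longlonglongrightarrow> (\<Sum>\<kappa>. C * pois (?h j) \<kappa> * w ^ \<kappa>)" if w: "0 < w" "w \<le> 1" for w
    proof -
      let ?z = "z(j := w)"
      have "(\<lambda>N. MEAN x. I j ?z N x) \<longlonglongrightarrow> (\<Prod>i<j. pois (?h i) (k i)) * (\<Prod>i\<in>{j..<M}. exp (- ?h i * (1 - ?z i)))"
        using Suc.prems w by (intro Suc.IH) auto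
      also have "(\<lambda>N. MEAN x. I j ?z N x) = (\<lambda>N. \<Sum>\<kappa>\<le>N. b N \<kappa> * w ^ \<kappa>)"
        unfolding sum_b I_def r_def prod.atLeast_Suc_lessThan[OF jM]
        by (simp add: mult_ac)
      also have "(\<Prod>i<j. pois (?h i) (k i)) * (\<Prod>i\<in>{j..<M}. exp (- ?h i * (1 - ?z i))) = C * exp (- ?h j * (1 - w))"
        unfolding C_def prod.atLeast_Suc_lessThan[OF jM] by simp
      also have "\<dots> = (\<Sum>\<kappa>. C * pois (?h j) \<kappa> * w ^ \<kappa>)"
        using sums_unique[OF sums_mult[OF pois_pgf[of "?h j" w], of C]] by (simp add: mult.assoc)
      finally show ?thesis .
    qed
    have b1: "(\<Sum>\<kappa>\<le>N. b N \<kappa>) \<le> 1" for N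
      using sum_b[of N 1] integral_circ_unit[of "r N"] r01 by simp
    have sums: "(\<lambda>\<kappa>. C * pois (?h j) \<kappa>) sums C" using sums_mult[OF pois_pgf[of "?h j" 1], of C] by simp
    have "C \<le> 1"
    proof (rule LIMSEQ_le_const2)
      show "(\<lambda>N. \<Sum>\<kappa>\<le>N. b N \<kappa>) \<longlonglongrightarrow> C" using lim[of 1] sums_unique[OF sums] by simp
    qed (use b1 in auto)
    have "(\<lambda>N. b N (k j)) \<longlonglongrightarrow> C * pois (?h j) (k j)"
    proof (rule coefficient_limits)
      show "0 \<le> b N i" for N i unfolding b_def using r01 by (intro Bochner_Integration.integral_nonneg) auto
      show "0 \<le> C * pois (?h j) i" for i using C0 h[OF jM] by (intro mult_nonneg_nonneg pois_nonneg)
      show "summable (\<lambda>\<kappa>. C * pois (?h j) \<kappa>)" using sums by (rule sums_summable)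
      show "suminf (\<lambda>\<kappa>. C * pois (?h j) \<kappa>) \<le> 1" using sums_unique[OF sums] \<open>C \<le> 1\<close> by simp
    qed (use lim b1 in auto)
    also have "(\<lambda>N. b N (k j)) = (\<lambda>N. MEAN x. I (Suc j) z N x)"
      unfolding b_def I_def r_def by (simp add: mult_ac)
    also have "C * pois (?h j) (k j) = (\<Prod>i<Suc j. pois (?h i) (k i)) * (\<Prod>i\<in>{Suc j..<M}. exp (- ?h i * (1 - z i)))"
      by (simp add: C_def)
    finally show ?case .
  qed
  have "(\<lambda>N. MEAN x. I M (\<lambda>_. 1) N x) \<longlonglongrightarrow> (\<Prod>i<M. pois (?h i) (k i))"
    using Q[of M "\<lambda>_. 1"] by simp
  moreover have "(MEAN x. I M (\<lambda>_. 1) N x) = measure circ {x. \<forall>i<M. c N i x = k i}" for N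
  proof -
    have "I M (\<lambda>_. 1) N x = indicator {x. \<forall>i<M. c N i x = k i} x" for x
      by (auto simp: I_def indicator_def prod_zero_iff)
    then show ?thesis by simp
  qed
  ultimately show ?thesis by (simp add: c_def)
qed

section \<open>Asymptotic lower bounds\<close>

text \<open>This says \<open>c \<le> liminf f\<close>.\<close>

definition lim_ge :: "(nat \<Rightarrow> real) \<Rightarrow> real \<Rightarrow> bool" where
  "lim_ge f c \<longleftrightarrow> (\<forall>e>0. \<forall>\<^sub>F N in sequentially. c - e < f N)"

lemma lim_ge_tendsto: "f \<longlonglongrightarrow> c \<Longrightarrow> lim_ge f c"
  unfolding lim_ge_def by (auto intro: order_tendstoD(1))

lemma lim_ge_mono: "lim_ge f c \<Longrightarrow> (\<forall>\<^sub>F N in sequentially. f N \<le> g N) \<Longrightarrow> lim_ge g c"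
  unfolding lim_ge_def
proof (intro allI impI)
  fix e :: real assume *: "\<forall>e>0. \<forall>\<^sub>F N in sequentially. c - e < f N" "\<forall>\<^sub>F N in sequentially. f N \<le> g N" "e > 0"
  from *(1)[rule_format, OF *(3)] *(2) show "\<forall>\<^sub>F N in sequentially. c - e < g N"
    by eventually_elim simp
qed

lemma lim_ge_le: "lim_ge f c \<Longrightarrow> d \<le> c \<Longrightarrow> lim_ge f d"
  unfolding lim_ge_def by (auto elim!: eventually_mono)

lemma lim_ge_add: assumes "lim_ge f c" "lim_ge g d" shows "lim_ge (\<lambda>N. f N + g N) (c + d)"
  unfolding lim_ge_def
proof (intro allI impI)
  fix e :: real assume "e > 0"
  then have "\<forall>\<^sub>F N in sequentially. c - e / 2 < f N" "\<forall>\<^sub>F N in sequentially. d - e / 2 < g N"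
    using assms by (auto simp: lim_ge_def)
  then show "\<forall>\<^sub>F N in sequentially. c + d - e < f N + g N" by eventually_elim simp
qed

lemma lim_ge_sum: "(\<And>i. i \<in> I \<Longrightarrow> lim_ge (f i) (c i)) \<Longrightarrow> lim_ge (\<lambda>N. \<Sum>i\<in>I. f i N) (\<Sum>i\<in>I. c i)"
  by (induction I rule: infinite_finite_induct) (auto intro: lim_ge_add lim_ge_tendsto)

lemma lim_ge_limit:
  assumes "\<forall>\<^sub>F m in sequentially. lim_ge f (c m)" "c \<longlonglongrightarrow> c0"
  shows "lim_ge f c0"
  unfolding lim_ge_def
proof (intro allI impI)
  fix e :: real assume e: "e > 0"
  have "\<forall>\<^sub>F m in sequentially. c0 - e / 2 < c m" using assms(2) e by (intro order_tendstoD(1)) auto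
  then have "\<forall>\<^sub>F m in sequentially. lim_ge f (c m) \<and> c0 - e / 2 < c m" using assms(1) by eventually_elim simp
  then obtain m where m: "lim_ge f (c m)" "c0 - e / 2 < c m" by (auto simp: eventually_sequentially)
  have "\<forall>\<^sub>F N in sequentially. c m - e / 2 < f N" using m(1) e by (simp add: lim_ge_def)
  then show "\<forall>\<^sub>F N in sequentially. c0 - e < f N" by eventually_elim (use m(2) in linarith)
qed

text \<open>Two complementary frequencies with lower bounds adding up to 1 leave no room: both bounds are
limits.\<close>

lemma lim_ge_squeeze:
  assumes f: "lim_ge f c" and g: "lim_ge g (1 - c)" and fg: "\<forall>\<^sub>F N in sequentially. f N + g N \<le> 1"
  shows "f \<longlonglongrightarrow> c"
proof (rule order_tendstoI)
  fix y assume "y < c"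
  then have "\<forall>\<^sub>F N in sequentially. c - (c - y) < f N" using f unfolding lim_ge_def by (meson diff_gt_0_iff_gt)
  then show "\<forall>\<^sub>F N in sequentially. y < f N" by simp
next
  fix y assume "c < y"
  then have "\<forall>\<^sub>F N in sequentially. (1 - c) - (y - c) < g N" using g unfolding lim_ge_def by (meson diff_gt_0_iff_gt)
  with fg show "\<forall>\<^sub>F N in sequentially. f N < y" by eventually_elim simp
qed

section \<open>Ordered points and uniformly placed windows\<close>

definition below :: "(nat \<Rightarrow> real) \<Rightarrow> nat \<Rightarrow> real \<Rightarrow> nat" where
  "below \<theta> N y = card {n \<in> {1..N}. \<theta> n < y}"

lemma below_le: "below \<theta> N y \<le> N"
proof -
  have "below \<theta> N y \<le> card {1..N}" unfolding below_def by (rule card_mono) auto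
  then show ?thesis by simp
qed

lemma below_mono: "y \<le> z \<Longrightarrow> below \<theta> N y \<le> below \<theta> N z"
  unfolding below_def by (rule card_mono) auto

lemma sorted_nth_less_iff:
  fixes xs :: "real list"
  assumes "sorted xs" "i < length xs"
  shows "xs ! i < y \<longleftrightarrow> i < card {j. j < length xs \<and> xs ! j < y}"
proof
  assume "xs ! i < y"
  then have "{..i} \<subseteq> {j. j < length xs \<and> xs ! j < y}"
    using assms by (auto dest: sorted_nth_mono intro: le_less_trans)
  from card_mono[OF _ this] show "i < card {j. j < length xs \<and> xs ! j < y}" by simp
next
  assume *: "i < card {j. j < length xs \<and> xs ! j < y}"
  show "xs ! i < y"
  proof (rule ccontr)
    assume "\<not> xs ! i < y"
    then have "{j. j < length xs \<and> xs ! j < y} \<subseteq> {..<i}"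
      using assms by (auto simp: not_less) (meson le_less_trans not_le sorted_nth_mono)
    from card_mono[OF _ this] * show False by simp
  qed
qed

lemma ordered_less_iff:
  assumes n: "1 \<le> n" "n \<le> N"
  shows "ordered \<theta> N n < y \<longleftrightarrow> n \<le> below \<theta> N y"
proof -
  let ?xs = "sort (map \<theta> [1..<N + 1])"
  have "card {j. j < length ?xs \<and> ?xs ! j < y} = length (filter (\<lambda>t. t < y) ?xs)"
    by (rule length_filter_conv_card[symmetric])
  also have "\<dots> = length (filter (\<lambda>t. t < y) (map \<theta> [1..<N + 1]))"
    by (simp only: filter_sort length_sort)
  also have "\<dots> = length (filter (\<lambda>n. \<theta> n < y) [1..<N + 1])" by (simp add: filter_map o_def)
  also have "\<dots> = below \<theta> N y"
    unfolding below_def by (subst distinct_length_filter) (auto intro!: arg_cong[of _ _ card])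
  finally have "card {j. j < length ?xs \<and> ?xs ! j < y} = below \<theta> N y" .
  with sorted_nth_less_iff[of ?xs "n - 1" y] n show ?thesis by (auto simp: ordered_def)
qed

lemma floor_unit_diff: "0 \<le> t \<Longrightarrow> t < 1 \<Longrightarrow> 0 \<le> y \<Longrightarrow> y \<le> 1 \<Longrightarrow> \<lfloor>t - y\<rfloor> = (if t < y then -1 else (0::int))" for t y :: real
  by (auto simp: floor_eq_iff)

text \<open>For arcs inside \<open>[0,1]\<close> the arc counts are increments of the counting function, so that they can
be compared with the ordered points; near the right end of the interval an arc would wrap around.\<close>

lemma hits_eq_below:
  assumes \<theta>: "\<And>n. 0 \<le> \<theta> n" "\<And>n. \<theta> n < 1" and x: "0 \<le> x + b" "b \<le> c" "x + c \<le> 1"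
  shows "below \<theta> N (x + c) = below \<theta> N (x + b) + hits \<theta> N b c x"
proof -
  have "arc_fun b c (\<theta> n - x) = 1 \<longleftrightarrow> \<theta> n < x + c \<and> \<not> \<theta> n < x + b" for n
    using floor_unit_diff[OF \<theta>(1,2), of "x + b" n] floor_unit_diff[OF \<theta>(1,2), of "x + c" n] x
    by (auto simp: arc_fun_def diff_diff_eq)
  then have "hits \<theta> N b c x = card ({n \<in> {1..N}. \<theta> n < x + c} - {n \<in> {1..N}. \<theta> n < x + b})"
    unfolding hits_def by (intro arg_cong[of _ _ card]) auto
  also have "\<dots> = below \<theta> N (x + c) - below \<theta> N (x + b)"
    unfolding below_def using x by (intro card_Diff_subset) auto
  finally show ?thesis using below_mono[of "x + b" "x + c" \<theta> N] x by simp
qed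

lemma measure_circ_interval_le: "a \<le> b \<Longrightarrow> measure circ {a<..b} \<le> b - a"
proof -
  assume "a \<le> b"
  have "measure lborel ({0..<1} \<inter> {a<..b}) \<le> measure lborel {a<..b}"
    by (rule measure_mono_fmeasurable) (use \<open>a \<le> b\<close> in \<open>auto simp: fmeasurable_def\<close>)
  with \<open>a \<le> b\<close> show ?thesis by (simp add: measure_circ)
qed

text \<open>Discarding the positions whose window would reach beyond 1 costs at most the length of the window.\<close>

lemma measure_circ_trim:
  assumes [measurable]: "S \<in> sets borel" and \<delta>: "0 \<le> \<delta>"
  shows "measure circ S - \<delta> \<le> measure circ (S \<inter> {0..1 - \<delta>})"
proof -
  have "measure circ S \<le> measure circ ((S \<inter> {0..1 - \<delta>}) \<union> {1 - \<delta><..1})"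
  proof (rule circ.finite_measure_mono_AE)
    show "AE x in circ. x \<in> S \<longrightarrow> x \<in> (S \<inter> {0..1 - \<delta>}) \<union> {1 - \<delta><..1}"
      using AE_circ_unit by eventually_elim auto
  qed simp
  also have "\<dots> \<le> measure circ (S \<inter> {0..1 - \<delta>}) + measure circ {1 - \<delta><..1}"
    by (rule measure_Un_le) auto
  also have "measure circ {1 - \<delta><..1} \<le> \<delta>" using measure_circ_interval_le[of "1 - \<delta>" 1] \<delta> by simp
  finally show ?thesis by simp
qed

text \<open>A point \<open>p n\<close> can serve only the positions in an interval of length \<open>h\<close>.\<close>

lemma palm_bound:
  assumes [measurable]: "E \<in> sets borel" and D: "finite D" and h: "0 \<le> h"
    and E: "\<And>x. x \<in> E \<Longrightarrow> \<exists>n\<in>D. x \<le> p n \<and> p n < x + h"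
  shows "measure circ E \<le> real (card D) * h"
proof -
  have "E \<subseteq> (\<Union>n\<in>D. {p n - h<..p n})"
  proof
    fix x assume "x \<in> E"
    from E[OF this] obtain n where "n \<in> D" "x \<le> p n" "p n < x + h" by blast
    then show "x \<in> (\<Union>n\<in>D. {p n - h<..p n})" by (intro UN_I[of n]) auto
  qed
  then have "measure circ E \<le> measure circ (\<Union>n\<in>D. {p n - h<..p n})"
    by (rule circ.finite_measure_mono) (use D in auto)
  also have "\<dots> \<le> (\<Sum>n\<in>D. measure circ {p n - h<..p n})"
    by (rule measure_UNION_le) (use D in auto)
  also have "\<dots> \<le> (\<Sum>n\<in>D. h)"
  proof (rule sum_mono)
    show "measure circ {p n - h<..p n} \<le> h" for n
      using measure_circ_interval_le[of "p n - h" "p n"] h by simp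
  qed
  finally show ?thesis by simp
qed

section \<open>Tails of the Erlang distributions\<close>

text \<open>The probability that a Poisson variable of mean \<open>s\<close> is less than \<open>j\<close>, equivalently that the sum of
\<open>j\<close> independent standard exponential variables exceeds \<open>s\<close>.\<close>

definition tail :: "nat \<Rightarrow> real \<Rightarrow> real" where
  "tail j s = (\<Sum>k<j. pois s k)"

text \<open>Differentiating the Poisson weights gives a telescoping sum.\<close>

lemma tail_deriv: "((\<lambda>s. tail (Suc j) s) has_real_derivative - (s ^ j / fact j * exp (- s))) (at s)"
proof (induction j)
  case 0
  show ?case by (auto simp: tail_def pois_def intro!: derivative_eq_intros)
next
  case (Suc j)
  have "((\<lambda>s. pois s (Suc j)) has_real_derivative s ^ j / fact j * exp (- s) - s ^ Suc j / fact (Suc j) * exp (- s)) (at s)"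
  proof -
    have "((\<lambda>s. s ^ Suc j / fact (Suc j)) has_real_derivative s ^ j / fact j) (at s)"
      by (rule DERIV_cong[OF DERIV_cdivide[OF DERIV_pow[of "Suc j"]]]) (simp del: of_nat_Suc add: fact_Suc)
    moreover have "((\<lambda>s. exp (- s)) has_real_derivative - exp (- s)) (at s)"
      by (auto intro!: derivative_eq_intros)
    ultimately have "((\<lambda>s. s ^ Suc j / fact (Suc j) * exp (- s)) has_real_derivative
        s ^ j / fact j * exp (- s) + - exp (- s) * (s ^ Suc j / fact (Suc j))) (at s)"
      by (rule DERIV_mult)
    moreover have "(\<lambda>s. pois s (Suc j)) = (\<lambda>s. s ^ Suc j / fact (Suc j) * exp (- s))"
      by (simp only: pois_def mult.commute[of "exp _"] times_divide_eq_left)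
    moreover have "s ^ j / fact j * exp (- s) + - exp (- s) * (s ^ Suc j / fact (Suc j))
        = s ^ j / fact j * exp (- s) - s ^ Suc j / fact (Suc j) * exp (- s)" by simp
    ultimately show ?thesis by (simp only:)
  qed
  from DERIV_add[OF Suc this] show ?case by (simp add: tail_def)
qed

lemma integral_erlang:
  assumes "A \<le> B" "j \<ge> 1"
  shows "integral {A..B} (\<lambda>s. s ^ (j - 1) / fact (j - 1) * exp (- s)) = tail j A - tail j B"
proof -
  obtain i where j: "j = Suc i" using assms(2) by (cases j) auto
  have "((\<lambda>s. s ^ i / fact i * exp (- s)) has_integral (- tail (Suc i) B) - (- tail (Suc i) A)) {A..B}"
  proof (rule fundamental_theorem_of_calculus[OF assms(1)])
    fix s
    have "((\<lambda>s. - tail (Suc i) s) has_real_derivative s ^ i / fact i * exp (- s)) (at s)"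
      using DERIV_minus[OF tail_deriv[of i s]] by simp
    then show "((\<lambda>s. - tail (Suc i) s) has_vector_derivative s ^ i / fact i * exp (- s)) (at s within {A..B})"
      by (simp add: has_real_derivative_iff_has_vector_derivative has_vector_derivative_at_within)
  qed
  from integral_unique[OF this] show ?thesis by (simp add: j)
qed

lemma tail_0: "j \<ge> 1 \<Longrightarrow> tail j 0 = 1"
  by (cases j) (simp_all add: tail_def pois_def lessThan_Suc_eq_insert_0 sum.insert sum.reindex)

lemma tail_1: "tail 1 s = exp (- s)"
  by (simp add: tail_def pois_def)

lemma isCont_pois: "isCont (\<lambda>h. pois h k) x"
  unfolding pois_def by (intro continuous_intros) auto

lemma isCont_tail: "isCont (tail j) x"
  unfolding tail_def[abs_def] by (intro continuous_intros isCont_pois)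

lemma tail_tendsto_0: "(\<lambda>m. tail j (real m)) \<longlonglongrightarrow> 0"
proof -
  have "(\<lambda>m. pois (real m) k) \<longlonglongrightarrow> 0" for k
  proof -
    have "(\<lambda>m. (real m ^ k / exp (real m)) / fact k) \<longlonglongrightarrow> 0 / fact k"
      by (intro tendsto_divide filterlim_compose[OF tendsto_power_div_exp_0 filterlim_real_sequentially] tendsto_const) auto
    then show ?thesis by (simp add: pois_def exp_minus field_simps)
  qed
  then have "(\<lambda>m. \<Sum>k<j. pois (real m) k) \<longlonglongrightarrow> (\<Sum>k<j. 0)" by (intro tendsto_sum)
  then show ?thesis by (simp add: tail_def)
qed

section \<open>Spacings of a sequence with Poisson window counts\<close>

text \<open>The deterministic input for all spacing laws: the counts in adjacent intervals of length of order
\<open>1/N\<close>, seen from a uniform position, are asymptotically independent Poisson variables.\<close>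

locale poisson_sequence =
  fixes \<theta> :: "nat \<Rightarrow> real"
  assumes unit: "0 \<le> \<theta> n" "\<theta> n < 1"
    and joint: "\<And>M s k. (\<And>i. i < M \<Longrightarrow> s i \<le> s (Suc i)) \<Longrightarrow>
      (\<lambda>N. measure circ {x. \<forall>i<M. hits \<theta> N (s i / real N) (s (Suc i) / real N) x = k i})
        \<longlonglongrightarrow> (\<Prod>i<M. pois (s (Suc i) - s i) (k i))"
begin

lemma hits_below: "0 \<le> x + b \<Longrightarrow> b \<le> c \<Longrightarrow> x + c \<le> 1 \<Longrightarrow> below \<theta> N (x + c) = below \<theta> N (x + b) + hits \<theta> N b c x"
  using hits_eq_below[OF unit] .

text \<open>Closed and half-open arcs differ only when the point sits on the right endpoint.\<close>

lemma on_arc_iff_arc_fun: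
  assumes L: "0 < L" "L \<le> 1" and x: "\<And>m::int. x \<noteq> t + of_int m - L"
  shows "on_arc x L t \<longleftrightarrow> arc_fun 0 L (t - x) = 1"
proof
  assume "on_arc x L t"
  then obtain m :: int where m: "x \<le> t + of_int m" "t + of_int m \<le> x + L" by (auto simp: on_arc_def)
  with x[of m] have m': "t + of_int m < x + L" by linarith
  have "\<lfloor>t - x\<rfloor> = - m" "\<lfloor>t - x - L\<rfloor> = - m - 1"
    unfolding floor_eq_iff using m m' L by auto
  then show "arc_fun 0 L (t - x) = 1" by (simp add: arc_fun_def)
next
  assume "arc_fun 0 L (t - x) = 1"
  then have "\<lfloor>t - x\<rfloor> - \<lfloor>t - x - L\<rfloor> = 1" unfolding arc_fun_def by linarith
  then have "t - x - L < of_int \<lfloor>t - x\<rfloor>" by linarith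
  then have "t + of_int (- \<lfloor>t - x\<rfloor>) \<in> {x..x + L}" by simp linarith
  then show "on_arc x L t" unfolding on_arc_def by blast
qed

lemma arc_prob_eq:
  assumes L: "0 < L" "L \<le> 1"
  shows "arc_prob \<theta> N L k = measure circ {x. hits \<theta> N 0 L x = k}"
proof -
  have [measurable]: "(\<lambda>x. arc_count \<theta> N x L) \<in> borel \<rightarrow>\<^sub>M count_space UNIV"
    unfolding arc_count_def on_arc_def atLeastAtMost_iff by measurable
  let ?C = "\<Union>n. range (\<lambda>m::int. \<theta> n + of_int m - L)"
  have "countable ?C" by auto
  then have "?C \<in> null_sets lborel" by (rule countable_imp_null_set_lborel)
  then have "AE x in lborel. x \<notin> ?C" by (rule AE_not_in)
  then have "AE x in circ. x \<notin> ?C" unfolding circ_def by (intro AE_uniform_measureI) auto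
  then have "AE x in circ. x \<in> {x. arc_count \<theta> N x L = k} \<longleftrightarrow> x \<in> {x. hits \<theta> N 0 L x = k}"
  proof eventually_elim
    case (elim x)
    then have "x \<noteq> \<theta> n + of_int m - L" for n and m :: int by auto
    from on_arc_iff_arc_fun[OF L this]
    show ?case by (simp add: arc_count_def hits_def)
  qed
  then have "measure circ {x. arc_count \<theta> N x L = k} = measure circ {x. hits \<theta> N 0 L x = k}"
    by (rule measure_eq_AE) measurable
  then show ?thesis by (simp add: arc_prob_def circ_def)
qed

theorem arc_prob_limit:
  assumes l: "0 < l"
  shows "(\<lambda>N. arc_prob \<theta> N (l / real N) k) \<longlonglongrightarrow> exp (- l) * l ^ k / fact k"
proof -
  have "(\<lambda>N. measure circ {x. \<forall>i<1. hits \<theta> N ((if i = 0 then 0 else l) / real N) ((if Suc i = 0 then 0 else l) / real N) x = k})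
     \<longlonglongrightarrow> (\<Prod>i<(1::nat). pois ((if Suc i = 0 then 0 else l) - (if i = 0 then 0 else l)) k)"
    by (rule joint) (use l in auto)
  then have "(\<lambda>N. measure circ {x. hits \<theta> N 0 (l / real N) x = k}) \<longlonglongrightarrow> pois l k" by simp
  moreover have "\<forall>\<^sub>F N in sequentially. measure circ {x. hits \<theta> N 0 (l / real N) x = k} = arc_prob \<theta> N (l / real N) k"
    using eventually_gt_at_top[of "nat \<lceil>l\<rceil>"]
  proof eventually_elim
    case (elim N)
    then have "0 < l / real N" "l / real N \<le> 1" using l by (auto simp: field_simps) linarith+
    then show ?case by (simp add: arc_prob_eq)
  qed
  ultimately show ?thesis using Lim_transform_eventually by (fastforce simp: pois_def)
qed

definition freq :: "(nat \<Rightarrow> nat \<Rightarrow> bool) \<Rightarrow> nat \<Rightarrow> nat \<Rightarrow> real" where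
  "freq P r N = real (card {n \<in> {1..N - r}. P N n}) / real N"

lemma freq_nonneg: "0 \<le> freq P r N" by (simp add: freq_def)

lemma freq_compl: "freq P r N + freq (\<lambda>N n. \<not> P N n) r N \<le> 1"
proof -
  have "card {n \<in> {1..N - r}. P N n} + card {n \<in> {1..N - r}. \<not> P N n} = card {1..N - r}"
    by (subst card_Un_disjoint[symmetric], simp, simp, blast, rule arg_cong[of _ _ card], blast)
  also have "\<dots> \<le> N" by simp
  finally have "real (card {n \<in> {1..N - r}. P N n}) + real (card {n \<in> {1..N - r}. \<not> P N n}) \<le> real N"
    by linarith
  then show ?thesis
    unfolding freq_def add_divide_distrib[symmetric] by (cases "N = 0") (auto simp: divide_le_eq_1)
qed

text \<open>Lower bounds on the measure of certifying positions become lower bounds on frequencies of points.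
The factor \<open>1/h\<close> is the price of locating a point in a window of length \<open>h/N\<close>.\<close>

lemma freq_lower:
  assumes h: "0 < h" and L: "0 \<le> L" and [measurable]: "\<And>N. S N \<in> sets borel" and lim: "lim_ge (\<lambda>N. measure circ (S N \<inter> {0..1 - L / real N})) c"
    and S: "\<And>N x. N > 0 \<Longrightarrow> x \<in> S N \<Longrightarrow> 0 \<le> x \<Longrightarrow> x \<le> 1 - L / real N \<Longrightarrow>
       \<exists>n\<in>{1..N - r}. P N n \<and> x \<le> ordered \<theta> N n \<and> ordered \<theta> N n < x + h / real N"
  shows "lim_ge (freq P r) (c / h)"
proof -
  have "\<forall>\<^sub>F N in sequentially. measure circ (S N \<inter> {0..1 - L / real N}) \<le> h * freq P r N"
    using eventually_gt_at_top[of 0]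
  proof eventually_elim
    case (elim N)
    have "measure circ (S N \<inter> {0..1 - L / real N}) \<le> real (card {n \<in> {1..N - r}. P N n}) * (h / real N)"
    proof (rule palm_bound[where p = "ordered \<theta> N"])
      fix x assume "x \<in> S N \<inter> {0..1 - L / real N}"
      then have "\<exists>n\<in>{1..N - r}. P N n \<and> x \<le> ordered \<theta> N n \<and> ordered \<theta> N n < x + h / real N"
        by (intro S[OF elim]) auto
      then show "\<exists>n\<in>{n \<in> {1..N - r}. P N n}. x \<le> ordered \<theta> N n \<and> ordered \<theta> N n < x + h / real N" by blast
    qed (use h in auto)
    then show ?case by (simp add: freq_def mult.commute)
  qed
  from lim_ge_mono[OF lim this] have *: "lim_ge (\<lambda>N. h * freq P r N) c" .
  show ?thesis unfolding lim_ge_def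
  proof (intro allI impI)
    fix e :: real assume "e > 0"
    then have "h * e > 0" using h by simp
    with * have "\<forall>\<^sub>F N in sequentially. c - h * e < h * freq P r N" unfolding lim_ge_def by blast
    then show "\<forall>\<^sub>F N in sequentially. c / h - e < freq P r N"
      by eventually_elim (use h in \<open>simp add: field_simps\<close>)
  qed
qed

lemma two_cell_limit:
  assumes "0 \<le> h" "h \<le> t"
  shows "(\<lambda>N. measure circ {x. hits \<theta> N 0 (h / real N) x = 1 \<and> hits \<theta> N (h / real N) (t / real N) x < j})
     \<longlonglongrightarrow> pois h 1 * tail j (t - h)"
proof -
  let ?s = "\<lambda>i::nat. if i = 0 then 0 else if i = 1 then h else t"
  have lim: "(\<lambda>N. measure circ {x. hits \<theta> N 0 (h / real N) x = 1 \<and> hits \<theta> N (h / real N) (t / real N) x = k})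
     \<longlonglongrightarrow> pois h 1 * pois (t - h) k" for k
  proof -
    have "(\<lambda>N. measure circ {x. \<forall>i<2. hits \<theta> N (?s i / real N) (?s (Suc i) / real N) x = (if i = 0 then 1 else k)})
       \<longlonglongrightarrow> (\<Prod>i<(2::nat). pois (?s (Suc i) - ?s i) (if i = 0 then 1 else k))"
      by (rule joint) (use assms in \<open>auto simp: less_2_cases_iff\<close>)
    then show ?thesis by (simp add: numeral_2_eq_2 All_less_Suc2 lessThan_Suc mult.commute)
  qed
  have "measure circ {x. hits \<theta> N 0 (h / real N) x = 1 \<and> hits \<theta> N (h / real N) (t / real N) x < j}
    = (\<Sum>k<j. measure circ {x. hits \<theta> N 0 (h / real N) x = 1 \<and> hits \<theta> N (h / real N) (t / real N) x = k})" for N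
  proof -
    have "{x. hits \<theta> N 0 (h / real N) x = 1 \<and> hits \<theta> N (h / real N) (t / real N) x < j}
      = (\<Union>k\<in>{..<j}. {x. hits \<theta> N 0 (h / real N) x = 1 \<and> hits \<theta> N (h / real N) (t / real N) x = k})" by auto
    then show ?thesis
      by (simp only:, subst circ.finite_measure_finite_Union) (auto simp: disjoint_family_on_def)
  qed
  then show ?thesis using tendsto_sum[of "{..<j}", OF lim] by (simp add: tail_def sum_distrib_left)
qed

definition in_gap :: "nat \<Rightarrow> real \<Rightarrow> real \<Rightarrow> nat \<Rightarrow> nat \<Rightarrow> bool" where
  "in_gap j A B N n \<longleftrightarrow> A < jth_spacing \<theta> N j n \<and> jth_spacing \<theta> N j n < B"

text \<open>Suppose that \<open>[0,h)\<close> contains exactly one point, \<open>[h, A + h)\<close> fewer than \<open>j\<close> and \<open>[h, B)\<close> at least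
\<open>j\<close>, in units of \<open>1/N\<close> from the position \<open>x\<close>.  Then the \<open>j\<close>-th successor of the first point lies in
\<open>[A + h, B)\<close>, hence at distance strictly between \<open>A\<close> and \<open>B\<close>.  Two events on two adjacent intervals
suffice to express this, and \<open>h\<close> tends to 0 afterwards.\<close>

lemma jth_spacing_lower:
  assumes j: "j \<ge> 1" and AB: "0 \<le> A" "A \<le> B"
  shows "lim_ge (freq (in_gap j A B) j) (tail j A - tail j B)"
proof (cases "A = B")
  case True
  then show ?thesis by (auto simp: lim_ge_def intro!: always_eventually less_le_trans[OF _ freq_nonneg])
next
  case False
  then have AB: "0 \<le> A" "A < B" using AB by auto
  let ?f = "freq (in_gap j A B) j"
  have low: "lim_ge ?f (pois h 1 * (tail j A - tail j (B - h)) / h)" if h: "0 < h" "A + h \<le> B" for h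
  proof -
    \<comment> \<open>The \<open>j\<close>-th successor of the only point in \<open>[0, h)\<close> lies beyond \<open>A + h\<close>, respectively beyond \<open>B\<close>.\<close>
    define S1 where "S1 N = {x. hits \<theta> N 0 (h / real N) x = 1 \<and> hits \<theta> N (h / real N) ((A + h) / real N) x < j}" for N
    define S2 where "S2 N = {x. hits \<theta> N 0 (h / real N) x = 1 \<and> hits \<theta> N (h / real N) (B / real N) x < j}" for N
    have [measurable]: "S1 N \<in> sets borel" "S2 N \<in> sets borel" for N unfolding S1_def S2_def by measurable
    show ?thesis
    proof (rule freq_lower[where S = "\<lambda>N. S1 N - S2 N" and L = B])
      have "(\<lambda>N. measure circ (S1 N) - measure circ (S2 N) - B / real N) \<longlonglongrightarrow>
         pois h 1 * tail j (A + h - h) - pois h 1 * tail j (B - h) - 0"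
        unfolding S1_def S2_def using h AB by (intro tendsto_diff two_cell_limit div_tendsto_0) auto
      then have "lim_ge (\<lambda>N. measure circ (S1 N) - measure circ (S2 N) - B / real N) (pois h 1 * (tail j A - tail j (B - h)))"
        by (intro lim_ge_tendsto) (simp add: right_diff_distrib)
      moreover have "measure circ (S1 N) - measure circ (S2 N) - B / real N \<le> measure circ ((S1 N - S2 N) \<inter> {0..1 - B / real N})" for N
      proof -
        have "measure circ (S1 N) \<le> measure circ ((S1 N - S2 N) \<union> S2 N)" by (rule circ.finite_measure_mono) auto
        also have "\<dots> \<le> measure circ (S1 N - S2 N) + measure circ (S2 N)" by (rule measure_Un_le) auto
        finally have "measure circ (S1 N) - measure circ (S2 N) \<le> measure circ (S1 N - S2 N)" by simp
        with measure_circ_trim[of "S1 N - S2 N" "B / real N"] AB show ?thesis by simp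
      qed
      ultimately show "lim_ge (\<lambda>N. measure circ ((S1 N - S2 N) \<inter> {0..1 - B / real N})) (pois h 1 * (tail j A - tail j (B - h)))"
        by (auto intro: lim_ge_mono)
    next
      fix N x assume N: "N > (0::nat)" and x: "x \<in> S1 N - S2 N" "0 \<le> x" "x \<le> 1 - B / real N"
      have ineq: "0 \<le> h / real N" "h / real N \<le> (A + h) / real N" "h / real N \<le> B / real N" "(A + h) / real N \<le> B / real N"
        using h AB N by (auto simp: divide_right_mono)
      let ?R = "below \<theta> N"
      define n where "n = Suc (?R x)"
      have R1: "?R (x + h / real N) = n"
        using hits_below[of x 0 "h / real N" N] x ineq by (auto simp: n_def S1_def)
      have R2: "?R (x + (A + h) / real N) < n + j"
        using hits_below[of x "h / real N" "(A + h) / real N" N] x ineq R1 by (auto simp: S1_def)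
      have R3: "n + j \<le> ?R (x + B / real N)"
        using hits_below[of x "h / real N" "B / real N" N] x ineq R1 by (auto simp: S1_def S2_def)
      have nN: "n + j \<le> N" using R3 below_le[of \<theta> N "x + B / real N"] by simp
      have o1: "x \<le> ordered \<theta> N n" "ordered \<theta> N n < x + h / real N"
        using ordered_less_iff[of n N \<theta>] R1 nN by (auto simp: n_def not_less[symmetric])
      have o2: "x + (A + h) / real N \<le> ordered \<theta> N (n + j)" "ordered \<theta> N (n + j) < x + B / real N"
        using ordered_less_iff[of "n + j" N \<theta>] R2 R3 nN by (auto simp: n_def not_less[symmetric])
      have "A / real N < ordered \<theta> N (n + j) - ordered \<theta> N n" "ordered \<theta> N (n + j) - ordered \<theta> N n < B / real N"
        using o1 o2 by (auto simp: add_divide_distrib)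
      then have "in_gap j A B N n"
        using N by (simp add: in_gap_def jth_spacing_def field_simps)
      with o1 nN show "\<exists>n\<in>{1..N - j}. in_gap j A B N n \<and> x \<le> ordered \<theta> N n \<and> ordered \<theta> N n < x + h / real N"
        by (intro bexI[of _ n]) (auto simp: n_def)
    qed (use h AB in auto)
  qed
  let ?h = "\<lambda>m. inverse (real (Suc m))"
  show ?thesis
  proof (rule lim_ge_limit)
    have "\<forall>\<^sub>F m in sequentially. ?h m < B - A"
      using AB by (intro order_tendstoD(2)[OF LIMSEQ_inverse_real_of_nat]) auto
    then show "\<forall>\<^sub>F m in sequentially. lim_ge ?f (pois (?h m) 1 * (tail j A - tail j (B - ?h m)) / ?h m)"
    proof eventually_elim
      case (elim m)
      then show ?case by (intro low) auto
    qed
    have "(\<lambda>m. exp (- ?h m) * (tail j A - tail j (B - ?h m))) \<longlonglongrightarrow> exp (- 0) * (tail j A - tail j (B - 0))"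
      by (intro tendsto_intros LIMSEQ_inverse_real_of_nat isCont_tendsto_compose[OF isCont_tail])
    then show "(\<lambda>m. pois (?h m) 1 * (tail j A - tail j (B - ?h m)) / ?h m) \<longlonglongrightarrow> tail j A - tail j B"
      by (simp add: pois_def)
  qed
qed

text \<open>The complement of \<open>[A, B]\<close> contains \<open>(0, A)\<close> and \<open>(B, m)\<close>; their limiting masses exhaust the rest as
\<open>m\<close> grows.\<close>

theorem jth_spacing_limit:
  assumes j: "j \<ge> 1" and AB: "0 \<le> A" "A \<le> B"
  shows "(\<lambda>N. real (card {n \<in> {1..N - j}. jth_spacing \<theta> N j n \<in> {A..B}}) / real N)
     \<longlonglongrightarrow> integral {A..B} (\<lambda>s. s ^ (j - 1) / fact (j - 1) * exp (- s))"
proof -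
  let ?f = "freq (\<lambda>N n. jth_spacing \<theta> N j n \<in> {A..B}) j"
  let ?g = "freq (\<lambda>N n. jth_spacing \<theta> N j n \<notin> {A..B}) j"
  have split: "?f N + ?g N \<le> 1" for N by (rule freq_compl)
  have f: "lim_ge ?f (tail j A - tail j B)"
    by (rule lim_ge_mono[OF jth_spacing_lower[OF j AB]])
       (auto simp: freq_def in_gap_def intro!: always_eventually divide_right_mono card_mono)
  have g: "lim_ge ?g (1 - (tail j A - tail j B))"
  proof (rule lim_ge_limit)
    have "lim_ge ?g ((tail j 0 - tail j A) + (tail j B - tail j (real m)))" if "B \<le> real m" for m
    proof (rule lim_ge_mono[OF lim_ge_add[OF jth_spacing_lower jth_spacing_lower]])
      show "\<forall>\<^sub>F N in sequentially. freq (in_gap j 0 A) j N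
         + freq (in_gap j B (real m)) j N \<le> ?g N"
      proof (rule always_eventually, rule allI)
        fix N
        have "card {n \<in> {1..N - j}. in_gap j 0 A N n} + card {n \<in> {1..N - j}. in_gap j B (real m) N n}
          \<le> card {n \<in> {1..N - j}. jth_spacing \<theta> N j n \<notin> {A..B}}"
          using AB by (subst card_Un_disjoint[symmetric]) (auto simp: in_gap_def intro!: card_mono)
        then show "freq (in_gap j 0 A) j N
         + freq (in_gap j B (real m)) j N \<le> ?g N"
          unfolding freq_def add_divide_distrib[symmetric] in_gap_def by (intro divide_right_mono) linarith+
      qed
    qed (use j AB that in auto)
    then show "\<forall>\<^sub>F m in sequentially. lim_ge ?g ((tail j 0 - tail j A) + (tail j B - tail j (real m)))"
      using eventually_ge_at_top[of "nat \<lceil>B\<rceil>"] by (auto elim!: eventually_mono simp: nat_ceiling_le_eq)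
    have "(\<lambda>m. (tail j 0 - tail j A) + (tail j B - tail j (real m))) \<longlonglongrightarrow> (tail j 0 - tail j A) + (tail j B - 0)"
      by (intro tendsto_intros tail_tendsto_0)
    then show "(\<lambda>m. (tail j 0 - tail j A) + (tail j B - tail j (real m))) \<longlonglongrightarrow> 1 - (tail j A - tail j B)"
      by (simp add: tail_0[OF j] algebra_simps)
  qed
  have "?f \<longlonglongrightarrow> tail j A - tail j B"
    by (rule lim_ge_squeeze[OF f g]) (use split in simp)
  then show ?thesis by (simp only: integral_erlang[OF AB(2) j] freq_def[abs_def])
qed

end

section \<open>Joint distribution of consecutive spacings\<close>

context poisson_sequence
begin

text \<open>If \<open>d 1, d 2, \<dots>\<close> are the gaps between occupied cells, starting with cell 0, then \<open>partial d l\<close> is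
the index of the \<open>l\<close>-th occupied cell.\<close>

definition partial :: "(nat \<Rightarrow> nat) \<Rightarrow> nat \<Rightarrow> nat" where
  "partial d l = (\<Sum>i\<in>{1..l}. d i)"

lemma partial_simps [simp]: "partial d 0 = 0" "partial d (Suc l) = partial d l + d (Suc l)"
  by (auto simp: partial_def)

lemma partial_mono: "l \<le> m \<Longrightarrow> partial d l \<le> partial d m"
  unfolding partial_def by (rule sum_mono2) auto

text \<open>Positions \<open>x\<close> at which, on the mesh of width \<open>h/N\<close> starting at \<open>x\<close>, the first \<open>r + 1\<close> occupied cells
are those prescribed by the gaps \<open>d\<close>, with exactly one point in each.\<close>

definition cells :: "real \<Rightarrow> nat \<Rightarrow> (nat \<Rightarrow> nat) \<Rightarrow> nat \<Rightarrow> real set" where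
  "cells h r d N = {x. \<forall>i<Suc (partial d r).
     hits \<theta> N (real i * h / real N) (real (Suc i) * h / real N) x = of_bool (i \<in> partial d ` {..r})}"

lemma cells_measurable [measurable]: "cells h r d N \<in> sets borel"
  unfolding cells_def by measurable

lemma partial_strict:
  assumes "\<And>i. i \<in> {1..r} \<Longrightarrow> 1 \<le> d i" "l < m" "m \<le> r"
  shows "partial d l < partial d m"
proof -
  obtain k where k: "m = Suc k" using assms(2) by (cases m) auto
  have "partial d l \<le> partial d k" using assms(2) k by (intro partial_mono) simp
  moreover have "1 \<le> d m" using assms(2,3) by (intro assms(1)) auto
  ultimately show ?thesis by (simp add: k)
qed

lemma partial_inj:
  assumes d: "\<And>i. i \<in> {1..r} \<Longrightarrow> 1 \<le> d i" and lm: "l \<le> r" "m \<le> r" "partial d l = partial d m"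
  shows "l = m"
proof (cases l m rule: linorder_cases)
  case less
  then show ?thesis using partial_strict[of r d, OF d less lm(2)] lm(3) by simp
next
  case greater
  then show ?thesis using partial_strict[of r d, OF d greater lm(1)] lm(3) by simp
qed

lemma cells_limit:
  assumes h: "0 < h" and d: "\<And>i. i \<in> {1..r} \<Longrightarrow> 1 \<le> d i"
  shows "(\<lambda>N. measure circ (cells h r d N)) \<longlonglongrightarrow> h ^ Suc r * exp (- (real (Suc (partial d r)) * h))"
proof -
  let ?M = "Suc (partial d r)" and ?k = "\<lambda>i. of_bool (i \<in> partial d ` {..r}) :: nat"
  have "(\<lambda>N. measure circ {x. \<forall>i<?M. hits \<theta> N (real i * h / real N) (real (Suc i) * h / real N) x = ?k i})
     \<longlonglongrightarrow> (\<Prod>i<?M. pois (real (Suc i) * h - real i * h) (?k i))"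
    by (rule joint) (use h in \<open>simp add: mult_right_mono\<close>)
  moreover have "(\<Prod>i<?M. pois (real (Suc i) * h - real i * h) (?k i)) = h ^ Suc r * exp (- (real ?M * h))"
  proof -
    have inj: "inj_on (partial d) {..r}"
    proof (rule inj_onI)
      fix l m assume "l \<in> {..r}" "m \<in> {..r}" "partial d l = partial d m"
      then show "l = m" using partial_inj[of r d, OF d] by auto
    qed
    have sub: "partial d ` {..r} \<subseteq> {..<?M}" using partial_mono[of _ r d] by (auto simp: less_Suc_eq_le)
    have "(\<Prod>i<?M. pois (real (Suc i) * h - real i * h) (?k i)) = (\<Prod>i<?M. exp (- h) * (if i \<in> partial d ` {..r} then h else 1))"
      by (intro prod.cong) (auto simp: pois_def algebra_simps)
    also have "\<dots> = exp (- h) ^ ?M * (\<Prod>i\<in>{i \<in> {..<?M}. i \<in> partial d ` {..r}}. h)"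
      by (subst prod.inter_filter) (simp_all only: prod.distrib prod_constant card_lessThan finite_lessThan)
    also have "{i \<in> {..<?M}. i \<in> partial d ` {..r}} = partial d ` {..r}" using sub by blast
    also have "(\<Prod>i\<in>partial d ` {..r}. h) = h ^ Suc r" by (simp only: prod_constant card_image[OF inj] card_atMost)
    also have "exp (- h) ^ ?M = exp (- (real ?M * h))" by (metis exp_of_nat_mult mult_minus_right)
    finally show ?thesis by (simp only: mult.commute)
  qed
  ultimately show ?thesis by (simp only: cells_def)
qed

text \<open>The counting function increases by one exactly in the occupied cells.\<close>

lemma cells_below:
  assumes N: "N > 0" and h: "0 < h" and x: "x \<in> cells h r d N" "0 \<le> x" "x + real (Suc (partial d r)) * h / real N \<le> 1"
    and d: "\<And>i. i \<in> {1..r} \<Longrightarrow> 1 \<le> d i" and l: "l \<le> r"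
  shows "below \<theta> N (x + real (partial d l) * h / real N) = below \<theta> N x + l"
    "below \<theta> N (x + real (Suc (partial d l)) * h / real N) = below \<theta> N x + Suc l"
proof -
  let ?R = "\<lambda>i. below \<theta> N (x + real i * h / real N)"
  have step: "?R (Suc i) = ?R i + of_bool (i \<in> partial d ` {..r})" if "i \<le> partial d r" for i
  proof -
    have "real i * h / real N \<le> real (Suc i) * h / real N" "0 \<le> real i * h / real N"
      using h by (auto intro!: divide_right_mono mult_right_mono)
    moreover have "real (Suc i) * h / real N \<le> real (Suc (partial d r)) * h / real N"
      using that h by (intro divide_right_mono mult_right_mono) auto
    ultimately have "?R (Suc i) = ?R i + hits \<theta> N (real i * h / real N) (real (Suc i) * h / real N) x"
      using x by (intro hits_below) auto
    then show ?thesis using x(1) that by (simp add: cells_def less_Suc_eq_le)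
  qed
  have R: "?R i = below \<theta> N x + card {l. l \<le> r \<and> partial d l < i}" if "i \<le> Suc (partial d r)" for i
    using that
  proof (induction i)
    case (Suc i)
    have fin: "finite {l. l \<le> r \<and> partial d l < j}" for j by simp
    have "card {l. l \<le> r \<and> partial d l < Suc i} = card {l. l \<le> r \<and> partial d l < i} + of_bool (i \<in> partial d ` {..r})"
    proof (cases "i \<in> partial d ` {..r}")
      case True
      then obtain l where l: "l \<le> r" "i = partial d l" by auto
      have uniq: "m = l" if "m \<le> r" "partial d m = partial d l" for m
        using partial_inj[of r d, OF d that(1) l(1) that(2)] by simp
      have "{l. l \<le> r \<and> partial d l < Suc i} = insert l {l. l \<le> r \<and> partial d l < i}"
        using l uniq by (auto simp: less_Suc_eq)
      then show ?thesis using True l by simp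
    next
      case False
      then have "{l. l \<le> r \<and> partial d l < Suc i} = {l. l \<le> r \<and> partial d l < i}" by (auto simp: less_Suc_eq)
      then show ?thesis using False by simp
    qed
    with Suc step[of i] show ?case by simp
  qed simp
  have pl: "partial d l \<le> partial d r" using l by (rule partial_mono)
  have lt: "partial d m < partial d l \<longleftrightarrow> m < l" if "m \<le> r" for m
    using partial_mono[of l m d] partial_strict[of r d m l, OF d] l by (meson not_le)
  have le: "partial d m \<le> partial d l \<longleftrightarrow> m \<le> l" if "m \<le> r" for m
    using partial_mono[of m l d] partial_strict[of r d l m, OF d] that by (meson not_le)
  have "{m. m \<le> r \<and> partial d m < partial d l} = {..<l}" using l lt by auto
  then show "?R (partial d l) = below \<theta> N x + l" using R[of "partial d l"] pl by simp
  have "{m. m \<le> r \<and> partial d m < Suc (partial d l)} = {..l}" using l le by (auto simp: less_Suc_eq_le)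
  then show "?R (Suc (partial d l)) = below \<theta> N x + Suc l" using R[of "Suc (partial d l)"] pl by simp
qed

text \<open>The counting function determines the cell containing the \<open>l\<close>-th point after \<open>x\<close>, hence all gaps.\<close>

lemma cells_disjoint:
  assumes N: "N > 0" and h: "0 < h" and x: "x \<in> cells h r d N" "x \<in> cells h r d' N" "0 \<le> x"
      "x + real (Suc (partial d r)) * h / real N \<le> 1" "x + real (Suc (partial d' r)) * h / real N \<le> 1"
    and d: "\<And>i. i \<in> {1..r} \<Longrightarrow> 1 \<le> d i" "\<And>i. i \<in> {1..r} \<Longrightarrow> 1 \<le> d' i" and i: "i \<in> {1..r}"
  shows "d i = d' i"
proof -
  have le: "partial d' l \<le> partial d l"
    if "l \<le> r" "x \<in> cells h r d N" "x \<in> cells h r d' N" 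
      "x + real (Suc (partial d r)) * h / real N \<le> 1" "x + real (Suc (partial d' r)) * h / real N \<le> 1"
      "\<And>i. i \<in> {1..r} \<Longrightarrow> 1 \<le> d i" "\<And>i. i \<in> {1..r} \<Longrightarrow> 1 \<le> d' i" for d d' l
  proof (rule ccontr)
    assume "\<not> partial d' l \<le> partial d l"
    then have "real (Suc (partial d l)) * h / real N \<le> real (partial d' l) * h / real N"
      using h by (intro divide_right_mono mult_right_mono) auto
    then have "below \<theta> N (x + real (Suc (partial d l)) * h / real N) \<le> below \<theta> N (x + real (partial d' l) * h / real N)"
      by (intro below_mono) simp
    moreover note cells_below(2)[OF N h that(2) x(3) that(4,6,1)] cells_below(1)[OF N h that(3) x(3) that(5,7,1)]
    ultimately show False by simp
  qed
  have "partial d l = partial d' l" if "l \<le> r" for l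
    using le[OF that x(1,2,4,5) d] le[OF that x(2,1,5,4) d(2,1)] by (rule order_antisym[rotated])
  from this[of i] this[of "i - 1"] i show ?thesis by (cases i) auto
qed

definition in_box :: "nat \<Rightarrow> (nat \<Rightarrow> real) \<Rightarrow> (nat \<Rightarrow> real) \<Rightarrow> nat \<Rightarrow> nat \<Rightarrow> bool" where
  "in_box r A B N n \<longleftrightarrow> (\<forall>i\<in>{1..r}. A i < spacing \<theta> N (n + i - 1) \<and> spacing \<theta> N (n + i - 1) < B i)"

text \<open>Points in cells at distance \<open>d\<close> on a mesh of width \<open>h\<close> have distance strictly between \<open>(d - 1) h\<close> and
\<open>(d + 1) h\<close>.\<close>

lemma cells_in_box:
  assumes N: "N > 0" and h: "0 < h" and x: "x \<in> cells h r d N" "0 \<le> x" "x + real (Suc (partial d r)) * h / real N \<le> 1"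
    and d: "\<And>i. i \<in> {1..r} \<Longrightarrow> 1 \<le> d i"
    and AB: "\<And>i. i \<in> {1..r} \<Longrightarrow> A i \<le> (real (d i) - 1) * h" "\<And>i. i \<in> {1..r} \<Longrightarrow> (real (d i) + 1) * h \<le> B i"
  shows "\<exists>n\<in>{1..N - r}. in_box r A B N n \<and> x \<le> ordered \<theta> N n \<and> ordered \<theta> N n < x + h / real N"
proof -
  define n where "n = Suc (below \<theta> N x)"
  have nr: "n + r \<le> N"
    using cells_below(2)[OF N h x d, of r] below_le[of \<theta> N "x + real (Suc (partial d r)) * h / real N"] by (simp add: n_def)
  have o: "x + real (partial d l) * h / real N \<le> ordered \<theta> N (n + l)"
    "ordered \<theta> N (n + l) < x + real (Suc (partial d l)) * h / real N" if "l \<le> r" for l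
  proof -
    have nl: "1 \<le> n + l" "n + l \<le> N" using nr that by (auto simp: n_def)
    show "ordered \<theta> N (n + l) < x + real (Suc (partial d l)) * h / real N"
      unfolding ordered_less_iff[OF nl] using cells_below(2)[OF N h x d that] by (simp only: n_def)
    have "\<not> ordered \<theta> N (n + l) < x + real (partial d l) * h / real N"
      unfolding ordered_less_iff[OF nl] using cells_below(1)[OF N h x d that] by (simp only: n_def)
    then show "x + real (partial d l) * h / real N \<le> ordered \<theta> N (n + l)" by simp
  qed
  have "in_box r A B N n" unfolding in_box_def
  proof
    fix i assume i: "i \<in> {1..r}"
    then obtain l where l: "i = Suc l" by (cases i) auto
    have p: "real (partial d i) = real (partial d l) + real (d i)" by (simp add: l)
    have "real N * (real k * h / real N) = real k * h" for k using N by simp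
    then have o': "real N * x + real (partial d i) * h \<le> real N * ordered \<theta> N (n + i)"
      "real N * ordered \<theta> N (n + i) < real N * x + real (Suc (partial d i)) * h"
      "real N * x + real (partial d l) * h \<le> real N * ordered \<theta> N (n + l)"
      "real N * ordered \<theta> N (n + l) < real N * x + real (Suc (partial d l)) * h"
      using o[of i] o[of l] i N l mult_left_mono[OF o(1)[of i], of "real N"] mult_left_mono[OF o(1)[of l], of "real N"]
        mult_strict_left_mono[OF o(2)[of i], of "real N"] mult_strict_left_mono[OF o(2)[of l], of "real N"]
      by (auto simp only: distrib_left atLeastAtMost_iff of_nat_0_less_iff of_nat_0_le_iff)
    have sp: "spacing \<theta> N (n + i - 1) = real N * ordered \<theta> N (n + i) - real N * ordered \<theta> N (n + l)"
      by (simp add: spacing_def l right_diff_distrib)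
    show "A i < spacing \<theta> N (n + i - 1) \<and> spacing \<theta> N (n + i - 1) < B i"
      using o' AB[OF i] unfolding sp p of_nat_Suc by (simp add: algebra_simps)
  qed
  with o[of 0] nr show ?thesis by (intro bexI[of _ n]) (auto simp: n_def)
qed

text \<open>A discrete analogue of the integral of the exponential density, using \<open>1 - exp (- h) \<le> h\<close>; if
\<open>p > q + 1\<close>, the left-hand side is negative.\<close>

lemma geometric_lower:
  assumes h: "0 < h"
  shows "exp (- (real p * h)) - exp (- (real (Suc q) * h)) \<le> (\<Sum>d\<in>{p..q}. h * exp (- (real d * h)))"
proof (cases "p \<le> Suc q")
  case True
  define e where "e d = exp (- (real d * h))" for d
  have "(\<Sum>d\<in>{p..<Suc q}. - e (Suc d) - - e d) = - e (Suc q) - - e p"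
    by (rule sum_Suc_diff'[OF True])
  moreover have "(\<Sum>d\<in>{p..<Suc q}. - e (Suc d) - - e d) = (\<Sum>d\<in>{p..q}. e d - e (Suc d))"
    unfolding atLeastLessThanSuc_atLeastAtMost by (intro sum.cong) auto
  ultimately have "exp (- (real p * h)) - exp (- (real (Suc q) * h))
    = (\<Sum>d\<in>{p..q}. exp (- (real d * h)) - exp (- (real (Suc d) * h)))"
    unfolding e_def by linarith
  also have "\<dots> \<le> (\<Sum>d\<in>{p..q}. h * exp (- (real d * h)))"
  proof (rule sum_mono)
    fix d
    have "1 - exp (- h) \<le> h" using exp_ge_add_one_self[of "- h"] by simp
    then have "(1 - exp (- h)) * exp (- (real d * h)) \<le> h * exp (- (real d * h))" by (intro mult_right_mono) auto
    moreover have "exp (- (real (Suc d) * h)) = exp (- h) * exp (- (real d * h))"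
      by (simp add: exp_add[symmetric] algebra_simps)
    ultimately show "exp (- (real d * h)) - exp (- (real (Suc d) * h)) \<le> h * exp (- (real d * h))"
      by (simp add: left_diff_distrib)
  qed
  finally show ?thesis .
next
  case False
  then have "exp (- (real p * h)) \<le> exp (- (real (Suc q) * h))"
    using h by (intro iffD2[OF exp_le_cancel_iff]) (auto intro: mult_right_mono)
  moreover have "0 \<le> (\<Sum>d\<in>{p..q}. h * exp (- (real d * h)))" using h by (intro sum_nonneg) auto
  ultimately show ?thesis by linarith
qed

text \<open>The patterns of gaps that certify the box form a product of integer intervals, and the limiting
measure of a pattern factorizes over the gaps.  Their sum is therefore a product of geometric sums.\<close>

lemma in_box_lower_mesh:
  assumes h: "0 < h" and A: "\<And>i. i \<in> {1..r} \<Longrightarrow> 0 \<le> A i" "\<And>i. i \<in> {1..r} \<Longrightarrow> A i \<le> B i"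
    and pos: "\<And>i. i \<in> {1..r} \<Longrightarrow> 0 \<le> exp (- (A i + 2 * h)) - exp (- (B i - h))"
  shows "lim_ge (freq (in_box r A B) r) (exp (- h) * (\<Prod>i\<in>{1..r}. exp (- (A i + 2 * h)) - exp (- (B i - h))))"
proof -
  let ?w = "\<lambda>d. h ^ Suc r * exp (- (real (Suc (partial d r)) * h))"
  \<comment> \<open>The gaps \<open>d\<close> in \<open>{p i..q i}\<close> satisfy \<open>A i \<le> (d - 1) h\<close> and \<open>(d + 1) h \<le> B i\<close>; rounding loses at most \<open>2 h\<close> and \<open>h\<close>.\<close>
  define p where "p i = Suc (nat \<lceil>A i / h\<rceil>)" for i
  define q where "q i = nat (\<lfloor>B i / h\<rfloor> - 1)" for i
  define D where "D = PiE {1..r} (\<lambda>i. {p i..q i})"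
  have finD: "finite D" unfolding D_def by (intro finite_PiE) auto
  have p: "A i \<le> (real d - 1) * h" "1 \<le> d" if "p i \<le> d" for i d
  proof -
    show "1 \<le> d" using that by (simp add: p_def)
    have "A i / h \<le> real d - 1" using that unfolding p_def by linarith
    then show "A i \<le> (real d - 1) * h" using h by (simp add: field_simps)
  qed
  have q: "(real d + 1) * h \<le> B i" if "d \<le> q i" "1 \<le> d" for i d
  proof -
    have "real d + 1 \<le> B i / h" using that unfolding q_def by linarith
    then show ?thesis using h by (simp add: field_simps)
  qed
  have ph: "real (p i) * h \<le> A i + 2 * h" if "i \<in> {1..r}" for i
  proof -
    have "0 \<le> A i / h" using A(1)[OF that] h by simp
    then have "real (p i) \<le> A i / h + 2" unfolding p_def by linarith
    from mult_right_mono[OF this, of h] h show ?thesis by (simp add: distrib_right)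
  qed
  have qh: "B i - h \<le> real (Suc (q i)) * h" for i
  proof -
    have "B i / h - 1 \<le> real (Suc (q i))" unfolding q_def by linarith
    from mult_right_mono[OF this, of h] h show ?thesis by (simp add: left_diff_distrib)
  qed
  have Dd: "1 \<le> d i" "A i \<le> (real (d i) - 1) * h" "(real (d i) + 1) * h \<le> B i" "d i \<le> q i" if "d \<in> D" "i \<in> {1..r}" for d i
    using that p[of i "d i"] q[of "d i" i] by (auto simp: D_def PiE_iff)
  define L where "L = real (Suc (partial q r)) * h"
  have L0: "0 \<le> L" using h by (simp add: L_def)
  have L: "real (Suc (partial d r)) * h \<le> L" if "d \<in> D" for d
  proof -
    have "partial d r \<le> partial q r" unfolding partial_def using Dd(4)[OF that] by (intro sum_mono) auto
    then show ?thesis unfolding L_def using h by (intro mult_right_mono) auto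
  qed
  have fits: "x + real (Suc (partial d r)) * h / real N \<le> 1" if "d \<in> D" "x \<le> 1 - L / real N" for d x N
    using divide_right_mono[OF L[OF that(1)], of "real N"] that(2) by simp
  let ?S = "\<lambda>N. \<Union>d\<in>D. cells h r d N"
  have "lim_ge (freq (in_box r A B) r) ((\<Sum>d\<in>D. ?w d) / h)"
  proof (rule freq_lower[where S = ?S and L = L])
    show "?S N \<in> sets borel" for N using finD by (intro sets.finite_UN) auto
    have eq: "measure circ (?S N \<inter> {0..1 - L / real N}) = (\<Sum>d\<in>D. measure circ (cells h r d N \<inter> {0..1 - L / real N}))"
      if N: "N > 0" for N
    proof -
      have u: "?S N \<inter> {0..1 - L / real N} = (\<Union>d\<in>D. cells h r d N \<inter> {0..1 - L / real N})" by blast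
      have dj: "disjoint_family_on (\<lambda>d. cells h r d N \<inter> {0..1 - L / real N}) D"
        unfolding disjoint_family_on_def
      proof (intro ballI impI)
        fix d d' assume dd: "d \<in> D" "d' \<in> D" "d \<noteq> d'"
        show "(cells h r d N \<inter> {0..1 - L / real N}) \<inter> (cells h r d' N \<inter> {0..1 - L / real N}) = {}"
        proof (rule equals0I)
          fix x assume x: "x \<in> (cells h r d N \<inter> {0..1 - L / real N}) \<inter> (cells h r d' N \<inter> {0..1 - L / real N})"
          have "d i = d' i" if "i \<in> {1..r}" for i
            using x dd that by (intro cells_disjoint[OF N h, of x r d d' i] fits Dd) auto
          then have "d = d'" using dd(1,2) unfolding D_def by (intro PiE_ext) auto
          with dd(3) show False by simp
        qed
      qed
      show ?thesis unfolding u by (rule circ.finite_measure_finite_Union[OF finD _ dj]) auto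
    qed
    show "lim_ge (\<lambda>N. measure circ (?S N \<inter> {0..1 - L / real N})) (\<Sum>d\<in>D. ?w d)"
    proof (rule lim_ge_mono)
      have "(\<lambda>N. \<Sum>d\<in>D. measure circ (cells h r d N) - L / real N) \<longlonglongrightarrow> (\<Sum>d\<in>D. ?w d - 0)"
        using Dd(1) h by (intro tendsto_sum tendsto_diff cells_limit div_tendsto_0) auto
      then show "lim_ge (\<lambda>N. \<Sum>d\<in>D. measure circ (cells h r d N) - L / real N) (\<Sum>d\<in>D. ?w d)"
        by (intro lim_ge_tendsto) simp
      show "\<forall>\<^sub>F N in sequentially. (\<Sum>d\<in>D. measure circ (cells h r d N) - L / real N) \<le> measure circ (?S N \<inter> {0..1 - L / real N})"
        using eventually_gt_at_top[of 0]
      proof eventually_elim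
        case (elim N)
        show ?case unfolding eq[OF elim] using L0 by (intro sum_mono measure_circ_trim) auto
      qed
    qed
  next
    fix N x assume "N > (0::nat)" "x \<in> ?S N" "0 \<le> x" "x \<le> 1 - L / real N"
    then obtain d where "d \<in> D" "x \<in> cells h r d N" by auto
    then show "\<exists>n\<in>{1..N - r}. in_box r A B N n \<and> x \<le> ordered \<theta> N n \<and> ordered \<theta> N n < x + h / real N"
      using \<open>N > 0\<close> \<open>0 \<le> x\<close> \<open>x \<le> 1 - L / real N\<close> h by (intro cells_in_box[where d = d] fits Dd) auto
  qed (use h L0 in auto)
  moreover have "(\<Sum>d\<in>D. ?w d) / h
    = exp (- h) * (\<Prod>i\<in>{1..r}. \<Sum>d\<in>{p i..q i}. h * exp (- (real d * h)))"
  proof -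
    have "?w d = h * exp (- h) * (\<Prod>i\<in>{1..r}. h * exp (- (real (d i) * h)))" for d
    proof -
      have "(\<Prod>i\<in>{1..r}. h * exp (- (real (d i) * h))) = h ^ r * exp (- (real (partial d r) * h))"
        by (simp add: prod.distrib partial_def exp_sum[symmetric] sum_negf sum_distrib_right)
      moreover have "exp (- (real (Suc (partial d r)) * h)) = exp (- h) * exp (- (real (partial d r) * h))"
        by (simp add: exp_add[symmetric] algebra_simps)
      ultimately show ?thesis by simp
    qed
    then have "(\<Sum>d\<in>D. ?w d)
      = h * exp (- h) * (\<Sum>d\<in>D. \<Prod>i\<in>{1..r}. h * exp (- (real (d i) * h)))"
      by (simp only: sum_distrib_left)
    also have "(\<Sum>d\<in>D. \<Prod>i\<in>{1..r}. h * exp (- (real (d i) * h))) = (\<Prod>i\<in>{1..r}. \<Sum>d\<in>{p i..q i}. h * exp (- (real d * h)))"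
      unfolding D_def by (rule prod_sum_PiE[symmetric]) auto
    finally show ?thesis using h by simp
  qed
  moreover have "(\<Prod>i\<in>{1..r}. exp (- (A i + 2 * h)) - exp (- (B i - h))) \<le> (\<Prod>i\<in>{1..r}. \<Sum>d\<in>{p i..q i}. h * exp (- (real d * h)))"
  proof (rule prod_mono)
    fix i assume i: "i \<in> {1..r}"
    have "exp (- (A i + 2 * h)) - exp (- (B i - h)) \<le> exp (- (real (p i) * h)) - exp (- (real (Suc (q i)) * h))"
      using ph[OF i] qh[of i] by (intro diff_mono) auto
    also have "\<dots> \<le> (\<Sum>d\<in>{p i..q i}. h * exp (- (real d * h)))" by (rule geometric_lower[OF h])
    finally show "0 \<le> exp (- (A i + 2 * h)) - exp (- (B i - h)) \<and>
       exp (- (A i + 2 * h)) - exp (- (B i - h)) \<le> (\<Sum>d\<in>{p i..q i}. h * exp (- (real d * h)))"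
      using pos[OF i] by simp
  qed
  ultimately show ?thesis by (auto intro: lim_ge_le)
qed

lemma in_box_lower:
  assumes A: "\<And>i. i \<in> {1..r} \<Longrightarrow> 0 \<le> A i" "\<And>i. i \<in> {1..r} \<Longrightarrow> A i \<le> B i"
  shows "lim_ge (freq (in_box r A B) r) (\<Prod>i\<in>{1..r}. exp (- A i) - exp (- B i))"
proof (cases "\<exists>i\<in>{1..r}. A i = B i")
  case True
  then have z: "(\<Prod>i\<in>{1..r}. exp (- A i) - exp (- B i)) = 0" by (subst prod_zero_iff) auto
  show ?thesis unfolding z by (auto simp: lim_ge_def intro!: always_eventually less_le_trans[OF _ freq_nonneg])
next
  case False
  let ?h = "\<lambda>m. inverse (real (Suc m))"
  have lim: "(\<lambda>m. exp (- (A i + 2 * ?h m)) - exp (- (B i - ?h m))) \<longlonglongrightarrow> exp (- (A i + 2 * 0)) - exp (- (B i - 0))" for i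
    by (intro tendsto_intros LIMSEQ_inverse_real_of_nat)
  show ?thesis
  proof (rule lim_ge_limit)
    have "\<forall>\<^sub>F m in sequentially. 0 < exp (- (A i + 2 * ?h m)) - exp (- (B i - ?h m))" if "i \<in> {1..r}" for i
      using False A that by (intro order_tendstoD(1)[OF lim]) (auto simp: less_le)
    then have "\<forall>\<^sub>F m in sequentially. \<forall>i\<in>{1..r}. 0 < exp (- (A i + 2 * ?h m)) - exp (- (B i - ?h m))"
      by (intro eventually_ball_finite) auto
    then show "\<forall>\<^sub>F m in sequentially. lim_ge (freq (in_box r A B) r)
        (exp (- ?h m) * (\<Prod>i\<in>{1..r}. exp (- (A i + 2 * ?h m)) - exp (- (B i - ?h m))))"
    proof eventually_elim
      case (elim m)
      then show ?case using A by (intro in_box_lower_mesh) (auto simp: less_imp_le)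
    qed
    have "(\<lambda>m. exp (- ?h m) * (\<Prod>i\<in>{1..r}. exp (- (A i + 2 * ?h m)) - exp (- (B i - ?h m))))
      \<longlonglongrightarrow> exp (- 0) * (\<Prod>i\<in>{1..r}. exp (- (A i + 2 * 0)) - exp (- (B i - 0)))"
      by (intro tendsto_mult tendsto_prod lim tendsto_exp tendsto_minus LIMSEQ_inverse_real_of_nat)
    then show "(\<lambda>m. exp (- ?h m) * (\<Prod>i\<in>{1..r}. exp (- (A i + 2 * ?h m)) - exp (- (B i - ?h m))))
      \<longlonglongrightarrow> (\<Prod>i\<in>{1..r}. exp (- A i) - exp (- B i))" by simp
  qed
qed

lemma integral_exp: "A \<le> B \<Longrightarrow> integral {A..B} (\<lambda>s. exp (- s)) = exp (- A) - exp (- B :: real)"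
  using integral_erlang[of A B 1] tail_1 by simp

text \<open>Every factor of the box \<open>[A, B]\<close> splits \<open>(0, m)\<close> into three intervals.  The \<open>3 ^ r\<close> resulting boxes
have total limiting mass \<open>(1 - exp (- m)) ^ r\<close>, and all but the central one are disjoint from the
closed box.\<close>

theorem spacing_limit:
  assumes AB: "\<And>i. i \<in> {1..r} \<Longrightarrow> 0 \<le> A i \<and> A i \<le> B i"
  shows "(\<lambda>N. real (card {n \<in> {1..N - r}. \<forall>i\<in>{1..r}. spacing \<theta> N (n + i - 1) \<in> {A i..B i}}) / real N)
     \<longlonglongrightarrow> (\<Prod>i=1..r. integral {A i..B i} (\<lambda>s. exp (- s)))"
proof -
  let ?P = "\<lambda>N n. \<forall>i\<in>{1..r}. spacing \<theta> N (n + i - 1) \<in> {A i..B i}"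
  let ?f = "freq (\<lambda>N n. ?P N n) r"
  let ?g = "freq (\<lambda>N n. \<not> (?P N n)) r"
  define \<mu> where "\<mu> = (\<Prod>i\<in>{1..r}. exp (- A i) - exp (- B i))"
  have split: "?f N + ?g N \<le> 1" for N by (rule freq_compl)
  have f: "lim_ge ?f \<mu>"
  proof (rule lim_ge_mono)
    show "lim_ge (freq (in_box r A B) r) \<mu>" unfolding \<mu>_def using AB by (intro in_box_lower) auto
    show "\<forall>\<^sub>F N in sequentially. freq (in_box r A B) r N \<le> ?f N"
      unfolding freq_def in_box_def
      by (intro always_eventually allI divide_right_mono of_nat_mono card_mono) (auto simp: less_imp_le)
  qed
  have g: "lim_ge ?g (1 - \<mu>)"
  proof (rule lim_ge_limit)
    \<comment> \<open>The value \<open>c i\<close> in \<open>{0, 1, 2}\<close> selects the part \<open>(0, A i)\<close>, \<open>(A i, B i)\<close> or \<open>(B i, m)\<close> of the \<open>i\<close>-th factor.\<close>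
    define lo where "lo c i = (if c i = 0 then 0 else if c i = 1 then A i else B i)" for c :: "nat \<Rightarrow> nat" and i
    define hi where "hi m c i = (if c i = 0 then A i else if c i = 1 then B i else real m)" for m :: nat and c :: "nat \<Rightarrow> nat" and i
    define W where "W = PiE {1..r} (\<lambda>_. {0, 1, 2::nat})"
    define one where "one = (\<lambda>i\<in>{1..r}. 1::nat)"
    have W: "finite W" "one \<in> W" unfolding W_def one_def by (auto intro!: finite_PiE)
    have low: "lim_ge ?g ((1 - exp (- real m)) ^ r - \<mu>)" if m: "\<And>i. i \<in> {1..r} \<Longrightarrow> B i \<le> real m" for m
    proof (rule lim_ge_mono)
      have lim: "lim_ge (\<lambda>N. \<Sum>c\<in>W - {one}. freq (in_box r (lo c) (hi m c)) r N)
         (\<Sum>c\<in>W - {one}. \<Prod>i\<in>{1..r}. exp (- lo c i) - exp (- hi m c i))"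
        using AB m by (intro lim_ge_sum in_box_lower) (auto simp: lo_def hi_def intro: order_trans)
      have "(\<Sum>c\<in>W. \<Prod>i\<in>{1..r}. exp (- lo c i) - exp (- hi m c i))
        = (\<Sum>c\<in>W. \<Prod>i\<in>{1..r}. exp (- lo (\<lambda>_. c i) i) - exp (- hi m (\<lambda>_. c i) i))"
        by (simp only: lo_def hi_def)
      also have "\<dots> = (\<Prod>i\<in>{1..r}. \<Sum>\<kappa>\<in>{0, 1, 2}. exp (- lo (\<lambda>_. \<kappa>) i) - exp (- hi m (\<lambda>_. \<kappa>) i))"
        unfolding W_def by (rule prod_sum_PiE[symmetric]) auto
      also have "\<dots> = (1 - exp (- real m)) ^ r" by (simp add: lo_def hi_def)
      finally have "(\<Sum>c\<in>W. \<Prod>i\<in>{1..r}. exp (- lo c i) - exp (- hi m c i)) = (1 - exp (- real m)) ^ r" .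
      moreover have "(\<Prod>i\<in>{1..r}. exp (- lo one i) - exp (- hi m one i)) = \<mu>"
        unfolding \<mu>_def by (intro prod.cong) (auto simp: lo_def hi_def one_def)
      ultimately have "(\<Sum>c\<in>W - {one}. \<Prod>i\<in>{1..r}. exp (- lo c i) - exp (- hi m c i)) = (1 - exp (- real m)) ^ r - \<mu>"
        using W by (simp add: sum_diff1)
      with lim show "lim_ge (\<lambda>N. \<Sum>c\<in>W - {one}. freq (in_box r (lo c) (hi m c)) r N) ((1 - exp (- real m)) ^ r - \<mu>)" by simp
      show "\<forall>\<^sub>F N in sequentially. (\<Sum>c\<in>W - {one}. freq (in_box r (lo c) (hi m c)) r N) \<le> ?g N"
      proof (rule always_eventually, rule allI)
        fix N
        let ?b = "\<lambda>c. {n \<in> {1..N - r}. in_box r (lo c) (hi m c) N n}"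
        let ?Q = "{n \<in> {1..N - r}. \<not> ?P N n}"
        have ne: "\<exists>i\<in>{1..r}. c i \<noteq> c' i" if "c \<in> W" "c' \<in> W" "c \<noteq> c'" for c c'
          using that unfolding W_def by (metis PiE_ext)
        have cW: "c i = 0 \<or> c i = 1 \<or> c i = 2" if "c \<in> W" "i \<in> {1..r}" for c i
          using that by (auto simp: W_def PiE_iff)
        have disj: "?b c \<inter> ?b c' = {}" if c: "c \<in> W" "c' \<in> W" "c \<noteq> c'" for c c'
        proof (rule equals0I)
          fix n assume n: "n \<in> ?b c \<inter> ?b c'"
          from ne[OF c] obtain i where i: "i \<in> {1..r}" "c i \<noteq> c' i" by blast
          let ?\<delta> = "spacing \<theta> N (n + i - 1)"
          have "lo c i < ?\<delta>" "?\<delta> < hi m c i" "lo c' i < ?\<delta>" "?\<delta> < hi m c' i"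
            using n i by (auto simp: in_box_def)
          with AB[OF i(1)] m[OF i(1)] i(2) cW[OF c(1) i(1)] cW[OF c(2) i(1)] show False
            by (auto simp: lo_def hi_def)
        qed
        have sub: "?b c \<subseteq> ?Q"
          if c: "c \<in> W - {one}" for c
        proof
          fix n assume n: "n \<in> ?b c"
          from c W(2) ne[of c one] obtain i where i: "i \<in> {1..r}" "c i \<noteq> one i" by blast
          have "lo c i < spacing \<theta> N (n + i - 1)" "spacing \<theta> N (n + i - 1) < hi m c i"
            using n i by (auto simp: in_box_def)
          then have "spacing \<theta> N (n + i - 1) \<notin> {A i..B i}"
            using i cW[of c i] c by (auto simp: lo_def hi_def one_def)
          with i n show "n \<in> ?Q" by blast
        qed
        have "(\<Sum>c\<in>W - {one}. card (?b c)) = card (\<Union>c\<in>W - {one}. ?b c)"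
          using W disj by (intro card_UN_disjoint[symmetric]) auto
        also have "\<dots> \<le> card ?Q"
          using sub by (intro card_mono UN_least) auto
        finally have "real (\<Sum>c\<in>W - {one}. card (?b c)) \<le> real (card ?Q)"
          by (rule of_nat_mono)
        then show "(\<Sum>c\<in>W - {one}. freq (in_box r (lo c) (hi m c)) r N) \<le> ?g N"
          unfolding freq_def sum_divide_distrib[symmetric] of_nat_sum by (rule divide_right_mono) simp
      qed
    qed
    have "\<forall>\<^sub>F m in sequentially. \<forall>i\<in>{1..r}. B i \<le> real m"
    proof (intro eventually_ball_finite ballI)
      fix i show "\<forall>\<^sub>F m in sequentially. B i \<le> real m"
        using eventually_ge_at_top[of "nat \<lceil>B i\<rceil>"] by eventually_elim linarith
    qed simp
    then show "\<forall>\<^sub>F m in sequentially. lim_ge ?g ((1 - exp (- real m)) ^ r - \<mu>)"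
      by eventually_elim (use low in blast)
    have "(\<lambda>m. exp (- real m)) \<longlonglongrightarrow> 0" using tail_tendsto_0[of 1] by (simp only: tail_1)
    then have "(\<lambda>m. (1 - exp (- real m)) ^ r - \<mu>) \<longlonglongrightarrow> (1 - 0) ^ r - \<mu>" by (intro tendsto_intros)
    then show "(\<lambda>m. (1 - exp (- real m)) ^ r - \<mu>) \<longlonglongrightarrow> 1 - \<mu>" by simp
  qed
  have "?f \<longlonglongrightarrow> \<mu>" by (rule lim_ge_squeeze[OF f g]) (use split in simp)
  moreover have "(\<Prod>i=1..r. integral {A i..B i} (\<lambda>s. exp (- s))) = \<mu>"
    unfolding \<mu>_def using AB by (intro prod.cong integral_exp) auto
  ultimately show ?thesis by (simp only: freq_def[abs_def])
qed

end

section \<open>Lacunary sequences\<close>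

lemma arc_fun_frac: "arc_fun b c (frac t - x) = arc_fun b c (t - x)"
proof -
  have "\<lfloor>frac t - y\<rfloor> = \<lfloor>t - y\<rfloor> - \<lfloor>t\<rfloor>" for y
  proof -
    have "frac t - y = (t - y) - of_int \<lfloor>t\<rfloor>" by (simp add: frac_def)
    then show ?thesis by (simp only: floor_diff_of_int)
  qed
  then show ?thesis by (simp add: arc_fun_def diff_diff_eq)
qed

lemma poisson_sequence_frac:
  assumes "\<And>M s v. steps M s v \<Longrightarrow> (\<lambda>N. void \<theta> N (step_fun M (\<lambda>i. s i / real N) v)) \<longlonglongrightarrow> exp (- mass M s v)"
  shows "poisson_sequence (\<lambda>n. frac (\<theta> n))"
proof
  fix M :: nat and s :: "nat \<Rightarrow> real" and k :: "nat \<Rightarrow> nat"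
  assume s: "\<And>i. i < M \<Longrightarrow> s i \<le> s (Suc i)"
  have "hits (\<lambda>n. frac (\<theta> n)) N b c x = hits \<theta> N b c x" for N b c x by (simp add: hits_def arc_fun_frac)
  then show "(\<lambda>N. measure circ {x. \<forall>i<M. hits (\<lambda>n. frac (\<theta> n)) N (s i / real N) (s (Suc i) / real N) x = k i})
     \<longlonglongrightarrow> (\<Prod>i<M. pois (s (Suc i) - s i) (k i))"
    using joint_poisson[of \<theta> M s k, OF assms s] by simp
qed (auto simp: frac_lt_1)

text \<open>Countably many integer translates of a null set of the unit interval form a null set.\<close>

lemma AE_lborel_of_AE_circ:
  assumes AE: "AE x in circ. P x" and per: "\<And>x k. P (x + of_int k) \<Longrightarrow> P x"
  shows "AE x in lborel. P x"
proof -
  have "AE x in lborel. x \<in> {0..<1} \<longrightarrow> P x"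
    using AE unfolding circ_def by (subst (asm) AE_uniform_measure) auto
  then obtain X where X: "{x. \<not> (x \<in> {0..<1} \<longrightarrow> P x)} \<subseteq> X" "X \<in> null_sets lborel"
    by (auto simp: eventually_ae_filter)
  have [measurable]: "X \<in> sets borel" using X(2) by auto
  have "AE x in lborel. x \<notin> X" using X(2) by (rule AE_not_in)
  then have "AE x in lborel. of_int k + 1 * x \<notin> X" for k :: int
    by (intro AE_borel_affine) auto
  then have "AE x in lborel. \<forall>k::int. of_int k + 1 * x \<notin> X" by (simp add: AE_all_countable)
  then show ?thesis
  proof eventually_elim
    case (elim x)
    have "of_int (- \<lfloor>x\<rfloor>) + 1 * x = frac x" by (simp add: frac_def)
    with elim have "frac x \<notin> X" by metis
    moreover have "frac x \<in> {0..<1}" using frac_lt_1[of x] by simp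
    ultimately have "P (frac x)" using X(1) by blast
    then show ?case using per[of x "- \<lfloor>x\<rfloor>"] by (simp add: frac_def)
  qed
qed

theorem theorem1p1:
  fixes a :: "nat \<Rightarrow> int"
  assumes "lacunary a"
  shows "AE \<alpha> in lborel.
    (let \<theta> = (\<lambda>n. frac (\<alpha> * real_of_int (a n))) in
      (\<forall>j\<ge>1. \<forall>A B::real. 0 \<le> A \<and> A \<le> B \<longrightarrow>
        (\<lambda>N. real (card {n \<in> {1..N - j}. jth_spacing \<theta> N j n \<in> {A..B}}) / real N)
          \<longlonglongrightarrow> integral {A..B} (\<lambda>s. s ^ (j - 1) / fact (j - 1) * exp (- s))) \<and>
      (\<forall>r\<ge>1. \<forall>A B::nat \<Rightarrow> real. (\<forall>i\<in>{1..r}. 0 \<le> A i \<and> A i \<le> B i) \<longrightarrow>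
        (\<lambda>N. real (card {n \<in> {1..N - r}. \<forall>i\<in>{1..r}. spacing \<theta> N (n + i - 1) \<in> {A i..B i}}) / real N)
          \<longlonglongrightarrow> (\<Prod>i=1..r. integral {A i..B i} (\<lambda>s. exp (- s)))) \<and>
      (\<forall>l::real. l > 0 \<longrightarrow> (\<forall>k::nat.
        (\<lambda>N. arc_prob \<theta> N (l / real N) k) \<longlonglongrightarrow> exp (- l) * l ^ k / fact k)))"
proof -
  have "AE \<alpha> in lborel. poisson_sequence (\<lambda>n. frac (\<alpha> * real_of_int (a n)))"
  proof (rule AE_lborel_of_AE_circ)
    show "AE \<alpha> in circ. poisson_sequence (\<lambda>n. frac (\<alpha> * real_of_int (a n)))"
      using AE_void_limit[OF assms]
    proof eventually_elim
      case (elim \<alpha>)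
      show ?case by (rule poisson_sequence_frac) (use elim in blast)
    qed
    fix \<alpha> :: real and k :: int
    have "frac ((\<alpha> + of_int k) * real_of_int (a n)) = frac (\<alpha> * real_of_int (a n))" for n
      by (simp add: distrib_right flip: of_int_mult)
    then show "poisson_sequence (\<lambda>n. frac ((\<alpha> + of_int k) * real_of_int (a n))) \<Longrightarrow>
      poisson_sequence (\<lambda>n. frac (\<alpha> * real_of_int (a n)))" by simp
  qed
  then show ?thesis
  proof eventually_elim
    case (elim \<alpha>)
    interpret poisson_sequence "\<lambda>n. frac (\<alpha> * real_of_int (a n))" by (rule elim)
    show ?case unfolding Let_def
      by (intro conjI allI impI jth_spacing_limit spacing_limit arc_prob_limit) auto
  qed
qed

end
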